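(* Let $Z\subset\mathbb{Q}$ be any set that is not thin in $\mathbb{Q}$. Then the set $$S_Z=\{[L]_{\cong}\in\operatorname{Sub}(\overline{\mathbb{Q}})/\!\cong\ :\ \text{some coinfinite } C\subseteq L\text{, universally definable in }L\text{, has } C\cap\mathbb{Q}=Z\}$$ is meager in $\operatorname{Sub}(\overline{\mathbb{Q}})/\!\cong$.
   Context: $\operatorname{Sub}(\overline{\mathbb{Q}})$ is the set of all subfields of a fixed algebraic closure $\overline{\mathbb{Q}}$ of $\mathbb{Q}$. It is regarded as a subset of the power set $2^{\overline{\mathbb{Q}}}$ (identifying subsets with characteristic functions) and carries the topology inherited from the product topology; a basis is given by the sets $U_{\vec a,\vec b}=\{L : a_1,\dots,a_n\in L,\ b_1,\dots,b_k\notin L\}$ for finite tuples $\vec a,\vec b$ from $\overline{\mathbb{Q}}$. $\operatorname{Sub}(\overline{\mathbb{Q}})/\!\cong$ is the set of field-isomorphism classes $[L]_{\cong}$ of members of $\operatorname{Sub}(\overline{\mathbb{Q}})$ (equivalently, the orbits under $\operatorname{Gal}(\overline{\mathbb{Q}}/\mathbb{Q})$), with the quotient topology. A set is meager if it is a countable union of nowhere dense sets. A subset of $L$ is coinfinite if its complement in $L$ is infinite. Definability: a subset $C\subseteq L$ is universally definable in the field $L$ if it is the set of $x\in L$ satisfying in $L$ a formula $\forall \vec Y\,\phi(X,\vec Y)$, where $\phi$ is a quantifier-free formula in the language of rings with parameters from $L$. Thin sets (Serre): for a field $K$ of characteristic $0$ and $n\ge1$, a subset $T\subseteq K^n=\mathbb{A}^n(K)$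 is thin if it is contained in a finite union of sets each of which is either (1) $V(K)$ for a proper Zariski-closed $V\subsetneq\mathbb{A}^n_K$, or (2) $\pi(W(K))$, where $W$ is an irreducible $K$-variety of dimension $n$ and $\pi:W\to\mathbb{A}^n_K$ is a dominant morphism of degree at least $2$. *)

theory Defs
  imports
    "HOL-Algebra.Algebraic_Closure_Type"
    "HOL-Analysis.Function_Topology"
    "HOL-Library.Extended_Nat"
begin

no_notation Polynomials.var (\<open>X\<index>\<close>)
no_notation eq_closure_of (\<open>closure'_of\<index>\<close>)

section \<open>General topology\<close>

definition nowhere_dense_in :: "'a topology \<Rightarrow> 'a set \<Rightarrow> bool" where
  "nowhere_dense_in X N \<longleftrightarrow> N \<subseteq> topspace X \<and> X interior_of (X closure_of N) = {}"

definition meager_in :: "'a topology \<Rightarrow> 'a set \<Rightarrow> bool" where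
  "meager_in X S \<longleftrightarrow> (\<exists>F. countable F \<and> (\<forall>N\<in>F. nowhere_dense_in X N) \<and> S = \<Union>F)"

definition quotient_topology :: "'a topology \<Rightarrow> ('a \<Rightarrow> 'b) \<Rightarrow> 'b topology" where
  "quotient_topology X f =
     topology (\<lambda>U. U \<subseteq> f ` topspace X \<and> openin X {x \<in> topspace X. f x \<in> U})"

lemma openin_quotient_topology:
  "openin (quotient_topology X f) U \<longleftrightarrow>
     U \<subseteq> f ` topspace X \<and> openin X {x \<in> topspace X. f x \<in> U}"
proof -
  have "istopology (\<lambda>U. U \<subseteq> f ` topspace X \<and> openin X {x \<in> topspace X. f x \<in> U})"
    unfolding istopology_def
  proof (intro conjI allI impI; (elim conjE)?)
    fix S T assume "openin X {x \<in> topspace X. f x \<in> S}" "openin X {x \<in> topspace X. f x \<in> T}"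
    moreover have "{x \<in> topspace X. f x \<in> S \<inter> T} =
        {x \<in> topspace X. f x \<in> S} \<inter> {x \<in> topspace X. f x \<in> T}" by auto
    ultimately show "openin X {x \<in> topspace X. f x \<in> S \<inter> T}" by auto
  next
    fix K assume *: "\<forall>S\<in>K. S \<subseteq> f ` topspace X \<and> openin X {x \<in> topspace X. f x \<in> S}"
    have "{x \<in> topspace X. f x \<in> \<Union>K} = (\<Union>S\<in>K. {x \<in> topspace X. f x \<in> S})" by auto
    with * show "openin X {x \<in> topspace X. f x \<in> \<Union>K}" by auto
  qed auto
  then show ?thesis
    by (simp add: quotient_topology_def)
qed

lemma quotient_map_quotient_topology: "quotient_map X (quotient_topology X f) f"
proof -
  have "{x \<in> topspace X. f x \<in> f ` topspace X} = topspace X" by auto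
  then have "openin (quotient_topology X f) (f ` topspace X)"
    by (simp add: openin_quotient_topology)
  moreover have "topspace (quotient_topology X f) \<subseteq> f ` topspace X"
    using openin_quotient_topology[of X f "topspace (quotient_topology X f)"] by simp
  ultimately have "topspace (quotient_topology X f) = f ` topspace X"
    by (simp add: openin_subset subset_antisym)
  then show ?thesis
    by (auto simp: quotient_map_def openin_quotient_topology)
qed

definition irreducible_in :: "'a topology \<Rightarrow> 'a set \<Rightarrow> bool" where
  "irreducible_in X S \<longleftrightarrow> S \<subseteq> topspace X \<and> S \<noteq> {} \<and>
     (\<forall>C D. closedin X C \<longrightarrow> closedin X D \<longrightarrow> S \<subseteq> C \<union> D \<longrightarrow> S \<subseteq> C \<or> S \<subseteq> D)"

definition krull_dim :: "'a topology \<Rightarrow> enat" where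
  "krull_dim X = Sup {enat n | n. \<exists>Z :: nat \<Rightarrow> 'a set.
     (\<forall>i\<le>n. closedin X (Z i) \<and> irreducible_in X (Z i)) \<and> (\<forall>i<n. Z i \<subset> Z (Suc i))}"


section \<open>The space of subfields of the algebraic closure of the rationals\<close>

type_synonym qbar = "rat alg_closure"

definition qbar_subfields :: "qbar set set" where
  "qbar_subfields = {L. subfield L ring_of_type_algebra}"

definition qbar_subfield_topology :: "qbar set topology" where
  "qbar_subfield_topology = pullback_topology qbar_subfields (\<lambda>L x. x \<in> L)
     (product_topology (\<lambda>_. discrete_topology (UNIV :: bool set)) UNIV)"

definition iso_class :: "qbar set \<Rightarrow> qbar set set" where
  "iso_class L = {L' \<in> qbar_subfields. is_ring_iso
     (ring_of_type_algebra\<lparr>carrier := L\<rparr>) (ring_of_type_algebra\<lparr>carrier := L'\<rparr>)}"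

definition qbar_iso_topology :: "qbar set set topology" where
  "qbar_iso_topology = quotient_topology qbar_subfield_topology iso_class"


section \<open>Universal definability in the language of rings\<close>

datatype (rterm_params: 'a) rterm =
    Param 'a
  | Var nat
  | Zero
  | One
  | Add "'a rterm" "'a rterm"
  | Minus "'a rterm"
  | Mult "'a rterm" "'a rterm"

datatype (qf_params: 'a) qf_formula =
    Equal "'a rterm" "'a rterm"
  | Negation "'a qf_formula"
  | Conjunction "'a qf_formula" "'a qf_formula"
  | Disjunction "'a qf_formula" "'a qf_formula"

primrec rterm_val :: "(nat \<Rightarrow> 'a::comm_ring_1) \<Rightarrow> 'a rterm \<Rightarrow> 'a" where
  "rterm_val e (Param a) = a"
| "rterm_val e (Var i) = e i"
| "rterm_val e Zero = 0"
| "rterm_val e One = 1"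
| "rterm_val e (Add s t) = rterm_val e s + rterm_val e t"
| "rterm_val e (Minus s) = - rterm_val e s"
| "rterm_val e (Mult s t) = rterm_val e s * rterm_val e t"

primrec qf_holds :: "(nat \<Rightarrow> 'a::comm_ring_1) \<Rightarrow> 'a qf_formula \<Rightarrow> bool" where
  "qf_holds e (Equal s t) \<longleftrightarrow> rterm_val e s = rterm_val e t"
| "qf_holds e (Negation \<phi>) \<longleftrightarrow> \<not> qf_holds e \<phi>"
| "qf_holds e (Conjunction \<phi> \<psi>) \<longleftrightarrow> qf_holds e \<phi> \<and> qf_holds e \<psi>"
| "qf_holds e (Disjunction \<phi> \<psi>) \<longleftrightarrow> qf_holds e \<phi> \<or> qf_holds e \<psi>"

text \<open>Variable 0 is the free variable \<open>X\<close>; all other variables (only finitely many of which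
  occur) are universally quantified over \<open>L\<close>. Since \<open>L\<close> is a subring of the ambient field, the
  values of terms in \<open>L\<close> agree with those in the ambient field.\<close>

definition universally_definable :: "'a::field set \<Rightarrow> 'a set \<Rightarrow> bool" where
  "universally_definable L C \<longleftrightarrow> (\<exists>\<phi>. qf_params \<phi> \<subseteq> L \<and>
     C = {x \<in> L. \<forall>e. e 0 = x \<longrightarrow> range e \<subseteq> L \<longrightarrow> qf_holds e \<phi>})"


section \<open>Varieties over a field of characteristic 0\<close>

text \<open>A variety over \<open>K\<close> is a reduced separated \<open>K\<close>-scheme of finite type. As \<open>K\<close> is perfect it
  is faithfully represented by its set of geometric points, the Zariski topology \<^emph>\<open>over K\<close> on that
  set (open sets are given by polynomials with coefficients in \<open>K\<close>; conjugate points are not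
  separated), and the regular functions defined over \<open>K\<close>. It is presented by a finite atlas of
  affine charts. Points of affine \<open>n\<close>-space are lists of length \<open>n\<close>.\<close>

inductive_set polyfun :: "nat \<Rightarrow> ('k::field_char_0 alg_closure list \<Rightarrow> 'k alg_closure) set"
  for n :: nat where
  const: "(\<lambda>_. to_ac c) \<in> polyfun n"
| coord: "i < n \<Longrightarrow> (\<lambda>x. x ! i) \<in> polyfun n"
| add: "p \<in> polyfun n \<Longrightarrow> q \<in> polyfun n \<Longrightarrow> (\<lambda>x. p x + q x) \<in> polyfun n"
| mult: "p \<in> polyfun n \<Longrightarrow> q \<in> polyfun n \<Longrightarrow> (\<lambda>x. p x * q x) \<in> polyfun n"

definition zariski :: "nat \<Rightarrow> 'k::field_char_0 alg_closure list topology" where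
  "zariski n = topology_generated_by {{x. length x = n \<and> p x \<noteq> 0} | p. p \<in> polyfun n}"

text \<open>\<open>f\<close> is regular on the locally closed set \<open>S\<close> in affine \<open>n\<close>-space: around every point of \<open>S\<close>
  it is a quotient of polynomials over \<open>K\<close>.\<close>

definition regular_on ::
  "nat \<Rightarrow> 'k::field_char_0 alg_closure list set \<Rightarrow>
   ('k alg_closure list \<Rightarrow> 'k alg_closure) \<Rightarrow> bool" where
  "regular_on n S f \<longleftrightarrow> (\<forall>x\<in>S. \<exists>p\<in>polyfun n. \<exists>q\<in>polyfun n. q x \<noteq> 0 \<and>
     (\<forall>y\<in>S. q y \<noteq> 0 \<longrightarrow> f y = p y / q y))"

text \<open>A chart \<open>(m, U, \<phi>)\<close> identifies the set \<open>U\<close> of points with the closed subset \<open>\<phi> ` U\<close>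
  of affine \<open>m\<close>-space.\<close>

type_synonym ('k, 'p) chart = "nat \<times> 'p set \<times> ('p \<Rightarrow> 'k alg_closure list)"

text \<open>The last condition says that the diagonal is closed, i.e. the variety is separated.\<close>

definition variety :: "('k::field_char_0, 'p) chart list \<Rightarrow> bool" where
  "variety W \<longleftrightarrow>
     (\<forall>(m, U, \<phi>) \<in> set W. inj_on \<phi> U \<and> closedin (zariski m) (\<phi> ` U)) \<and>
     (\<forall>(m, U, \<phi>) \<in> set W. \<forall>(m', U', \<phi>') \<in> set W.
        openin (subtopology (zariski m) (\<phi> ` U)) (\<phi> ` (U \<inter> U')) \<and>
        (\<forall>j<m'. regular_on m (\<phi> ` (U \<inter> U')) (\<lambda>v. \<phi>' (inv_into U \<phi> v) ! j)) \<and>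
        closedin (zariski (m + m')) ((\<lambda>x. \<phi> x @ \<phi>' x) ` (U \<inter> U')))"

definition geom_points :: "('k::field_char_0, 'p) chart list \<Rightarrow> 'p set" where
  "geom_points W = (\<Union>(m, U, \<phi>) \<in> set W. U)"

definition rational_points :: "('k::field_char_0, 'p) chart list \<Rightarrow> 'p set" where
  "rational_points W =
     {x \<in> geom_points W. \<forall>(m, U, \<phi>) \<in> set W. x \<in> U \<longrightarrow> set (\<phi> x) \<subseteq> range to_ac}"

text \<open>For a variety the open subsets of the charts form a basis of this topology.\<close>

definition variety_topology :: "('k::field_char_0, 'p) chart list \<Rightarrow> 'p topology" where
  "variety_topology W = topology_generated_by
     (\<Union>(m, U, \<phi>) \<in> set W. Collect (openin (pullback_topology U \<phi> (zariski m))))"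

definition regular_fun ::
  "('k::field_char_0, 'p) chart list \<Rightarrow> 'p set \<Rightarrow> ('p \<Rightarrow> 'k alg_closure) \<Rightarrow> bool" where
  "regular_fun W S f \<longleftrightarrow>
     (\<forall>(m, U, \<phi>) \<in> set W. regular_on m (\<phi> ` (S \<inter> U)) (\<lambda>v. f (inv_into U \<phi> v)))"

definition morphism ::
  "('k::field_char_0, 'p) chart list \<Rightarrow> ('k, 'q) chart list \<Rightarrow> ('p \<Rightarrow> 'q) \<Rightarrow> bool" where
  "morphism V W \<pi> \<longleftrightarrow> \<pi> ` geom_points V \<subseteq> geom_points W \<and>
     (\<forall>(m, U, \<phi>) \<in> set W.
        openin (variety_topology V) {x \<in> geom_points V. \<pi> x \<in> U} \<and>
        (\<forall>j<m. regular_fun V {x \<in> geom_points V. \<pi> x \<in> U} (\<lambda>x. \<phi> (\<pi> x) ! j)))"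

definition dominant ::
  "('k::field_char_0, 'p) chart list \<Rightarrow> ('k, 'q) chart list \<Rightarrow> ('p \<Rightarrow> 'q) \<Rightarrow> bool" where
  "dominant V W \<pi> \<longleftrightarrow> variety_topology W closure_of (\<pi> ` geom_points V) = geom_points W"

definition affine_space :: "nat \<Rightarrow> ('k::field_char_0, 'k alg_closure list) chart list" where
  "affine_space n = [(n, {x. length x = n}, id)]"


subsection \<open>Function fields and degrees\<close>

text \<open>For irreducible \<open>W\<close>: elements are regular functions on nonempty open sets, identified when
  they agree on the intersection of their domains.\<close>

definition local_funs ::
  "('k::field_char_0, 'p) chart list \<Rightarrow> ('p set \<times> ('p \<Rightarrow> 'k alg_closure)) set" where
  "local_funs W = {(S, f). openin (variety_topology W) S \<and> S \<noteq> {} \<and> regular_fun W S f}"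

definition local_rel ::
  "('k::field_char_0, 'p) chart list \<Rightarrow> ('p set \<times> ('p \<Rightarrow> 'k alg_closure)) rel" where
  "local_rel W = {((S, f), (T, g)). (S, f) \<in> local_funs W \<and> (T, g) \<in> local_funs W \<and>
     (\<forall>x \<in> S \<inter> T. f x = g x)}"

definition rational_fun ::
  "('k::field_char_0, 'p) chart list \<Rightarrow> 'p set \<Rightarrow> ('p \<Rightarrow> 'k alg_closure) \<Rightarrow>
   ('p set \<times> ('p \<Rightarrow> 'k alg_closure)) set" where
  "rational_fun W S f = local_rel W `` {(S, f)}"

definition function_field ::
  "('k::field_char_0, 'p) chart list \<Rightarrow> ('p set \<times> ('p \<Rightarrow> 'k alg_closure)) set ring" where
  "function_field W = \<lparr>
     carrier = local_funs W // local_rel W,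
     monoid.mult = (\<lambda>\<alpha> \<beta>. \<Union>(S, f)\<in>\<alpha>. \<Union>(T, g)\<in>\<beta>. rational_fun W (S \<inter> T) (\<lambda>x. f x * g x)),
     one = rational_fun W (geom_points W) (\<lambda>_. 1),
     ring.zero = rational_fun W (geom_points W) (\<lambda>_. 0),
     add = (\<lambda>\<alpha> \<beta>. \<Union>(S, f)\<in>\<alpha>. \<Union>(T, g)\<in>\<beta>. rational_fun W (S \<inter> T) (\<lambda>x. f x + g x)) \<rparr>"

text \<open>The image of the function field of \<open>W\<close> in that of \<open>V\<close> under a dominant morphism.\<close>

definition pullback_field ::
  "('k::field_char_0, 'p) chart list \<Rightarrow> ('k, 'q) chart list \<Rightarrow> ('p \<Rightarrow> 'q) \<Rightarrow>
   ('p set \<times> ('p \<Rightarrow> 'k alg_closure)) set set" where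
  "pullback_field V W \<pi> =
     {rational_fun V {x \<in> geom_points V. \<pi> x \<in> T} (\<lambda>x. g (\<pi> x)) | T g. (T, g) \<in> local_funs W}"

definition has_degree ::
  "('k::field_char_0, 'p) chart list \<Rightarrow> ('k, 'q) chart list \<Rightarrow> ('p \<Rightarrow> 'q) \<Rightarrow> nat \<Rightarrow> bool" where
  "has_degree V W \<pi> d \<longleftrightarrow> ring.dimension (function_field V) d (pullback_field V W \<pi>)
     (carrier (function_field V))"


section \<open>Thin sets\<close>

text \<open>Subsets of \<open>K\<^sup>n\<close> are sets of lists of length \<open>n\<close> over \<open>K\<close>.\<close>

definition thin_type1 :: "nat \<Rightarrow> 'k::field_char_0 list set \<Rightarrow> bool" where
  "thin_type1 n T \<longleftrightarrow> (\<exists>V. closedin (zariski n) V \<and> V \<noteq> {x. length x = n} \<and>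
     T = {a. map to_ac a \<in> V})"

text \<open>The point set of any variety over \<open>K\<close>, being a finite union of affine charts, injects into
  the lists over the algebraic closure of \<open>K\<close>; so up to isomorphism this type of points allows
  every variety.\<close>

definition thin_type2 :: "nat \<Rightarrow> 'k::field_char_0 list set \<Rightarrow> bool" where
  "thin_type2 n T \<longleftrightarrow>
     (\<exists>(W :: ('k, 'k alg_closure list) chart list) \<pi> d.
        variety W \<and> irreducible_in (variety_topology W) (geom_points W) \<and>
        krull_dim (variety_topology W) = enat n \<and>
        morphism W (affine_space n) \<pi> \<and> dominant W (affine_space n) \<pi> \<and>
        has_degree W (affine_space n) \<pi> d \<and> d \<ge> 2 \<and>
        T = {a. map to_ac a \<in> \<pi> ` rational_points W})"

definition thin :: "nat \<Rightarrow> 'k::field_char_0 list set \<Rightarrow> bool" where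
  "thin n T \<longleftrightarrow> T \<subseteq> {a. length a = n} \<and>
     (\<exists>F. finite F \<and> (\<forall>S\<in>F. thin_type1 n S \<or> thin_type2 n S) \<and> T \<subseteq> \<Union>F)"

end

theory Submission
  imports Defs
begin


section \<open>Elementary field theory: subfields, algebraic elements and simple extensions\<close>

section \<open>Subfields of a field type\<close>

text \<open>There are only countably many formulas with parameters in the countable field
  \<open>qbar\<close>, and the set in question is the union, over all formulas phi, of the sets of
  classes [L] such that phi, read universally, defines in L a coinfinite set C whose rational points
  are Z. So it suffices that each of these sets is nowhere dense
  (\<open>nowhere_dense_formula\<close>).

  Let L be such a field in the basic open set given by finite sets A (to be contained) and B (to be
  avoided). Suppose that some field N in the same basic open set contains a witness that a point z
  of Z violates the universal formula. Adjoining the finitely many entries of the witness to A gives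
  a smaller nonempty basic open set; in none of its members can phi define a set containing z, so
  there it never cuts out Z (\<open>avoid_formula\<close>). The heart of the proof is the
  construction of N in \<open>specialise_witness\<close>.

  The complement of C in L is infinite. Infinitely many of its points, each with a witness, form in
  an ultrapower of \<open>qbar\<close> a nonstandard point x with a witness, all inside the
  ultrapower *L. Being nonstandard, x is transcendental over the rationals. Let F be the field
  generated by x, the witness and A. A transcendence basis of F that starts with x is mapped, one
  element at a time, to sequences of rationals from Z, in such a way that the field generated by the
  images stays relatively algebraically closed in *Q. That this is possible is the Gilmore-Robinson
  form of Hilbert irreducibility (\<open>hilbertian_specialisation\<close>). The remaining
  generators of F are algebraic over the basis; adjoining their images both to the image field and,
  coordinatewise, to the internal field *Q yields an internal field *N in which the image of F is
  still relatively algebraically closed (\<open>rel_alg_closed_adj_algebraic\<close>,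
  \<open>partial_embedding_algebraic\<close>). The embedding fixes standard elements. Hence a
  standard b in *N, being algebraic over the rationals, lies in the image of F, so in F, so in *L,
  so in L. Thus almost every coordinate N_n of *N contains A, misses B and contains a witness above
  a point of Z.

  Non-thinness supplies the arithmetic (\<open>not_thin_imp_hilbertian_set\<close>). If m(t,y) is
  monic in y without root in Q[t], each prime factor of m defines an irreducible plane curve whose
  projection to the t-line has degree at least 2. So the z for which m(z,y) has a rational root form
  a thin set. This rests on a computation of the dimension and function field of such a curve.

  Finally, isomorphism classes are orbits of automorphisms of \<open>qbar\<close>, the quotient map
  is open, and a formula has only finitely many conjugates, all of which can be avoided at once
  (\<open>avoid_formulas\<close>).\<close>

abbreviation subfld :: "'a::field set \<Rightarrow> bool" where
  "subfld K \<equiv> subfield K ring_of_type_algebra"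

lemma ring_of_type_algebra_simps [simp]:
  "carrier ring_of_type_algebra = UNIV"
  "x \<otimes>\<^bsub>ring_of_type_algebra\<^esub> y = x * y" "x \<oplus>\<^bsub>ring_of_type_algebra\<^esub> y = x + y"
  "\<one>\<^bsub>ring_of_type_algebra\<^esub> = 1" "\<zero>\<^bsub>ring_of_type_algebra\<^esub> = 0"
  by (simp_all add: ring_of_type_algebra_def)

lemma a_inv_ring_of_type_algebra [simp]:
  "\<ominus>\<^bsub>ring_of_type_algebra\<^esub> x = - (x :: 'a::field)"
proof -
  interpret R: field "ring_of_type_algebra :: 'a ring" by rule
  show ?thesis using R.minus_equality[of "- x" x] by simp
qed

lemma m_inv_ring_of_type_algebra [simp]:
  "x \<noteq> 0 \<Longrightarrow> inv\<^bsub>ring_of_type_algebra\<^esub> x = inverse (x :: 'a::field)"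
proof -
  interpret R: field "ring_of_type_algebra :: 'a ring" by rule
  assume "x \<noteq> 0"
  then show ?thesis using R.inv_unique'[of x "inverse x"] by simp
qed

lemma subfldI:
  fixes K :: "'a::field set"
  assumes "1 \<in> K" "\<And>x y. x \<in> K \<Longrightarrow> y \<in> K \<Longrightarrow> x - y \<in> K" "\<And>x y. x \<in> K \<Longrightarrow> y \<in> K \<Longrightarrow> x * y \<in> K"
    "\<And>x. x \<in> K \<Longrightarrow> x \<noteq> 0 \<Longrightarrow> inverse x \<in> K"
  shows "subfld K"
proof -
  interpret R: field "ring_of_type_algebra :: 'a ring" by rule
  have 0: "0 \<in> K" using assms(2)[OF assms(1) assms(1)] by simp
  have m: "- x \<in> K" if "x \<in> K" for x using assms(2)[OF 0 that] by simp
  have p: "x + y \<in> K" if "x \<in> K" "y \<in> K" for x y using assms(2)[OF that(1) m[OF that(2)]] by simp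
  show ?thesis
    by (rule R.subfieldI'[OF R.subringI]) (use assms m p in auto)
qed

context
  fixes K :: "'a::field set"
  assumes K: "subfld K"
begin

lemma subfld_1 [simp, intro]: "1 \<in> K"
  and subfld_0 [simp, intro]: "0 \<in> K"
  and subfld_uminus [intro]: "x \<in> K \<Longrightarrow> - x \<in> K"
  and subfld_add [intro]: "x \<in> K \<Longrightarrow> y \<in> K \<Longrightarrow> x + y \<in> K"
  and subfld_mult [intro]: "x \<in> K \<Longrightarrow> y \<in> K \<Longrightarrow> x * y \<in> K"
  using subringE(2,3,5,6,7)[OF subfieldE(1)[OF K]] by auto

lemma subfld_diff [intro]: "x \<in> K \<Longrightarrow> y \<in> K \<Longrightarrow> x - y \<in> K"
  using subfld_add[of x "- y"] subfld_uminus by simp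

lemma subfld_inverse [intro]: "x \<in> K \<Longrightarrow> inverse x \<in> K"
proof (cases "x = 0")
  case False
  interpret R: field "ring_of_type_algebra :: 'a ring" by rule
  assume "x \<in> K"
  with False show ?thesis using R.subfield_m_inv(1)[OF K, of x] by simp
qed (use subfld_0 in simp)

lemma subfld_divide [intro]: "x \<in> K \<Longrightarrow> y \<in> K \<Longrightarrow> x / y \<in> K"
  unfolding divide_inverse by (blast intro: subfld_mult subfld_inverse)

lemma subfld_power [intro]: "x \<in> K \<Longrightarrow> x ^ n \<in> K"
  by (induction n) (auto intro: subfld_mult)

lemma subfld_sum [intro]: "(\<And>i. i \<in> I \<Longrightarrow> f i \<in> K) \<Longrightarrow> sum f I \<in> K"
  by (induction I rule: infinite_finite_induct) (auto intro: subfld_add)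

lemma subfld_prod [intro]: "(\<And>i. i \<in> I \<Longrightarrow> f i \<in> K) \<Longrightarrow> prod f I \<in> K"
  by (induction I rule: infinite_finite_induct) (auto intro: subfld_mult)

lemma subfld_of_nat [intro]: "of_nat n \<in> K"
  by (induction n) (auto intro: subfld_add)

lemma subfld_of_int [intro]: "of_int n \<in> K"
  by (cases n rule: int_diff_cases) (auto intro: subfld_diff subfld_of_nat)

end

lemma subfld_Rats_subset:
  fixes K :: "'a::field_char_0 set"
  shows "subfld K \<Longrightarrow> \<rat> \<subseteq> K"
  by (auto elim!: Rats_cases' intro!: subfld_divide subfld_of_int)

lemma subfld_Rats: "subfld (\<rat> :: 'a::field_char_0 set)"
  by (rule subfldI) auto

lemma subfld_UNIV: "subfld (UNIV :: 'a::field set)"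
  by (rule subfldI) auto

section \<open>Polynomials over a subfield\<close>

definition polys_over :: "'a::zero set \<Rightarrow> 'a poly set" where
  "polys_over K = {p. \<forall>i. coeff p i \<in> K}"

lemma polys_overD: "p \<in> polys_over K \<Longrightarrow> coeff p i \<in> K"
  by (simp add: polys_over_def)

lemma polys_over_iff_coeffs: "0 \<in> K \<Longrightarrow> p \<in> polys_over K \<longleftrightarrow> set (coeffs p) \<subseteq> K"
  using range_coeff[of p] image_subset_iff[of "coeff p" UNIV K] by (simp add: polys_over_def)

lemma polys_over_mono: "K \<subseteq> L \<Longrightarrow> polys_over K \<subseteq> polys_over L"
  by (auto simp: polys_over_def)

lemma polys_over_Int: "polys_over (K \<inter> L) = polys_over K \<inter> polys_over L"
  by (auto simp: polys_over_def)

context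
  fixes K :: "'a::field set"
  assumes K: "subfld K"
begin

lemma polys_over_const [simp]: "[:c:] \<in> polys_over K \<longleftrightarrow> c \<in> K"
  using subfld_0[OF K] by (force simp: polys_over_def coeff_pCons split: nat.splits)

lemma polys_over_0 [intro]: "0 \<in> polys_over K"
  using subfld_0[OF K] by (auto simp: polys_over_def)

lemma polys_over_1 [intro]: "1 \<in> polys_over K"
  using subfld_0[OF K] subfld_1[OF K] by (auto simp: polys_over_def coeff_1)

lemma polys_over_pCons [simp]: "pCons c p \<in> polys_over K \<longleftrightarrow> c \<in> K \<and> p \<in> polys_over K"
  by (auto simp: polys_over_def coeff_pCons split: nat.splits)

lemma polys_over_add [intro]: "p \<in> polys_over K \<Longrightarrow> q \<in> polys_over K \<Longrightarrow> p + q \<in> polys_over K"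
  using K by (auto simp: polys_over_def)

lemma polys_over_uminus [intro]: "p \<in> polys_over K \<Longrightarrow> - p \<in> polys_over K"
  using K by (auto simp: polys_over_def)

lemma polys_over_diff [intro]: "p \<in> polys_over K \<Longrightarrow> q \<in> polys_over K \<Longrightarrow> p - q \<in> polys_over K"
  using K by (auto simp: polys_over_def)

lemma polys_over_mult [intro]: "p \<in> polys_over K \<Longrightarrow> q \<in> polys_over K \<Longrightarrow> p * q \<in> polys_over K"
  using K by (auto simp: polys_over_def coeff_mult)

lemma polys_over_power [intro]: "p \<in> polys_over K \<Longrightarrow> p ^ n \<in> polys_over K"
  by (induction n) (auto intro: polys_over_mult)

lemma polys_over_smult [intro]: "c \<in> K \<Longrightarrow> p \<in> polys_over K \<Longrightarrow> smult c p \<in> polys_over K"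
  using K by (auto simp: polys_over_def)

lemma polys_over_monom [intro]: "c \<in> K \<Longrightarrow> monom c n \<in> polys_over K"
  using K by (auto simp: polys_over_def)

lemma polys_over_sum [intro]: "(\<And>i. i \<in> I \<Longrightarrow> f i \<in> polys_over K) \<Longrightarrow> sum f I \<in> polys_over K"
  by (induction I rule: infinite_finite_induct) (auto intro: polys_over_add)

lemma polys_over_prod [intro]: "(\<And>i. i \<in> I \<Longrightarrow> f i \<in> polys_over K) \<Longrightarrow> prod f I \<in> polys_over K"
  by (induction I rule: infinite_finite_induct) (auto intro: polys_over_mult)

lemma polys_over_pderiv [intro]: "p \<in> polys_over K \<Longrightarrow> pderiv p \<in> polys_over K"
  using K by (auto simp: polys_over_def coeff_pderiv simp del: of_nat_Suc)

lemma polys_over_pcompose [intro]: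
  "p \<in> polys_over K \<Longrightarrow> q \<in> polys_over K \<Longrightarrow> pcompose p q \<in> polys_over K"
  by (induction p) (auto simp: pcompose_pCons intro!: polys_over_add polys_over_mult)

lemma poly_in_subfld [intro]: "p \<in> polys_over K \<Longrightarrow> x \<in> K \<Longrightarrow> poly p x \<in> K"
  using K by (induction p) auto

end

lemma polys_over_division:
  fixes K :: "'a::field set"
  assumes K: "subfld K" and f: "f \<in> polys_over K" "f \<noteq> 0" and "g \<in> polys_over K"
  shows "\<exists>q\<in>polys_over K. \<exists>r\<in>polys_over K. g = f * q + r \<and> (r = 0 \<or> degree r < degree f)"
  using assms(4)
proof (induction "degree g" arbitrary: g rule: less_induct)
  case less
  show ?case
  proof (cases "g = 0 \<or> degree g < degree f")
    case True
    then show ?thesis using less.prems polys_over_0[OF K] by (intro bexI[of _ 0] bexI[of _ g]) auto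
  next
    case False
    define c where "c = monom (lead_coeff g / lead_coeff f) (degree g - degree f)"
    have c: "c \<in> polys_over K"
      unfolding c_def using less.prems f K by (intro polys_over_monom subfld_divide) (auto simp: polys_over_def)
    have dc: "degree (f * c) = degree g" "c \<noteq> 0"
    proof -
      have "lead_coeff g / lead_coeff f \<noteq> 0" using False f by simp
      then have "degree c = degree g - degree f" "c \<noteq> 0"
        unfolding c_def by (rule degree_monom_eq) (use \<open>lead_coeff g / lead_coeff f \<noteq> 0\<close> in simp)
      then show "c \<noteq> 0" "degree (f * c) = degree g"
        using False f by (auto simp: degree_mult_eq)
    qed
    have "lead_coeff c = lead_coeff g / lead_coeff f" unfolding c_def by (rule lead_coeff_monom)
    then have lc: "lead_coeff (f * c) = lead_coeff g"
      using f(2) by (simp only: lead_coeff_mult) simp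
    define g' where "g' = g - f * c"
    have g': "g' \<in> polys_over K" unfolding g'_def using c f less.prems K by auto
    show ?thesis
    proof (cases "g' = 0")
      case True
      then show ?thesis using c polys_over_0[OF K] by (intro bexI[of _ c] bexI[of _ 0]) (auto simp: g'_def)
    next
      case ne: False
      have "degree g' < degree g"
      proof -
        have "degree g' \<le> degree g" unfolding g'_def using dc by (metis degree_diff_le order_refl)
        moreover have "coeff g' (degree g) = 0" using lc dc by (simp add: g'_def)
        ultimately show ?thesis using ne by (metis le_neq_implies_less leading_coeff_0_iff)
      qed
      from less.hyps[OF this g'] obtain q r where qr: "q \<in> polys_over K" "r \<in> polys_over K"
        "g' = f * q + r" "r = 0 \<or> degree r < degree f" by blast
      then show ?thesis using c K
        by (intro bexI[of _ "q + c"] bexI[of _ r]) (auto simp: g'_def algebra_simps)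
    qed
  qed
qed

text \<open>Newton interpolation: peeling off one interpolation point lowers the degree.\<close>

lemma polys_over_interpolation:
  fixes g :: "'a::field poly"
  assumes K: "subfld K" and "finite S" "S \<subseteq> K" "degree g < card S" "\<And>s. s \<in> S \<Longrightarrow> poly g s \<in> K"
  shows "g \<in> polys_over K"
  using assms(2-)
proof (induction S arbitrary: g rule: finite_induct)
  case (insert s S)
  show ?case
  proof (cases "degree g = 0")
    case True
    then obtain c where "g = [:c:]" by (metis degree_eq_zeroE)
    then show ?thesis using insert.prems(3)[of s] K polys_over_0[OF K] by simp
  next
    case False
    define q where "q = synthetic_div g s"
    have g: "g = [:poly g s:] + [:-s, 1:] * q"
      unfolding q_def using synthetic_div_correct'[of s g] by (simp add: add.commute)
    have "q \<in> polys_over K"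
    proof (rule insert.IH)
      show "degree q < card S" using insert.prems(2) insert.hyps False
        by (simp add: q_def degree_synthetic_div)
      fix t assume t: "t \<in> S"
      then have "t \<noteq> s" using insert.hyps by auto
      have "poly g t = poly g s + (t - s) * poly q t" by (subst g) (simp add: algebra_simps)
      then have "poly q t = (poly g t - poly g s) / (t - s)" using \<open>t \<noteq> s\<close> by simp
      also have "\<dots> \<in> K"
        using insert.prems t K by (intro subfld_divide subfld_diff) auto
      finally show "poly q t \<in> K" .
    qed (use insert.prems in auto)
    then show ?thesis
      using insert.prems K by (subst g) (intro polys_over_add polys_over_mult, auto)
  qed
qed simp


section \<open>Algebraic elements\<close>

definition acl :: "'a::field set \<Rightarrow> 'a set" where
  "acl K = {x. \<exists>p\<in>polys_over K. p \<noteq> 0 \<and> poly p x = 0}"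

lemma aclI: "p \<in> polys_over K \<Longrightarrow> p \<noteq> 0 \<Longrightarrow> poly p x = 0 \<Longrightarrow> x \<in> acl K"
  by (auto simp: acl_def)

lemma acl_mono: "K \<subseteq> L \<Longrightarrow> acl K \<subseteq> acl L"
  using polys_over_mono[of K L] by (fastforce simp: acl_def)

lemma acl_base: "subfld K \<Longrightarrow> K \<subseteq> acl K"
  by (auto intro!: aclI[of "[:- x, 1:]" for x])

lemma eval_ring_of_type_algebra:
  "ring.eval ring_of_type_algebra p (x::'a::field) = poly (Poly (rev p)) x"
proof -
  interpret R: field "ring_of_type_algebra :: 'a ring" by rule
  have pw: "x [^]\<^bsub>ring_of_type_algebra\<^esub> n = x ^ n" for n
    by (induction n) (auto simp: mult.commute)
  show ?thesis
    by (induction p) (auto simp: Poly_append poly_monom pw)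
qed

lemma algebraic_over_iff_acl:
  fixes x :: "'a::field"
  assumes K: "subfld K"
  shows "(ring.algebraic ring_of_type_algebra over K) x \<longleftrightarrow> x \<in> acl K"
proof -
  interpret R: field "ring_of_type_algebra :: 'a ring" by rule
  have sr: "subring K ring_of_type_algebra" using subfieldE(1)[OF K] .
  show ?thesis
  proof
    assume "(R.algebraic over K) x"
    from R.algebraicE[OF sr _ this] obtain p where
      p: "p \<in> carrier (K[X]\<^bsub>ring_of_type_algebra\<^esub>)" "p \<noteq> []" "R.eval p x = 0" by auto
    have sub: "set p \<subseteq> K" "hd p \<noteq> 0"
      using p(1,2) by (auto simp: univ_poly_def polynomial_def)
    show "x \<in> acl K"
    proof (rule aclI)
      show "Poly (rev p) \<in> polys_over K"
        using sub(1) subfld_0[OF K] by (auto simp: polys_over_def nth_default_def) (metis set_rev nth_mem length_rev subset_eq)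
      show "Poly (rev p) \<noteq> 0"
      proof
        assume "Poly (rev p) = 0"
        then have "coeff (Poly (rev p)) (length p - 1) = 0" by simp
        then have "hd p = 0" using p(2)
          by (simp add: nth_default_def rev_nth hd_conv_nth)
        then show False using sub by simp
      qed
      show "poly (Poly (rev p)) x = 0" using p(3) eval_ring_of_type_algebra[of p x] by simp
    qed
  next
    assume "x \<in> acl K"
    then obtain p where p: "p \<in> polys_over K" "p \<noteq> 0" "poly p x = 0" by (auto simp: acl_def)
    show "(R.algebraic over K) x"
    proof (rule R.algebraicI)
      show "rev (coeffs p) \<noteq> []" using p by simp
      show "rev (coeffs p) \<in> carrier (K[X]\<^bsub>ring_of_type_algebra\<^esub>)"
        using p by (auto simp: univ_poly_def polynomial_def hd_rev last_coeffs_eq_coeff_degree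
            polys_over_def coeffs_def)
      show "R.eval (rev (coeffs p)) x = \<zero>\<^bsub>ring_of_type_algebra\<^esub>"
        using p eval_ring_of_type_algebra[of "rev (coeffs p)" x] by simp
    qed
  qed
qed

lemma subfld_acl: "subfld K \<Longrightarrow> subfld (acl (K :: 'a::field set))"
proof -
  interpret R: field "ring_of_type_algebra :: 'a ring" by rule
  assume "subfld K"
  then show ?thesis
    using R.subfield_of_algebraics[of K] algebraic_over_iff_acl[of K] by simp
qed

text \<open>The finitely many coefficients of a polynomial over \<open>acl K\<close> generate a
  finite extension of K. Adjoining a root keeps the dimension over K finite, and elements of a ring
  of finite dimension over K are algebraic over K.\<close>

lemma acl_acl: 
  fixes K :: "'a::field set"
  assumes K: "subfld K"
  shows "acl (acl K) = acl K"
proof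
  interpret R: field "ring_of_type_algebra :: 'a ring" by rule
  show "acl K \<subseteq> acl (acl K)" by (intro acl_base subfld_acl K)
  show "acl (acl K) \<subseteq> acl K"
  proof
    fix x assume "x \<in> acl (acl K)"
    then obtain p where p: "p \<in> polys_over (acl K)" "p \<noteq> 0" "poly p x = 0" by (auto simp: acl_def)
    define cs where "cs = coeffs p"
    have alg: "(R.algebraic over K) c" if "c \<in> set cs" for c
      using that p(1) algebraic_over_iff_acl[OF K] subfld_0[OF subfld_acl[OF K]]
      by (auto simp: cs_def polys_over_iff_coeffs)
    define E where "E = R.finite_extension K cs"
    have E: "subfld E" unfolding E_def
      by (rule R.finite_extension_is_subfield[OF K]) (use alg in auto)
    have fd: "R.finite_dimension K E" unfolding E_def
      by (rule R.finite_extension_finite_dimension(1)[OF K]) (use alg in auto)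
    have "set cs \<subseteq> E" unfolding E_def
      by (rule R.finite_extension_mem) (use subfieldE(1)[OF K] in auto)
    then have "p \<in> polys_over E"
      using subfld_0[OF E] by (simp add: polys_over_iff_coeffs cs_def)
    then have "x \<in> acl E" using p by (intro aclI)
    then have xE: "(R.algebraic over E) x" using algebraic_over_iff_acl[OF E] by simp
    define E' where "E' = R.simple_extension E x"
    have "R.finite_dimension E E'" unfolding E'_def
      using R.finite_dimension_simple_extension[OF E] xE by simp
    then have fd': "R.finite_dimension K E'"
      using R.telescopic_base_dim(1)[OF K E fd] by simp
    have "subring E' ring_of_type_algebra" unfolding E'_def
      by (rule R.simple_extension_is_subring) (use subfieldE(1)[OF E] in auto)
    moreover have "x \<in> E'" unfolding E'_def
      by (rule R.simple_extension_mem) (use subfieldE(1)[OF E] in auto)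
    ultimately have "(R.algebraic over K) x"
      using R.finite_dimension_imp_algebraic[OF K _ fd'] by simp
    then show "x \<in> acl K" using algebraic_over_iff_acl[OF K] by simp
  qed
qed


subsection \<open>Minimal polynomials\<close>

lemma monic_root_degree: "lead_coeff f = 1 \<Longrightarrow> poly f a = 0 \<Longrightarrow> degree f \<noteq> 0"
  for f :: "'a::comm_ring_1 poly"
  by (metis degree_eq_zeroE degree_pCons_0 coeff_pCons_0 mult_zero_right add_0_right poly_0 poly_pCons zero_neq_one)

definition minpoly_over :: "'a::field set \<Rightarrow> 'a poly \<Rightarrow> 'a \<Rightarrow> bool" where
  "minpoly_over K f x \<longleftrightarrow> f \<in> polys_over K \<and> lead_coeff f = 1 \<and> poly f x = 0 \<and>
     (\<forall>g\<in>polys_over K. g \<noteq> 0 \<longrightarrow> poly g x = 0 \<longrightarrow> degree f \<le> degree g)"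

lemma minpoly_over_exists:
  fixes K :: "'a::field set"
  assumes K: "subfld K" and "x \<in> acl K"
  obtains f where "minpoly_over K f x"
proof -
  obtain p where p: "p \<in> polys_over K" "p \<noteq> 0" "poly p x = 0"
    using assms(2) by (auto simp: acl_def)
  define P where "P = (\<lambda>p. p \<in> polys_over K \<and> p \<noteq> 0 \<and> poly p x = 0)"
  define g where "g = arg_min degree P"
  have g: "P g" and min: "\<And>q. P q \<Longrightarrow> degree g \<le> degree q"
    using arg_min_nat_lemma[of P p degree] p unfolding g_def P_def by auto
  have "minpoly_over K (smult (inverse (lead_coeff g)) g) x"
    using g min K unfolding minpoly_over_def P_def
    by (auto intro!: polys_over_smult subfld_inverse simp: polys_overD)
  then show thesis by (rule that)
qed

lemma minpoly_over_dvd: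
  fixes K :: "'a::field set"
  assumes K: "subfld K" and f: "minpoly_over K f x" and g: "g \<in> polys_over K" "poly g x = 0"
  shows "\<exists>q\<in>polys_over K. g = f * q"
proof -
  have f0: "f \<in> polys_over K" "f \<noteq> 0" "poly f x = 0" using f by (auto simp: minpoly_over_def)
  obtain q r where qr: "q \<in> polys_over K" "r \<in> polys_over K" "g = f * q + r" "r = 0 \<or> degree r < degree f"
    using polys_over_division[OF K f0(1,2) g(1)] by blast
  have "poly r x = 0" using qr(3) g(2) f0(3) by simp
  with qr f have "r = 0" by (force simp: minpoly_over_def)
  with qr show ?thesis by auto
qed

text \<open>A minimal polynomial is irreducible, so it is the minimal polynomial of all of its roots.\<close>

lemma minpoly_over_root:
  fixes K :: "'a::field set"
  assumes K: "subfld K" and f: "minpoly_over K f x" and y: "poly f y = 0"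
  shows "minpoly_over K f y"
proof -
  have f0: "f \<in> polys_over K" "f \<noteq> 0" "poly f x = 0" "lead_coeff f = 1"
    using f by (auto simp: minpoly_over_def)
  then have "y \<in> acl K" using y by (intro aclI)
  then obtain m where m: "minpoly_over K m y" using minpoly_over_exists[OF K] by blast
  then have m0: "m \<in> polys_over K" "m \<noteq> 0" "poly m y = 0" "lead_coeff m = 1" 
    by (auto simp: minpoly_over_def)
  have "degree m \<noteq> 0" using m0 monic_root_degree by blast
  from minpoly_over_dvd[OF K m f0(1) y] obtain q where q: "q \<in> polys_over K" "f = m * q" by blast
  have "q \<noteq> 0" using q f0 by auto
  then have deg: "degree f = degree m + degree q" using q m0 by (simp add: degree_mult_eq)
  have "poly q x \<noteq> 0"
  proof
    assume "poly q x = 0"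
    then have "degree f \<le> degree q" using f q \<open>q \<noteq> 0\<close> by (auto simp: minpoly_over_def)
    then show False using deg \<open>degree m \<noteq> 0\<close> by simp
  qed
  then have "poly m x = 0" using q f0 by simp
  then have "degree f \<le> degree m" using f m0 by (auto simp: minpoly_over_def)
  then have "degree q = 0" using deg by simp
  moreover have "lead_coeff q = 1" using q f0 m0 by (simp add: lead_coeff_mult)
  ultimately have "q = 1" by (metis degree_eq_zeroE lead_coeff_pCons(2) one_pCons)
  then show ?thesis using q m by simp
qed

text \<open>Separability in characteristic 0: f is minimal at each of its roots, and its derivative
  is nonzero of lower degree.\<close>

lemma minpoly_over_pderiv:
  fixes K :: "'a::field_char_0 set"
  assumes K: "subfld K" and f: "minpoly_over K f x" and a: "poly f a = 0"
  shows "poly (pderiv f) a \<noteq> 0"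
proof
  assume a': "poly (pderiv f) a = 0"
  have m: "minpoly_over K f a" using minpoly_over_root[OF K f a] .
  then have f0: "f \<in> polys_over K" "lead_coeff f = 1" by (auto simp: minpoly_over_def)
  have d: "degree f \<noteq> 0" using a f0 monic_root_degree by blast
  then have "pderiv f \<noteq> 0" by (simp add: pderiv_eq_0_iff)
  moreover have "pderiv f \<in> polys_over K" using f0 K by auto
  ultimately have "degree f \<le> degree (pderiv f)" using m a' by (auto simp: minpoly_over_def)
  then show False using d by (simp add: degree_pderiv)
qed


section \<open>Simple extensions\<close>

text \<open>Fractions are allowed, so that the same set is K(x) for algebraic and for transcendental
  x.\<close>

definition adj :: "'a::field set \<Rightarrow> 'a \<Rightarrow> 'a set" where
  "adj K x = {poly p x / poly q x | p q. p \<in> polys_over K \<and> q \<in> polys_over K \<and> poly q x \<noteq> 0}"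

lemma poly_in_adj:
  fixes K :: "'a::field set"
  assumes K: "subfld K" and p: "p \<in> polys_over K"
  shows "poly p x \<in> adj K x"
proof -
  have "poly p x = poly p x / poly 1 x" by simp
  then show ?thesis unfolding adj_def using p polys_over_1[OF K] by fastforce
qed

lemma adj_base: "subfld K \<Longrightarrow> K \<subseteq> adj K x"
  using poly_in_adj[of K "[:c:]" x for c] by auto

lemma adj_gen: "subfld K \<Longrightarrow> x \<in> adj K x"
  using poly_in_adj[of K "[:0,1:]" x] by (simp add: subfld_1 subfld_0 polys_over_0)

lemma subfld_adj: 
  fixes K :: "'a::field set"
  assumes K: "subfld K"
  shows "subfld (adj K x)"
proof (rule subfldI)
  show "1 \<in> adj K x" using adj_base[OF K] K by auto
next
  fix u v assume "u \<in> adj K x" "v \<in> adj K x"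
  then obtain p q p' q' where *: "p \<in> polys_over K" "q \<in> polys_over K" "poly q x \<noteq> 0" "u = poly p x / poly q x"
    "p' \<in> polys_over K" "q' \<in> polys_over K" "poly q' x \<noteq> 0" "v = poly p' x / poly q' x"
    by (auto simp: adj_def)
  have "u - v = poly (p * q' - p' * q) x / poly (q * q') x" using * by (simp add: diff_frac_eq)
  then show "u - v \<in> adj K x" unfolding adj_def using * K by fastforce
  have "u * v = poly (p * p') x / poly (q * q') x" using * by simp
  then show "u * v \<in> adj K x" unfolding adj_def using * K by fastforce
next
  fix u assume "u \<in> adj K x" "u \<noteq> 0"
  then show "inverse u \<in> adj K x" unfolding adj_def by fastforce
qed

lemma adj_least:
  fixes K :: "'a::field set"
  assumes K: "subfld L" "K \<subseteq> L" "x \<in> L"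
  shows "adj K x \<subseteq> L"
  unfolding adj_def using polys_over_mono[OF K(2)]
  by (auto intro!: subfld_divide[OF K(1)] poly_in_subfld[OF K(1) _ K(3)])

lemma adj_mono: "K \<subseteq> L \<Longrightarrow> adj K x \<subseteq> adj L x"
  using polys_over_mono[of K L] by (auto simp: adj_def)

lemma countable_polys_over: "countable K \<Longrightarrow> countable (polys_over K)"
proof -
  assume "countable K"
  then have "countable (Poly ` lists K)" by auto
  moreover have "polys_over K \<subseteq> Poly ` lists K"
  proof
    fix p assume "p \<in> polys_over K"
    then have "coeffs p \<in> lists K" by (auto simp: polys_over_def coeffs_def)
    then show "p \<in> Poly ` lists K" by (intro image_eqI[of _ _ "coeffs p"]) auto
  qed
  ultimately show ?thesis by (rule countable_subset[rotated])
qed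

lemma countable_adj: 
  assumes "countable K"
  shows "countable (adj K x)"
proof -
  have "adj K x \<subseteq> (\<lambda>(p,q). poly p x / poly q x) ` (polys_over K \<times> polys_over K)"
    by (auto simp: adj_def)
  then show ?thesis
    by (rule countable_subset) (use countable_polys_over[OF assms] in auto)
qed

text \<open>Denominators disappear: if c + v s(v) = 0 is the minimal equation of v = q(x), then c is
  nonzero and 1/v = -s(v)/c is a polynomial in x. Reduction modulo f then bounds the degree.\<close>

lemma adj_algebraic:
  fixes K :: "'a::field set"
  assumes K: "subfld K" and f: "minpoly_over K f x" and u: "u \<in> adj K x"
  shows "\<exists>g\<in>polys_over K. (g = 0 \<or> degree g < degree f) \<and> u = poly g x"
proof -
  from u obtain p q where pq: "p \<in> polys_over K" "q \<in> polys_over K" "poly q x \<noteq> 0" "u = poly p x / poly q x"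
    by (auto simp: adj_def)
  have f0: "f \<in> polys_over K" "f \<noteq> 0" "poly f x = 0" using f by (auto simp: minpoly_over_def)
  define v where "v = poly q x"
  have "x \<in> acl K" using f0 by (rule aclI)
  then have "v \<in> acl K"
    unfolding v_def using pq(2) polys_over_mono[OF acl_base[OF K]] poly_in_subfld[OF subfld_acl[OF K]] by blast
  then obtain r where r: "minpoly_over K r v" using minpoly_over_exists[OF K] by blast
  then have r0: "r \<in> polys_over K" "r \<noteq> 0" "poly r v = 0" by (auto simp: minpoly_over_def)
  obtain c s where cs: "r = pCons c s" by (metis pCons_cases)
  then have s: "c \<in> K" "s \<in> polys_over K" "c + v * poly s v = 0" using r0 K by auto
  have "c \<noteq> 0"
  proof
    assume "c = 0"
    then have "poly s v = 0" "s \<noteq> 0" using s pq cs r0 by (auto simp: v_def)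
    then have "degree r \<le> degree s" using r s by (auto simp: minpoly_over_def)
    then show False using cs \<open>s \<noteq> 0\<close> by simp
  qed
  have inv: "1 / v = poly (smult (- 1 / c) (pcompose s q)) x"
    using s(3) \<open>c \<noteq> 0\<close> pq(3) by (simp add: poly_pcompose v_def[symmetric] field_simps) (metis add.commute add_eq_0_iff)
  define g where "g = p * smult (- 1 / c) (pcompose s q)"
  have g: "g \<in> polys_over K"
    unfolding g_def using pq s K
    by (intro polys_over_mult polys_over_smult polys_over_pcompose subfld_divide subfld_uminus) auto
  have ug: "u = poly g x"
    using pq(4) inv by (simp add: g_def v_def[symmetric] divide_inverse)
  obtain a b where ab: "a \<in> polys_over K" "b \<in> polys_over K" "g = f * a + b" "b = 0 \<or> degree b < degree f"
    using polys_over_division[OF K f0(1,2) g] by blast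
  have "u = poly b x" using ug ab f0 by simp
  then show ?thesis using ab by blast
qed

lemma adj_subset_acl: 
  fixes K :: "'a::field set"
  shows "subfld K \<Longrightarrow> x \<in> acl K \<Longrightarrow> adj K x \<subseteq> acl K"
  by (intro adj_least subfld_acl acl_base)


section \<open>Relative algebraic closure and its behaviour under simple extensions\<close>

section \<open>Relatively algebraically closed subfields\<close>

text \<open>Closure is taken in the ambient field. In characteristic 0 this says that K is a regular
  extension of k, the property preserved throughout the construction.\<close>

definition rel_alg_closed :: "'a::field set \<Rightarrow> 'a set \<Rightarrow> bool" where
  "rel_alg_closed k K \<longleftrightarrow> subfld k \<and> subfld K \<and> k \<subseteq> K \<and> acl k \<inter> K \<subseteq> k"

lemma rel_alg_closed_subset:
  "rel_alg_closed k K \<Longrightarrow> subfld L \<Longrightarrow> k \<subseteq> L \<Longrightarrow> L \<subseteq> K \<Longrightarrow> rel_alg_closed k L"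
  by (auto simp: rel_alg_closed_def)

lemma polys_over_splitting:
  fixes f :: "'a::alg_closed_field poly"
  assumes A: "subfld A" and f: "lead_coeff f = 1" "\<And>x. poly f x = 0 \<Longrightarrow> x \<in> A"
  shows "f \<in> polys_over A"
proof -
  have "f \<noteq> 0" using f(1) by auto
  from alg_closed_imp_factorization[OF this] obtain B where
    B: "f = smult (lead_coeff f) (\<Prod>x\<in>#B. [:-x, 1:])" by blast
  have "x \<in> A" if "x \<in># B" for x
  proof (rule f(2))
    have "poly (\<Prod>x\<in>#B. [:-x, 1:]) x = 0" using that
      by (induction B) auto
    then show "poly f x = 0" by (subst B) simp
  qed
  then have "(\<Prod>x\<in>#B. [:-x, 1:]) \<in> polys_over A"
    by (induction B)
       (use A in \<open>auto simp: polys_over_1 polys_over_0 simp del: mult_pCons_left intro!: polys_over_mult subfld_uminus\<close>)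
  then show ?thesis using B f by simp
qed

text \<open>A linear factor occurring twice in the factorisation of f would make the derivative
  vanish at its root.\<close>

lemma card_roots_rsquarefree:
  fixes f :: "'a::alg_closed_field poly"
  assumes f: "f \<noteq> 0" and nodouble: "\<And>x. poly f x = 0 \<Longrightarrow> poly (pderiv f) x \<noteq> 0"
  shows "card {x. poly f x = 0} = degree f"
proof -
  from alg_closed_imp_factorization[OF f] obtain B where
    B: "size B = degree f" "f = smult (lead_coeff f) (\<Prod>x\<in>#B. [:-x, 1:])" by blast
  have roots: "{x. poly f x = 0} = set_mset B"
  proof -
    have "poly (\<Prod>x\<in>#B. [:-x, 1:]) y = 0 \<longleftrightarrow> y \<in># B" for y by (induction B) auto
    then show ?thesis using f by (subst B(2)) auto
  qed
  have "count B x = 1" if x: "x \<in># B" for x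
  proof (rule ccontr)
    assume "count B x \<noteq> 1"
    obtain B1 where B1: "B = add_mset x B1" using x by (metis insert_DiffM)
    with \<open>count B x \<noteq> 1\<close> have "x \<in># B1" by (auto simp: count_eq_zero_iff)
    then obtain B2 where B2: "B1 = add_mset x B2" by (metis insert_DiffM)
    define g where "g = smult (lead_coeff f) (\<Prod>x\<in>#B2. [:-x, 1:])"
    have "f = [:-x, 1:] * ([:-x, 1:] * g)"
      by (subst B(2)) (simp add: B1 B2 g_def del: mult_pCons_left)
    then have "poly f x = 0" "poly (pderiv f) x = 0"
      by (simp_all add: pderiv_mult del: mult_pCons_left)
    then show False using nodouble by blast
  qed
  then have "size B = card (set_mset B)" by (simp add: size_multiset_overloaded_eq)
  then show ?thesis using B roots by simp
qed

text \<open>If \<open>b = g(\<theta>)\<close> is algebraic over \<open>k\<close> then so are the values of \<open>g\<close> at all conjugates of \<open>\<theta>\<close>,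
  hence, by interpolation, so are the coefficients of \<open>g\<close>.\<close>

lemma rel_alg_closed_adj_algebraic:
  fixes k K :: "'a::{alg_closed_field,field_char_0} set"
  assumes rac: "rel_alg_closed k K" and x: "x \<in> acl k"
  shows "rel_alg_closed (adj k x) (adj K x)"
proof -
  have k: "subfld k" and K: "subfld K" and kK: "k \<subseteq> K" and cl: "acl k \<inter> K \<subseteq> k"
    using rac by (auto simp: rel_alg_closed_def)
  have A: "subfld (acl k)" using subfld_acl[OF k] .
  have "x \<in> acl K" using x acl_mono[OF kK] by blast
  then obtain f where f: "minpoly_over K f x" using minpoly_over_exists[OF K] by blast
  then have f0: "f \<in> polys_over K" "f \<noteq> 0" "poly f x = 0" "lead_coeff f = 1" by (auto simp: minpoly_over_def)
  obtain m where m: "m \<in> polys_over k" "m \<noteq> 0" "poly m x = 0" using x by (auto simp: acl_def)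
  have fm: "\<exists>q\<in>polys_over K. m = f * q"
    using minpoly_over_dvd[OF K f _ m(3)] m polys_over_mono[OF kK] by blast
  have roots: "y \<in> acl k" if "poly f y = 0" for y
    using fm that m by (intro aclI[of m]) auto
  \<comment> \<open>By separability f has as many distinct roots as its degree, just enough points
    to determine g, whose degree is smaller.\<close>
  have card: "card {y. poly f y = 0} = degree f"
    using minpoly_over_pderiv[OF K f] by (intro card_roots_rsquarefree f0)
  have fin: "finite {y. poly f y = 0}" using poly_roots_finite[OF f0(2)] .
  have "acl (adj k x) \<inter> adj K x \<subseteq> adj k x"
  proof
    fix b assume "b \<in> acl (adj k x) \<inter> adj K x"
    moreover have "acl (adj k x) \<subseteq> acl k"
      using acl_mono[OF adj_subset_acl[OF k x]] acl_acl[OF k] by simp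
    ultimately have b: "b \<in> acl k" "b \<in> adj K x" by auto
    from adj_algebraic[OF K f b(2)] obtain g where
      g: "g \<in> polys_over K" "g = 0 \<or> degree g < degree f" "b = poly g x" by blast
    obtain \<mu> where \<mu>: "\<mu> \<in> polys_over k" "\<mu> \<noteq> 0" "poly \<mu> b = 0" using b by (auto simp: acl_def)
    have "pcompose \<mu> g \<in> polys_over K"
      using \<mu>(1) g(1) polys_over_mono[OF kK] by (intro polys_over_pcompose K) auto
    from minpoly_over_dvd[OF K f this] obtain q where q: "pcompose \<mu> g = f * q"
      using \<mu>(3) g(3) by (auto simp: poly_pcompose)
    have val: "poly g y \<in> acl k" if "poly f y = 0" for y
    proof (rule aclI[OF \<mu>(1,2)])
      have "poly \<mu> (poly g y) = poly (f * q) y" using q by (metis poly_pcompose)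
      then show "poly \<mu> (poly g y) = 0" using that by simp
    qed
    have "degree g < degree f" using g(2) monic_root_degree[OF f0(4,3)] by auto
    then have "g \<in> polys_over (acl k)"
      using roots val card fin by (intro polys_over_interpolation[OF A fin]) auto
    then have "g \<in> polys_over k"
      using g(1) polys_over_Int[of "acl k" K] polys_over_mono[OF cl] by auto
    then show "b \<in> adj k x" using poly_in_adj[OF k] g(3) by blast
  qed
  then show ?thesis
    unfolding rel_alg_closed_def using subfld_adj k K adj_mono[OF kK] by blast
qed

lemma poly_poly_const: "poly (poly m p) c = poly (poly m [:poly p c:]) (c :: 'a::comm_ring_1)"
  by (induction m) auto

lemma poly_poly_const_in_polys_over:
  "poly (poly m [:v:]) c = poly (map_poly (\<lambda>q. poly q c) m) (v :: 'a::comm_ring_1)"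
  by (induction m) (auto simp: map_poly_pCons)

text \<open>Evaluate at enough points of \<open>k\<close> and interpolate.\<close>

lemma rel_alg_closed_poly_root:
  fixes k K :: "'a::field_char_0 set"
  assumes rac: "rel_alg_closed k K" and m: "m \<in> polys_over (polys_over k)" "lead_coeff m = 1"
    and p: "p \<in> polys_over K" "poly m p = 0"
  shows "p \<in> polys_over k"
proof -
  have k: "subfld k" and K: "subfld K" and kK: "k \<subseteq> K" and cl: "acl k \<inter> K \<subseteq> k"
    using rac by (auto simp: rel_alg_closed_def)
  \<comment> \<open>The numbers 0, ..., degree p are distinct in characteristic 0 and lie in every
    subfield, and there are enough of them for p. The empty set only fixes the type.\<close>
  define S where "S = of_nat ` {..degree p} \<union> ({} :: 'a set)"
  have S: "finite S" "card S = Suc (degree p)" "S \<subseteq> k"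
    using subfld_of_nat[OF k] by (auto simp: S_def card_image inj_on_def)
  show ?thesis
  proof (rule polys_over_interpolation[OF k S(1,3)])
    show "degree p < card S" using S by simp
    fix c assume "c \<in> S"
    then have c: "c \<in> k" using S by auto
    define f where "f = map_poly (\<lambda>q. poly q c) m"
    have "f \<in> polys_over k"
      using m(1) poly_in_subfld[OF k _ c] by (auto simp: f_def polys_over_def coeff_map_poly)
    moreover have "f \<noteq> 0"
    proof
      assume "f = 0"
      then have "coeff f (degree m) = 0" by simp
      then show False using m(2) by (simp add: f_def coeff_map_poly)
    qed
    moreover have "poly f (poly p c) = 0"
      using p(2) poly_poly_const[of m p c] by (simp add: f_def poly_poly_const_in_polys_over)
    ultimately have "poly p c \<in> acl k" by (rule aclI)
    moreover have "poly p c \<in> K" using poly_in_subfld[OF K p(1)] c kK by blast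
    ultimately show "poly p c \<in> k" using cl by blast
  qed
qed

text \<open>A monic equation m(z,v) = 0 forces m to have a root p in k[t]. Splitting off the factor
  y - p, either v = p(z), or v satisfies the quotient, which is again monic over k[t] and of lower
  degree.\<close>

lemma bivariate_root_in_adj:
  fixes k K :: "'a::field set"
  assumes k: "subfld k"
    and noroot: "\<And>m. m \<in> polys_over (polys_over k) \<Longrightarrow> lead_coeff m = 1 \<Longrightarrow>
       (\<forall>p\<in>polys_over k. poly m p \<noteq> 0) \<Longrightarrow> poly (poly m [:v:]) z \<noteq> 0"
    and m: "m \<in> polys_over (polys_over k)" "lead_coeff m = 1" "poly (poly m [:v:]) z = 0"
  shows "v \<in> adj k z"
  using m
proof (induction "degree m" arbitrary: m rule: less_induct)
  case less
  obtain p where p: "p \<in> polys_over k" "poly m p = 0" using noroot less.prems by blast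
  define q where "q = synthetic_div m p"
  have mq: "m = [:- p, 1:] * q" unfolding q_def using synthetic_div_correct'[of p m] p by simp
  have d: "degree m \<noteq> 0" using monic_root_degree less.prems p by blast
  have dq: "degree q < degree m" using d by (simp add: q_def degree_synthetic_div)
  have lq: "lead_coeff q = 1" using less.prems(2) mq by (metis lead_coeff_mult lead_coeff_pCons(1) lead_coeff_1 mult_1 one_neq_zero one_pCons pCons_eq_0_iff)
  have q: "q \<in> polys_over (polys_over k)"
  proof -
    \<comment> \<open>Downward induction from the leading coefficient 1, by q_i = m_(i+1) + p
      q_(i+1).\<close>
    have "coeff q i \<in> polys_over k" if "i \<le> degree q" for i
      using that
    proof (induction "degree q - i" arbitrary: i)
      case 0
      then show ?case using lq polys_over_1[OF k] by simp
    next
      case (Suc n)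
      have "coeff m (Suc i) = coeff q i - p * coeff q (Suc i)"
        by (subst mq) (simp add: coeff_pCons)
      then have "coeff q i = coeff m (Suc i) + p * coeff q (Suc i)" by simp
      moreover have "coeff q (Suc i) \<in> polys_over k" using Suc by auto
      ultimately show ?case using p less.prems(1) k by (auto simp: polys_overD)
    qed
    then show ?thesis using polys_over_0[OF k]
      by (auto simp: polys_over_def[of "polys_over k"]) (metis coeff_eq_0 not_le)
  qed
  have "poly (poly m [:v:]) z = (v - poly p z) * poly (poly q [:v:]) z"
    by (subst mq) (simp add: algebra_simps)
  then consider "v = poly p z" | "poly (poly q [:v:]) z = 0" using less.prems by auto
  then show ?case
  proof cases
    case 1
    then show ?thesis using poly_in_adj[OF k p(1)] by simp
  next
    case 2
    then show ?thesis using less.hyps[OF dq q lq] by simp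
  qed
qed

text \<open>Clearing denominators: a multiple of an algebraic element is integral over the polynomial ring.\<close>

lemma adj_integral_multiple:
  fixes k :: "'a::field set"
  assumes k: "subfld k" and u: "u \<in> acl (adj k z)"
  shows "\<exists>c m. c \<in> polys_over k \<and> poly c z \<noteq> 0 \<and> m \<in> polys_over (polys_over k) \<and> lead_coeff m = 1 \<and>
    poly (poly m [:poly c z * u:]) z = 0"
proof -
  obtain P where P: "P \<in> polys_over (adj k z)" "P \<noteq> 0" "poly P u = 0" using u by (auto simp: acl_def)
  have "\<forall>i. \<exists>a b. a \<in> polys_over k \<and> b \<in> polys_over k \<and> poly b z \<noteq> 0 \<and> coeff P i = poly a z / poly b z"
    using polys_overD[OF P(1)] unfolding adj_def by blast
  then obtain a b where ab: "\<And>i. a i \<in> polys_over k" "\<And>i. b i \<in> polys_over k" "\<And>i. poly (b i) z \<noteq> 0"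
    "\<And>i. coeff P i = poly (a i) z / poly (b i) z" by metis
  define d where "d = degree P"
  \<comment> \<open>The coefficients a_i/b_i of P are multiplied by the product B of all
    denominators: a_i times the product of the other b_j.\<close>
  define e where "e i = a i * (\<Prod>j\<in>{..d} - {i}. b j)" for i
  define B where "B = (\<Prod>j\<le>d. poly (b j) z)"
  have B: "B \<noteq> 0" using ab(3) by (simp add: B_def)
  have e: "e i \<in> polys_over k" for i unfolding e_def using ab k by auto
  have ez: "poly (e i) z = B * coeff P i" if "i \<le> d" for i
  proof -
    have "B = poly (b i) z * (\<Prod>j\<in>{..d} - {i}. poly (b j) z)"
      unfolding B_def using that by (intro prod.remove) auto
    then show ?thesis using ab(3)[of i] by (simp add: e_def ab(4) poly_prod)
  qed
  define c where "c = e d"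
  have cz: "poly c z \<noteq> 0" using ez[of d] B P(2) by (simp add: c_def d_def)
  \<comment> \<open>Multiplying the equation with coefficients e_i for u by c^(d-1) gives the monic
    equation w^d + sum e_i c^(d-1-i) w^i = 0 for w = c u, where c = e_d is the leading
    coefficient.\<close>
  define m where "m = monom 1 d + (\<Sum>i<d. monom (e i * c ^ (d - 1 - i)) i)"
  have cm: "coeff m i = (if i = d then 1 else if i < d then e i * c ^ (d - 1 - i) else 0)" for i
    unfolding m_def by (simp add: coeff_sum)
  have dm: "degree m = d"
    by (rule antisym) (auto intro!: degree_le le_degree simp: cm)
  have "poly (poly m [:poly c z * u:]) z = (poly c z * u) ^ d + (\<Sum>i<d. poly (e i) z * poly c z ^ (d - 1 - i) * (poly c z * u) ^ i)"
    unfolding m_def by (simp add: poly_monom poly_sum poly_const_pow[symmetric] poly_power)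
  also have "(\<Sum>i<d. poly (e i) z * poly c z ^ (d - 1 - i) * (poly c z * u) ^ i) =
      (\<Sum>i<d. poly c z ^ (d - 1) * (poly (e i) z * u ^ i))"
  proof (rule sum.cong)
    fix i assume "i \<in> {..<d}"
    then have "d - 1 = (d - 1 - i) + i" by auto
    then have "poly c z ^ (d - 1) = poly c z ^ (d - 1 - i) * poly c z ^ i" by (metis power_add)
    then show "poly (e i) z * poly c z ^ (d - 1 - i) * (poly c z * u) ^ i = poly c z ^ (d - 1) * (poly (e i) z * u ^ i)"
      by (simp add: power_mult_distrib)
  qed simp
  also have "(poly c z * u) ^ d + \<dots> = poly c z ^ (d - 1) * (poly (e d) z * u ^ d + (\<Sum>i<d. poly (e i) z * u ^ i))"
  proof (cases "d = 0")
    \<comment> \<open>Here d - 1 truncates to 0, so the general computation fails; but then P is a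
      nonzero constant with a root, which is absurd.\<close>
    case True
    then have "P = [:coeff P 0:]" by (metis d_def degree_eq_zeroE coeff_pCons_0)
    then have "coeff P 0 = 0" using P(3) by (metis poly_const_conv)
    then show ?thesis using True P(2) \<open>P = _\<close> by simp
  next
    case False
    then have "poly c z ^ d = poly c z ^ (d - 1) * poly c z" by (metis power_minus_mult not_gr_zero)
    then show ?thesis by (simp add: c_def power_mult_distrib algebra_simps sum_distrib_left)
  qed
  also have "poly (e d) z * u ^ d + (\<Sum>i<d. poly (e i) z * u ^ i) = (\<Sum>i\<le>d. poly (e i) z * u ^ i)"
    by (simp add: lessThan_Suc_atMost[symmetric])
  also have "\<dots> = B * poly P u"
    by (simp add: ez poly_altdef[of P] sum_distrib_left d_def[symmetric] mult.assoc)
  finally have "poly (poly m [:poly c z * u:]) z = 0" using P(3) by simp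
  moreover have "m \<in> polys_over (polys_over k)"
    unfolding polys_over_def[of "polys_over k"] using e k cm
    by (auto simp: c_def polys_over_1 polys_over_0 intro!: polys_over_mult polys_over_power)
  ultimately show ?thesis using cz e dm cm[of d] by (intro exI[of _ c] exI[of _ m]) (auto simp: c_def)
qed

text \<open>An element u of K algebraic over k(z) becomes integral over k[z] after multiplication by
  some nonzero c(z). By the hypothesis on monic equations c(z) u lies in k(z), and so does u. Thus
  relative closedness of k(z) is reduced to countably many conditions on z when k is countable, one
  for each monic m without root in k[t].\<close>

lemma rel_alg_closed_adjI:
  fixes k K :: "'a::field set"
  assumes k: "subfld k" "subfld K" "k \<subseteq> K" "z \<in> K"
    and noroot: "\<And>m v. m \<in> polys_over (polys_over k) \<Longrightarrow> lead_coeff m = 1 \<Longrightarrow>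
       (\<forall>p\<in>polys_over k. poly m p \<noteq> 0) \<Longrightarrow> v \<in> K \<Longrightarrow> poly (poly m [:v:]) z \<noteq> 0"
  shows "rel_alg_closed (adj k z) K"
proof -
  have sub: "adj k z \<subseteq> K" by (intro adj_least k)
  have "u \<in> adj k z" if u: "u \<in> acl (adj k z)" "u \<in> K" for u
  proof -
    obtain c m where cm: "c \<in> polys_over k" "poly c z \<noteq> 0" "m \<in> polys_over (polys_over k)" "lead_coeff m = 1"
      "poly (poly m [:poly c z * u:]) z = 0" using adj_integral_multiple[OF k(1) u(1)] by blast
    have cz: "poly c z \<in> adj k z" using poly_in_adj[OF k(1) cm(1)] .
    then have "poly c z * u \<in> K" using sub u(2) k(2) by auto
    then have "poly c z * u \<in> adj k z"
      by (intro bivariate_root_in_adj[OF k(1) _ cm(3-5)] noroot)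
    then have "poly c z * u / poly c z \<in> adj k z" using cz by (intro subfld_divide subfld_adj k)
    then show ?thesis using cm(2) by simp
  qed
  then show ?thesis
    unfolding rel_alg_closed_def using sub subfld_adj k by blast
qed


section \<open>Ultrapowers of a field over a nonprincipal ultrafilter on the naturals\<close>

section \<open>Ultrapowers\<close>

text \<open>Zorn's lemma gives a minimal proper filter below F: finite meets in a chain of proper
  filters are members of the chain, so the infimum of the chain is proper. If the complement of P
  does not belong to the minimal filter, intersecting with P leaves it proper and hence, by
  minimality, unchanged.\<close>

lemma ultrafilter_exists:
  assumes "(F :: 'a filter) \<noteq> bot"
  shows "\<exists>U\<le>F. U \<noteq> bot \<and> (\<forall>P. eventually P U \<or> eventually (\<lambda>x. \<not> P x) U)"
proof -
  define A where "A = {G. G \<le> F \<and> G \<noteq> bot}"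
  have "\<exists>U\<in>A. \<forall>G\<in>A. G \<le> U \<longrightarrow> G = U"
  proof (rule predicate_Zorn[of A "\<lambda>G H. H \<le> G"])
    show "partial_order_on A (relation_of (\<lambda>G H. H \<le> G) A)"
      by (rule partial_order_on_relation_ofI) auto
    fix C assume "C \<in> Chains (relation_of (\<lambda>G H. H \<le> G) A)"
    then have C: "C \<subseteq> A" "\<And>G H. G \<in> C \<Longrightarrow> H \<in> C \<Longrightarrow> G \<le> H \<or> H \<le> G"
      by (auto simp: Chains_def relation_of_def)
    show "\<exists>U\<in>A. \<forall>G\<in>C. U \<le> G"
    proof (cases "C = {}")
      case True
      then show ?thesis using assms by (auto simp: A_def)
    next
      case False
      have "Inf X \<in> X" if "finite X" "X \<noteq> {}" "X \<subseteq> C" for X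
        using that
      proof (induction X rule: finite_ne_induct)
        case (insert G X)
        then consider "G \<le> Inf X" | "Inf X \<le> G" using C(2)[of G "Inf X"] by blast
        then show ?case
        proof cases
          case 1
          then have "Inf (insert G X) = G" by (simp only: Inf_insert inf.absorb1)
          then show ?thesis by simp
        next
          case 2
          then have "Inf (insert G X) = Inf X" by (simp only: Inf_insert inf.absorb2)
          then show ?thesis using insert by simp
        qed
      qed simp
      note * = this
      have top: "(top_class.top :: 'a filter) \<noteq> bot" using assms by (metis bot_unique top_greatest)
      have "Inf X \<noteq> bot" if X: "finite X" "X \<subseteq> C" for X
      proof (cases "X = {}")
        case True
        then show ?thesis using top by simp
      next
        case False
        then have "Inf X \<in> A" using *[OF X(1) False X(2)] X(2) C(1) by blast
        then show ?thesis by (simp add: A_def)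
      qed
      then have "Inf C \<noteq> bot" by (rule Inf_filter_not_bot)
      moreover have "Inf C \<le> F"
      proof -
        obtain G where G: "G \<in> C" using False by blast
        then have "G \<le> F" using C(1) by (auto simp: A_def)
        then show ?thesis using Inf_lower[OF G] by (rule order_trans[rotated])
      qed
      ultimately show ?thesis by (intro bexI[of _ "Inf C"] ballI Inf_lower) (simp_all add: A_def)
    qed
  qed
  then obtain U where U': "U \<in> A" and max': "\<forall>G\<in>A. G \<le> U \<longrightarrow> G = U" by blast
  have U: "U \<le> F" "U \<noteq> bot" using U' by (simp_all add: A_def)
  have max: "G = U" if "G \<noteq> bot" "G \<le> U" for G
    using max' that order_trans[OF that(2) U(1)] by (simp add: A_def)
  have "eventually P U \<or> eventually (\<lambda>x. \<not> P x) U" for P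
  proof (rule disjCI)
    assume "\<not> eventually (\<lambda>x. \<not> P x) U"
    then have "inf U (principal {x. P x}) \<noteq> bot"
      by (simp add: trivial_limit_def eventually_inf_principal)
    then have "inf U (principal {x. P x}) = U" by (intro max) auto
    then have "U \<le> principal {x. P x}" by (metis inf_le2)
    then show "eventually P U" by (simp add: le_principal)
  qed
  with U show ?thesis by blast
qed

definition ufilter :: "nat filter" where
  "ufilter = (SOME U. U \<le> sequentially \<and> U \<noteq> bot \<and> (\<forall>P. eventually P U \<or> eventually (\<lambda>x. \<not> P x) U))"

lemma ufilter_le: "ufilter \<le> sequentially"
  and ufilter_not_bot [simp]: "ufilter \<noteq> bot"
  and ufilter_ultra: "eventually P ufilter \<or> eventually (\<lambda>n. \<not> P n) ufilter"
  using someI_ex[OF ultrafilter_exists[of sequentially, OF sequentially_bot], folded ufilter_def] by blast+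

lemma eventually_ufilter_not_iff:
  "eventually (\<lambda>n. \<not> P n) ufilter \<longleftrightarrow> \<not> eventually P ufilter"
  using ufilter_ultra[of P] eventually_conj[of P ufilter "\<lambda>n. \<not> P n"] by auto

lemma eventually_ufilter_disj_iff:
  "eventually (\<lambda>n. P n \<or> Q n) ufilter \<longleftrightarrow> eventually P ufilter \<or> eventually Q ufilter"
proof -
  have "eventually (\<lambda>n. \<not> (P n \<or> Q n)) ufilter \<longleftrightarrow> \<not> eventually P ufilter \<and> \<not> eventually Q ufilter"
    by (simp add: eventually_conj_iff eventually_ufilter_not_iff)
  then show ?thesis by (simp only: eventually_ufilter_not_iff) blast
qed

lemma eventually_ufilter_bex_iff:
  "finite A \<Longrightarrow> eventually (\<lambda>n. \<exists>a\<in>A. P a n) ufilter \<longleftrightarrow> (\<exists>a\<in>A. eventually (P a) ufilter)"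
  by (induction A rule: finite_induct) (auto simp: eventually_ufilter_disj_iff)

lemma eventually_ufilter_ge: "eventually (\<lambda>n. n \<ge> m) ufilter"
  using ufilter_le eventually_ge_at_top filter_leD by blast

quotient_type 'a ultra = "nat \<Rightarrow> 'a" / "\<lambda>f g. \<forall>\<^sub>F n in ufilter. f n = g n"
  morphisms rep_ultra star
proof (rule equivpI)
  show "reflp (\<lambda>f g. \<forall>\<^sub>F n in ufilter. f n = g n)" by (simp add: reflp_def)
  show "symp (\<lambda>f g. \<forall>\<^sub>F n in ufilter. f n = g n)" by (simp add: symp_def eq_commute)
  show "transp (\<lambda>f g. \<forall>\<^sub>F n in ufilter. f n = g n)"
    by (rule transpI) (erule (1) eventually_elim2, simp)
qed

lemma star_eq_iff: "star f = star g \<longleftrightarrow> (\<forall>\<^sub>F n in ufilter. f n = g n)"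
  using ultra.abs_eq_iff by blast

lemma star_cases [case_names star, cases type: ultra]:
  obtains f where "u = star f"
  using ultra.abs_induct[of "\<lambda>u. \<exists>f. u = star f" u] by blast

instantiation ultra :: (field) field
begin

lift_definition zero_ultra :: "'a ultra" is "\<lambda>_. 0" .
lift_definition one_ultra :: "'a ultra" is "\<lambda>_. 1" .
lift_definition plus_ultra :: "'a ultra \<Rightarrow> 'a ultra \<Rightarrow> 'a ultra" is "\<lambda>f g n. f n + g n"
  by (erule (1) eventually_elim2) simp
lift_definition minus_ultra :: "'a ultra \<Rightarrow> 'a ultra \<Rightarrow> 'a ultra" is "\<lambda>f g n. f n - g n"
  by (erule (1) eventually_elim2) simp
lift_definition times_ultra :: "'a ultra \<Rightarrow> 'a ultra \<Rightarrow> 'a ultra" is "\<lambda>f g n. f n * g n"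
  by (erule (1) eventually_elim2) simp
lift_definition divide_ultra :: "'a ultra \<Rightarrow> 'a ultra \<Rightarrow> 'a ultra" is "\<lambda>f g n. f n / g n"
  by (erule (1) eventually_elim2) simp
lift_definition uminus_ultra :: "'a ultra \<Rightarrow> 'a ultra" is "\<lambda>f n. - f n"
  by (erule eventually_mono) simp
lift_definition inverse_ultra :: "'a ultra \<Rightarrow> 'a ultra" is "\<lambda>f n. inverse (f n)"
  by (erule eventually_mono) simp

instance
proof
  fix a b c :: "'a ultra"
  show "a * b * c = a * (b * c)" by transfer (simp add: mult.assoc)
  show "a * b = b * a" by transfer (simp add: mult.commute)
  show "1 * a = a" by transfer simp
  show "a + b + c = a + (b + c)" by transfer (simp add: add.assoc)
  show "a + b = b + a" by transfer (simp add: add.commute)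
  show "0 + a = a" by transfer simp
  show "- a + a = 0" by transfer simp
  show "a - b = a + - b" by transfer simp
  show "(a + b) * c = a * c + b * c" by transfer (simp add: distrib_right)
  show "(0 :: 'a ultra) \<noteq> 1" by transfer simp
  show "a div b = a * inverse b" by transfer (simp add: divide_inverse)
  show "inverse (0 :: 'a ultra) = 0" by transfer simp
  show "a \<noteq> 0 \<Longrightarrow> inverse a * a = 1"
  proof transfer
    fix f :: "nat \<Rightarrow> 'a" assume "\<not> (\<forall>\<^sub>F n in ufilter. f n = 0)"
    then have "\<forall>\<^sub>F n in ufilter. \<not> f n = 0" by (simp add: eventually_ufilter_not_iff)
    then show "\<forall>\<^sub>F n in ufilter. inverse (f n) * f n = 1" by (rule eventually_mono) simp
  qed
qed

end

lemma star_arith: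
  "star f + star g = star (\<lambda>n. f n + g n)" "star f - star g = star (\<lambda>n. f n - g n)"
  "star f * star g = star (\<lambda>n. f n * g n)" "star f / star g = star (\<lambda>n. f n / g n)"
  "- star f = star (\<lambda>n. - f n)" "inverse (star f) = star (\<lambda>n. inverse (f n))"
  by (simp_all add: plus_ultra.abs_eq minus_ultra.abs_eq times_ultra.abs_eq divide_ultra.abs_eq
      uminus_ultra.abs_eq inverse_ultra.abs_eq)

lemma star_0: "star (\<lambda>_. 0) = 0" and star_1: "star (\<lambda>_. 1) = 1"
  by (simp_all add: zero_ultra_def one_ultra_def)

lemma star_eq_0_iff: "star f = 0 \<longleftrightarrow> (\<forall>\<^sub>F n in ufilter. f n = 0)"
  by (simp add: star_eq_iff flip: star_0)

lemma star_sum: "(\<Sum>i\<in>I. star (f i)) = star (\<lambda>n. \<Sum>i\<in>I. f i n)"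
  by (induction I rule: infinite_finite_induct) (auto simp: star_arith star_0)

lemma star_power: "star f ^ k = star (\<lambda>n. f n ^ k)"
  by (induction k) (auto simp: star_arith star_1)

definition cst :: "'a \<Rightarrow> 'a ultra" where "cst a = star (\<lambda>_. a)"

lemma cst_eq_iff [simp]: "cst a = cst b \<longleftrightarrow> a = b"
  by (simp add: cst_def star_eq_iff)

lemma cst_simps [simp]: "cst 0 = 0" "cst 1 = 1" "cst (a + b) = cst a + cst b" "cst (a * b) = cst a * cst b"
  "cst (- a) = - cst a" "cst (a - b) = cst a - cst b" "cst (inverse a) = inverse (cst a)" "cst (a / b) = cst a / cst b"
  by (simp_all add: cst_def star_arith star_0 star_1)

lemma cst_eq_0_iff [simp]: "cst a = 0 \<longleftrightarrow> a = 0"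
  using cst_eq_iff[of a 0] by (simp del: cst_eq_iff)

lemma cst_of_nat [simp]: "cst (of_nat k) = of_nat k" by (induction k) simp_all

lemma cst_sum: "cst (sum f A) = (\<Sum>x\<in>A. cst (f x))"
  by (induction A rule: infinite_finite_induct) auto

lemma cst_power [simp]: "cst (a ^ k) = cst a ^ k" by (induction k) simp_all

lemma poly_cst: "poly (map_poly cst p) (cst x) = cst (poly p x)"
  by (induction p) (auto simp: map_poly_pCons)

instance ultra :: (field_char_0) field_char_0
proof
  show "inj (of_nat :: nat \<Rightarrow> 'a ultra)"
    by (rule injI) (metis cst_of_nat cst_eq_iff of_nat_eq_iff)
qed

lemma cst_of_int [simp]: "cst (of_int k) = of_int k" by (cases k rule: int_diff_cases) simp

lemma cst_of_rat [simp]: "cst (of_rat q) = of_rat q"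
  by (cases q) (simp add: of_rat_rat)

instance ultra :: (alg_closed_field) alg_closed_field
proof
  fix p :: "'a ultra poly" assume p: "lead_coeff p = 1" "degree p > 0"
  define u where "u = coeff p"
  define N where "N = degree p"
  have N: "N > 0" "u N \<noteq> 0" using p by (simp_all add: u_def N_def)
  define f where "f k = rep_ultra (u k)" for k
  have f: "u k = star (f k)" for k unfolding f_def by (simp add: Quotient3_abs_rep[OF Quotient3_ultra])
  \<comment> \<open>The equation is solved in each coordinate. Where the leading coefficient
    vanishes nothing is demanded of x; such indices are negligible.\<close>
  have "\<forall>n. \<exists>x. f N n \<noteq> 0 \<longrightarrow> (\<Sum>k\<le>N. f k n * x ^ k) = 0"
  proof
    fix n show "\<exists>x. f N n \<noteq> 0 \<longrightarrow> (\<Sum>k\<le>N. f k n * x ^ k) = 0"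
      using alg_closed[OF N(1), of "\<lambda>k. f k n"] by auto
  qed
  then obtain x where x: "\<And>n. f N n \<noteq> 0 \<Longrightarrow> (\<Sum>k\<le>N. f k n * x n ^ k) = 0" by metis
  have "\<forall>\<^sub>F n in ufilter. f N n \<noteq> 0"
    using N(2) by (simp add: f star_eq_0_iff eventually_ufilter_not_iff)
  then have "\<forall>\<^sub>F n in ufilter. (\<Sum>k\<le>N. f k n * x n ^ k) = 0" by (rule eventually_mono) (rule x)
  then have "(\<Sum>k\<le>N. u k * star x ^ k) = 0"
    by (simp add: f star_power star_arith star_sum star_eq_0_iff)
  then show "\<exists>y. poly p y = 0" by (auto simp: poly_altdef u_def N_def)
qed

subsection \<open>Internal subsets\<close>

definition star_set :: "(nat \<Rightarrow> 'a set) \<Rightarrow> 'a ultra set" where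
  "star_set N = {star f | f. \<forall>\<^sub>F n in ufilter. f n \<in> N n}"

lemma star_in_star_set: "star f \<in> star_set N \<longleftrightarrow> (\<forall>\<^sub>F n in ufilter. f n \<in> N n)"
proof
  assume "star f \<in> star_set N"
  then obtain g where "star f = star g" "\<forall>\<^sub>F n in ufilter. g n \<in> N n" by (auto simp: star_set_def)
  then show "\<forall>\<^sub>F n in ufilter. f n \<in> N n"
    unfolding star_eq_iff by (rule eventually_elim2) simp
qed (auto simp: star_set_def)

lemma cst_in_star_set: "cst a \<in> star_set N \<longleftrightarrow> (\<forall>\<^sub>F n in ufilter. a \<in> N n)"
  by (simp add: cst_def star_in_star_set)

text \<open>The representative is changed at the negligible indices where it leaves
  \<open>N n\<close>, so that membership holds at every index.\<close>

lemma star_setD: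
  assumes "u \<in> star_set N" "\<And>n. N n \<noteq> {}"
  shows "\<exists>f. u = star f \<and> (\<forall>n. f n \<in> N n)"
proof -
  obtain f where f: "u = star f" "\<forall>\<^sub>F n in ufilter. f n \<in> N n" using assms by (auto simp: star_set_def)
  define g where "g n = (if f n \<in> N n then f n else SOME a. a \<in> N n)" for n
  have "star f = star g" unfolding star_eq_iff
    using f(2) by (rule eventually_mono) (simp add: g_def)
  moreover have "g n \<in> N n" for n using assms(2) by (auto simp: g_def some_in_eq)
  ultimately show ?thesis using f(1) by blast
qed

lemma subfld_star_set:
  fixes N :: "nat \<Rightarrow> 'a::field set"
  assumes N: "\<And>n. subfld (N n)"
  shows "subfld (star_set N)"
proof -
  have ne: "N n \<noteq> {}" for n using subfld_0[OF N] by blast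
  show ?thesis
  proof (rule subfldI)
    show "1 \<in> star_set N" using cst_in_star_set[of 1 N] subfld_1[OF N] by simp
  next
    fix x y assume x: "x \<in> star_set N" and y: "y \<in> star_set N"
    obtain f where f: "x = star f" "\<And>n. f n \<in> N n" using star_setD[OF x ne] by blast
    obtain g where g: "y = star g" "\<And>n. g n \<in> N n" using star_setD[OF y ne] by blast
    show "x - y \<in> star_set N"
      unfolding f g star_arith star_in_star_set
      by (rule always_eventually) (intro allI subfld_diff N f g)
    show "x * y \<in> star_set N"
      unfolding f g star_arith star_in_star_set
      by (rule always_eventually) (intro allI subfld_mult N f g)
  next
    fix x assume x: "x \<in> star_set N"
    obtain f where f: "x = star f" "\<And>n. f n \<in> N n" using star_setD[OF x ne] by blast
    show "inverse x \<in> star_set N"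
      unfolding f star_arith star_in_star_set
      by (rule always_eventually) (intro allI subfld_inverse N f)
  qed
qed

text \<open>An internal simple extension by an element algebraic of bounded degree is the external one.\<close>

lemma star_set_adj_subset:
  fixes N :: "nat \<Rightarrow> 'a::field set"
  assumes N: "\<And>n. subfld (N n)" and w: "star w \<in> acl (star_set N)"
  shows "star_set (\<lambda>n. adj (N n) (w n)) \<subseteq> adj (star_set N) (star w)"
proof
  have ne: "N n \<noteq> {}" for n using subfld_0[OF N] by blast
  have M: "subfld (star_set N)" using subfld_star_set[OF N] .
  fix u assume u: "u \<in> star_set (\<lambda>n. adj (N n) (w n))"
  have "adj (N n) (w n) \<noteq> {}" for n using subfld_0[OF subfld_adj[OF N]] by blast
  from star_setD[OF u this] obtain a where a: "u = star a" "\<And>n. a n \<in> adj (N n) (w n)" by blast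
  obtain p where p: "p \<in> polys_over (star_set N)" "p \<noteq> 0" "poly p (star w) = 0"
    using w by (auto simp: acl_def)
  define d where "d = degree p"
  have "\<exists>f. coeff p i = star f \<and> (\<forall>n. f n \<in> N n)" for i
    using star_setD[OF polys_overD[OF p(1)] ne] .
  then obtain c where c: "\<And>i. coeff p i = star (c i)" "\<And>i n. c i n \<in> N n" by metis
  have lc: "\<forall>\<^sub>F n in ufilter. c d n \<noteq> 0"
  proof -
    have "star (c d) \<noteq> 0" using p(2) c(1)[of d] by (metis d_def leading_coeff_0_iff)
    then show ?thesis by (simp add: star_eq_0_iff eventually_ufilter_not_iff)
  qed
  have "poly p (star w) = star (\<lambda>n. \<Sum>i\<le>d. c i n * w n ^ i)"
    by (simp add: poly_altdef c d_def[symmetric] star_power star_arith star_sum)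
  then have root: "\<forall>\<^sub>F n in ufilter. (\<Sum>i\<le>d. c i n * w n ^ i) = 0" using p(3) by (simp add: star_eq_0_iff)
  have ev: "\<forall>\<^sub>F n in ufilter. \<exists>g. (\<forall>i. g i \<in> N n) \<and> a n = (\<Sum>i\<le>d. g i * w n ^ i)"
    using lc root
  proof eventually_elim
    case (elim n)
    define P where "P = (\<Sum>i\<le>d. monom (c i n) i)"
    have P: "P \<in> polys_over (N n)" unfolding P_def by (intro polys_over_sum[OF N] polys_over_monom[OF N] c)
    have cP: "coeff P d = c d n" unfolding P_def by (simp add: coeff_sum)
    have "P \<noteq> 0" using cP elim(1) coeff_0[of d] by metis
    have "degree P \<le> d" unfolding P_def
      by (intro degree_sum_le) (auto intro: order_trans[OF degree_monom_le])
    have Pw: "poly P (w n) = 0" unfolding P_def using elim(2) by (simp add: poly_sum poly_monom)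
    have "w n \<in> acl (N n)" using P \<open>P \<noteq> 0\<close> Pw by (rule aclI)
    then obtain f where f: "minpoly_over (N n) f (w n)" using minpoly_over_exists[OF N] by blast
    \<comment> \<open>The degree of \<open>w n\<close> over \<open>N n\<close> is bounded by the
      same d for almost all n. Hence every sequence of elements of the fields \<open>N n\<close>
      with \<open>w n\<close> adjoined is a single sum of d + 1 terms with internal
      coefficients.\<close>
    then have "degree f \<le> d" using P \<open>P \<noteq> 0\<close> Pw \<open>degree P \<le> d\<close> by (force simp: minpoly_over_def)
    obtain g where g: "g \<in> polys_over (N n)" "g = 0 \<or> degree g < degree f" "a n = poly g (w n)"
      using adj_algebraic[OF N f a(2)] by blast
    have "degree g \<le> d" using g(2) \<open>degree f \<le> d\<close> by auto
    have "a n = (\<Sum>i\<le>d. coeff g i * w n ^ i)"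
      unfolding g(3) poly_altdef using \<open>degree g \<le> d\<close> by (intro sum.mono_neutral_left) (auto simp: coeff_eq_0)
    then show ?case using g(1) by (intro exI[of _ "coeff g"]) (auto simp: polys_over_def)
  qed
  define R where "R n g \<longleftrightarrow> (\<forall>i. g i \<in> N n) \<and> a n = (\<Sum>i\<le>d. g i * w n ^ i)" for n g
  define g where "g n = (SOME g. R n g)" for n
  have "\<forall>\<^sub>F n in ufilter. R n (g n)"
    using ev unfolding g_def R_def[symmetric] by (rule eventually_mono) (erule someI_ex)
  then have g: "\<forall>\<^sub>F n in ufilter. (\<forall>i. g n i \<in> N n) \<and> a n = (\<Sum>i\<le>d. g n i * w n ^ i)"
    by (simp add: R_def)
  have "u = (\<Sum>i\<le>d. star (\<lambda>n. g n i) * star w ^ i)"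
  proof -
    have "(\<Sum>i\<le>d. star (\<lambda>n. g n i) * star w ^ i) = star (\<lambda>n. \<Sum>i\<le>d. g n i * w n ^ i)"
      by (simp add: star_power star_arith star_sum)
    moreover have "star a = star (\<lambda>n. \<Sum>i\<le>d. g n i * w n ^ i)"
      unfolding star_eq_iff using g by (rule eventually_mono) blast
    ultimately show ?thesis using a(1) by simp
  qed
  also have "\<dots> \<in> adj (star_set N) (star w)"
  proof (rule subfld_sum[OF subfld_adj[OF M]])
    fix i
    have "star (\<lambda>n. g n i) \<in> star_set N"
      unfolding star_in_star_set using g by (rule eventually_mono) blast
    then have "star (\<lambda>n. g n i) \<in> adj (star_set N) (star w)" using adj_base[OF M] by blast
    then show "star (\<lambda>n. g n i) * star w ^ i \<in> adj (star_set N) (star w)"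
      by (rule subfld_mult[OF subfld_adj[OF M] _ subfld_power[OF subfld_adj[OF M] adj_gen[OF M]]])
  qed
  finally show "u \<in> adj (star_set N) (star w)" .
qed


section \<open>Non-thinness as a specialisation property, and the Gilmore-Robinson criterion\<close>

section \<open>Specialising one transcendental\<close>

text \<open>Here m is a monic polynomial in y over Q[t]; by integrality, having no root in Q[t] is
  the same as having none in Q(t). The conclusion is that m(z,y) has no rational root. The finite
  set A makes the good points z infinitely many, which later keeps the specialised element out of a
  given countable field.\<close>

definition hilbertian_set :: "rat set \<Rightarrow> bool" where
  "hilbertian_set Z \<longleftrightarrow> (\<forall>m :: rat poly poly. \<forall>A. lead_coeff m = 1 \<longrightarrow> (\<forall>p. poly m p \<noteq> 0) \<longrightarrow> finite A \<longrightarrow>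
     (\<exists>z\<in>Z - A. \<forall>u. poly (poly m [:u:]) z \<noteq> 0))"

lemma bounded_coeff_degrees: "\<exists>E. \<forall>i. degree (coeff m i) \<le> E" for m :: "'a::comm_ring_1 poly poly"
proof (intro exI allI)
  fix i
  show "degree (coeff m i) \<le> (\<Sum>i\<le>degree m. degree (coeff m i))"
    by (cases "i \<le> degree m") (auto intro: member_le_sum simp: coeff_eq_0)
qed

text \<open>A rectangular range of summation that depends only on degree bounds; evaluations of a
  whole sequence of polynomials can then be written as one sum.\<close>

lemma poly_poly_const_altdef:
  fixes m :: "'a::comm_ring_1 poly poly"
  assumes "degree m \<le> D" "\<And>i. degree (coeff m i) \<le> E"
  shows "poly (poly m [:v:]) z = (\<Sum>i\<le>D. (\<Sum>j\<le>E. coeff (coeff m i) j * z ^ j) * v ^ i)"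
proof -
  have c: "poly (coeff m i) z = (\<Sum>j\<le>E. coeff (coeff m i) j * z ^ j)" for i
    unfolding poly_altdef using assms(2)[of i]
    by (intro sum.mono_neutral_left) (auto simp: coeff_eq_0)
  have "poly m [:v:] = (\<Sum>i\<le>D. coeff m i * [:v:] ^ i)"
    unfolding poly_altdef using assms(1) by (intro sum.mono_neutral_left) (auto simp: coeff_eq_0)
  then show ?thesis by (simp add: poly_sum poly_power c)
qed

text \<open>With d the degree of m in y, isolating the leading term p^d gives d deg(p) <= E + (d -
  1) deg(p). The bound depends on m only, so polynomial roots chosen at different indices have
  bounded degree.\<close>

lemma monic_root_degree_le:
  fixes m :: "'a::idom poly poly"
  assumes m: "lead_coeff m = 1" "\<And>i. degree (coeff m i) \<le> E" and p: "poly m p = 0"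
  shows "degree p \<le> E"
proof (rule ccontr)
  assume E: "\<not> degree p \<le> E"
  define d where "d = degree m"
  have "d \<noteq> 0" unfolding d_def by (rule monic_root_degree[OF m(1) p])
  then obtain d' where d': "d = Suc d'" by (cases d) auto
  have p0: "p \<noteq> 0" using E by auto
  have "0 = (\<Sum>i\<le>d. coeff m i * p ^ i)" using p by (simp add: poly_altdef d_def)
  also have "\<dots> = p ^ d + (\<Sum>i\<le>d'. coeff m i * p ^ i)"
    using m(1) by (simp add: d' d_def[symmetric])
  finally have "p ^ d = - (\<Sum>i\<le>d'. coeff m i * p ^ i)" by (simp add: eq_neg_iff_add_eq_0)
  then have "degree (p ^ d) = degree (\<Sum>i\<le>d'. coeff m i * p ^ i)" by simp
  also have "\<dots> \<le> E + d' * degree p"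
  proof (rule degree_sum_le)
    fix i assume "i \<in> {..d'}"
    have "degree (coeff m i * p ^ i) \<le> degree (coeff m i) + degree (p ^ i)" by (rule degree_mult_le)
    also have "degree (p ^ i) = i * degree p" using p0 by (simp add: degree_power_eq)
    also have "\<dots> \<le> d' * degree p" using \<open>i \<in> {..d'}\<close> by simp
    finally show "degree (coeff m i * p ^ i) \<le> E + d' * degree p" using m(2)[of i] by linarith
  qed simp
  finally have "d * degree p \<le> E + d' * degree p" by (simp only: degree_power_eq[OF p0])
  then show False using E by (simp add: d')
qed

abbreviation star_rat :: "'a::field_char_0 ultra set" where
  "star_rat \<equiv> star_set (\<lambda>_. \<rat>)"

definition starq :: "(nat \<Rightarrow> rat) \<Rightarrow> 'a::field_char_0 ultra" where
  "starq g = star (\<lambda>n. of_rat (g n))"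

lemma starq_in [simp, intro]: "starq g \<in> star_rat"
  by (simp add: starq_def star_in_star_set)

lemma starq_const: "starq (\<lambda>_. c) = of_rat c"
  using cst_of_rat[of c] by (simp add: starq_def cst_def)

lemma starq_eq_0_iff: "starq g = 0 \<longleftrightarrow> (\<forall>\<^sub>F n in ufilter. g n = 0)"
  by (simp add: starq_def star_eq_0_iff)

text \<open>With constant representatives of 0 and 1, the coordinates of a monic polynomial are
  monic and of no larger degree at every index, not merely at almost every one.\<close>

lemma starq_representation:
  "\<exists>r :: 'a::field_char_0 ultra \<Rightarrow> nat \<Rightarrow> rat.
    (\<forall>u\<in>star_rat. starq (r u) = u) \<and> r 0 = (\<lambda>_. 0) \<and> r 1 = (\<lambda>_. 1)"
proof -
  have ex: "\<exists>g. starq g = u" if "u \<in> star_rat" for u :: "'a ultra"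
  proof -
    have "(\<rat> :: 'a set) \<noteq> {}" by auto
    from star_setD[OF that this] obtain f where f: "u = star f" "\<And>n. f n \<in> \<rat>" by blast
    then have "\<exists>q. f n = of_rat q" for n by (meson Rats_cases)
    then obtain g where "\<And>n. f n = of_rat (g n)" by metis
    then have "f = (\<lambda>n. of_rat (g n))" by blast
    then have "starq g = u" using f(1) by (simp add: starq_def)
    then show ?thesis by blast
  qed
  define r where "r u = (if u = 0 then (\<lambda>_. 0) else if u = 1 then (\<lambda>_. 1) else SOME g. starq g = u)"
    for u :: "'a ultra"
  have "starq (r u) = u" if "u \<in> star_rat" for u
    using someI_ex[OF ex[OF that]] starq_const[of 0] starq_const[of 1] by (auto simp: r_def)
  then show ?thesis by (intro exI[of _ r]) (auto simp: r_def)
qed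

context
  fixes r :: "'a::field_char_0 ultra \<Rightarrow> nat \<Rightarrow> rat"
  assumes r: "\<And>u. u \<in> star_rat \<Longrightarrow> starq (r u) = u" "r 0 = (\<lambda>_. 0)" "r 1 = (\<lambda>_. 1)"
begin

definition component :: "'a ultra poly poly \<Rightarrow> nat \<Rightarrow> rat poly poly" where
  "component m n = map_poly (map_poly (\<lambda>c. r c n)) m"

lemma coeff_component: "coeff (coeff (component m n) i) j = r (coeff (coeff m i) j) n"
  unfolding component_def by (simp add: coeff_map_poly r)

lemma degree_component: "degree (component m n) \<le> degree m"
  by (rule degree_le) (auto simp: component_def coeff_map_poly coeff_eq_0 r)

lemma degree_coeff_component: "degree (coeff (component m n) i) \<le> degree (coeff m i)"
  by (rule degree_le) (simp add: coeff_component coeff_eq_0 r)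

lemma lead_coeff_component:
  assumes "lead_coeff m = 1"
  shows "lead_coeff (component m n) = 1"
proof -
  have c: "coeff (component m n) (degree m) = 1"
    by (rule poly_eqI) (simp add: coeff_component assms coeff_1 r)
  then have "degree (component m n) = degree m"
    using degree_component[of m n] by (metis antisym le_degree zero_neq_one)
  then show ?thesis using c by simp
qed

text \<open>Los's theorem for the evaluation of m: both sides are the same double sum, with a range
  that does not depend on n.\<close>

lemma poly_component:
  assumes m: "m \<in> polys_over (polys_over star_rat)"
  shows "poly (poly m [:starq y:]) (starq x) = starq (\<lambda>n. poly (poly (component m n) [:y n:]) (x n))"
proof -
  obtain E where E: "\<And>i. degree (coeff m i) \<le> E" using bounded_coeff_degrees by blast
  have E': "degree (coeff (component m n) i) \<le> E" for n i
    using order_trans[OF degree_coeff_component E] .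
  have c: "coeff (coeff m i) j = starq (r (coeff (coeff m i) j))" for i j
    using m r(1) by (simp add: polys_over_def)
  show ?thesis
    unfolding poly_poly_const_altdef[OF order_refl E] poly_poly_const_altdef[OF degree_component E']
      coeff_component
    by (subst c) (simp add: starq_def star_arith star_power star_sum of_rat_sum of_rat_mult of_rat_power)
qed

text \<open>If almost all coordinates of m had a polynomial root \<open>p n\<close>, the degrees
  would be bounded by E and the \<open>p n\<close> would form a polynomial P over *Q. Then m(P)
  vanishes at all standard rationals, hence identically, and \<open>rel_alg_closed_poly_root\<close>
  puts the coefficients of P into k, contrary to the assumption on m.\<close>

lemma eventually_no_root:
  assumes rac: "rel_alg_closed k star_rat"
    and m: "m \<in> polys_over (polys_over k)" "lead_coeff m = 1" "\<forall>p\<in>polys_over k. poly m p \<noteq> 0"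
  shows "\<forall>\<^sub>F n in ufilter. \<forall>p. poly (component m n) p \<noteq> 0"
proof (rule ccontr)
  assume "\<not> ?thesis"
  then have "\<forall>\<^sub>F n in ufilter. \<not> (\<forall>p. poly (component m n) p \<noteq> 0)"
    by (simp only: eventually_ufilter_not_iff not_False_eq_True)
  then have ev: "\<forall>\<^sub>F n in ufilter. \<exists>p. poly (component m n) p = 0" by simp
  have kQ: "k \<subseteq> star_rat" and Q: "subfld (star_rat :: 'a ultra set)"
    using rac by (auto simp: rel_alg_closed_def)
  have mQ: "m \<in> polys_over (polys_over star_rat)"
    using m(1) polys_over_mono[OF polys_over_mono[OF kQ]] by blast
  obtain E where E: "\<And>i. degree (coeff m i) \<le> E" using bounded_coeff_degrees by blast
  define p where "p n = (SOME p. poly (component m n) p = 0)" for n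
  have root: "\<forall>\<^sub>F n in ufilter. poly (component m n) (p n) = 0"
    using ev unfolding p_def by (rule eventually_mono) (erule someI_ex)
  then have deg: "\<forall>\<^sub>F n in ufilter. degree (p n) \<le> E"
  proof (rule eventually_mono)
    fix n assume "poly (component m n) (p n) = 0"
    then show "degree (p n) \<le> E"
      by (rule monic_root_degree_le[OF lead_coeff_component[OF m(2)] order_trans[OF degree_coeff_component E]])
  qed
  define P :: "'a ultra poly" where "P = (\<Sum>j\<le>E. monom (starq (\<lambda>n. coeff (p n) j)) j)"
  have PQ: "P \<in> polys_over star_rat"
    unfolding P_def by (intro polys_over_sum[OF Q] polys_over_monom[OF Q] starq_in)
  have Pc: "poly P (of_rat c) = starq (\<lambda>n. poly (p n) c)" for c
  proof -
    have "poly P (of_rat c) = (\<Sum>j\<le>E. starq (\<lambda>n. coeff (p n) j) * starq (\<lambda>_. c) ^ j)"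
      by (simp add: P_def poly_sum poly_monom starq_const)
    also have "\<dots> = starq (\<lambda>n. \<Sum>j\<le>E. coeff (p n) j * c ^ j)"
      by (simp add: starq_def star_arith star_power star_sum of_rat_sum of_rat_mult of_rat_power)
    also have "\<dots> = starq (\<lambda>n. poly (p n) c)"
      unfolding starq_def star_eq_iff of_rat_eq_iff using deg
    proof (rule eventually_mono)
      fix n assume "degree (p n) \<le> E"
      then show "(\<Sum>j\<le>E. coeff (p n) j * c ^ j) = poly (p n) c"
        unfolding poly_altdef by (intro sum.mono_neutral_right) (auto simp: coeff_eq_0)
    qed
    finally show ?thesis .
  qed
  have zero: "poly (poly m P) (of_rat c) = 0" for c
  proof -
    have "poly (poly m P) (of_rat c) = poly (poly m [:starq (\<lambda>n. poly (p n) c):]) (starq (\<lambda>_. c))"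
      by (subst poly_poly_const) (simp add: Pc starq_const)
    also have "\<dots> = starq (\<lambda>n. poly (poly (component m n) [:poly (p n) c:]) c)"
      by (rule poly_component[OF mQ])
    also have "\<dots> = starq (\<lambda>n. poly (poly (component m n) (p n)) c)"
      by (simp flip: poly_poly_const)
    also have "\<dots> = 0"
      unfolding starq_eq_0_iff using root by (rule eventually_mono) simp
    finally show ?thesis .
  qed
  have "poly m P = 0"
  proof (rule ccontr)
    assume "poly m P \<noteq> 0"
    then have "finite {x. poly (poly m P) x = 0}" by (rule poly_roots_finite)
    moreover have "range of_rat \<subseteq> {x. poly (poly m P) x = 0}" using zero by auto
    ultimately have "finite (range (of_rat :: rat \<Rightarrow> 'a ultra))" by (rule finite_subset[rotated])
    then have "finite (UNIV :: rat set)" by (rule finite_imageD) (simp add: inj_on_def)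
    then show False by (simp add: infinite_UNIV_char_0)
  qed
  then have "P \<in> polys_over k" using rel_alg_closed_poly_root[OF rac m(1,2) PQ] by blast
  then show False using m(3) \<open>poly m P = 0\<close> by blast
qed

end

text \<open>The criterion of Gilmore and Robinson. A diagonal argument replaces saturation.\<close>

lemma hilbertian_specialisation:
  fixes k :: "'a::field_char_0 ultra set"
  assumes Z: "hilbertian_set Z" and rac: "rel_alg_closed k star_rat" and cnt: "countable k"
  shows "\<exists>g. (\<forall>n. g n \<in> Z) \<and> starq g \<notin> k \<and> rel_alg_closed (adj k (starq g)) star_rat"
proof -
  have k: "subfld k" and kQ: "k \<subseteq> star_rat" and Q: "subfld (star_rat :: 'a ultra set)"
    using rac by (auto simp: rel_alg_closed_def)
  obtain r :: "'a ultra \<Rightarrow> nat \<Rightarrow> rat" where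
    r: "\<And>u. u \<in> star_rat \<Longrightarrow> starq (r u) = u" "r 0 = (\<lambda>_. 0)" "r 1 = (\<lambda>_. 1)"
    using starq_representation by blast
  define M where "M = {m \<in> polys_over (polys_over k). lead_coeff m = 1 \<and> (\<forall>p\<in>polys_over k. poly m p \<noteq> 0)}"
  have cM: "countable M"
    by (rule countable_subset[OF _ countable_polys_over[OF countable_polys_over[OF cnt]]]) (auto simp: M_def)
  define G where "G m n \<longleftrightarrow> (\<forall>p. poly (component r m n) p \<noteq> 0)" for m n
  \<comment> \<open>At index n only finitely many requirements are active: those with number at most
    n whose coordinate n is itself without a root. Each member of \<open>M\<close> is active at
    almost all n, by \<open>eventually_no_root\<close>.\<close>
  define F where "F n = {m \<in> M. to_nat_on M m \<le> n \<and> G m n}" for n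
  \<comment> \<open>The values at n of the elements of k with number at most n. A sequence that
    avoids them differs almost everywhere from each element of k.\<close>
  define A where "A n = (\<lambda>u. r u n) ` {u \<in> k. to_nat_on k u \<le> n}" for n
  have fin: "finite {x \<in> X. to_nat_on X x \<le> n}" if "countable X" for X :: "'b set" and n
  proof (rule finite_imageD)
    show "finite (to_nat_on X ` {x \<in> X. to_nat_on X x \<le> n})"
      by (rule finite_subset[of _ "{..n}"]) auto
    show "inj_on (to_nat_on X) {x \<in> X. to_nat_on X x \<le> n}"
      by (rule inj_on_subset[OF inj_on_to_nat_on[OF that]]) auto
  qed
  have finF: "finite (F n)" for n
    by (rule finite_subset[OF _ fin[OF cM, of n]]) (auto simp: F_def)
  have "\<exists>z\<in>Z. z \<notin> A n \<and> (\<forall>m\<in>F n. \<forall>u. poly (poly (component r m n) [:u:]) z \<noteq> 0)" for n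
  proof -
    \<comment> \<open>A product of monic polynomials without roots is again monic without roots, so
      one application of \<open>hilbertian_set\<close> serves all active requirements.\<close>
    define m where "m = (\<Prod>m\<in>F n. component r m n)"
    have "lead_coeff (component r m n) = 1" if "m \<in> F n" for m
      using that by (intro lead_coeff_component r) (auto simp: F_def M_def)
    then have "lead_coeff m = 1" unfolding m_def by (simp add: lead_coeff_prod)
    moreover have "\<forall>p. poly m p \<noteq> 0"
      using finF by (auto simp: m_def poly_prod F_def G_def)
    moreover have "finite (A n)" unfolding A_def using fin[OF cnt] by blast
    ultimately obtain z where z: "z \<in> Z - A n" "\<forall>u. poly (poly m [:u:]) z \<noteq> 0"
      using Z unfolding hilbertian_set_def by blast
    have "poly (poly (component r m' n) [:u:]) z \<noteq> 0" if "m' \<in> F n" for m' u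
    proof
      assume "poly (poly (component r m' n) [:u:]) z = 0"
      then have "poly (poly m [:u:]) z = 0"
        unfolding m_def poly_prod using that finF by (auto intro!: prod_zero)
      then show False using z by blast
    qed
    then show ?thesis using z by blast
  qed
  then obtain g where g: "\<And>n. g n \<in> Z" "\<And>n. g n \<notin> A n"
    "\<And>n m u. m \<in> F n \<Longrightarrow> poly (poly (component r m n) [:u:]) (g n) \<noteq> 0" by metis
  have "starq g \<notin> k"
  proof
    assume gk: "starq g \<in> k"
    then have "starq (r (starq g)) = (starq g :: 'a ultra)" using r(1) kQ by blast
    then have "\<forall>\<^sub>F n in ufilter. r (starq g) n = g n" by (simp add: starq_def star_eq_iff)
    then have "\<forall>\<^sub>F n in ufilter. False"
      using eventually_ufilter_ge[of "to_nat_on k (starq g)"]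
    proof (rule eventually_elim2)
      fix n assume "r (starq g) n = g n" "to_nat_on k (starq g) \<le> n"
      then have "g n \<in> A n" unfolding A_def using gk by (intro image_eqI[of _ _ "starq g"]) auto
      then show False using g(2) by blast
    qed
    then show False by simp
  qed
  moreover have "rel_alg_closed (adj k (starq g)) star_rat"
  proof (rule rel_alg_closed_adjI[OF k Q kQ starq_in])
    fix m v assume m: "m \<in> polys_over (polys_over k)" "lead_coeff m = 1"
      "\<forall>p\<in>polys_over k. poly m p \<noteq> 0" and v: "v \<in> (star_rat :: 'a ultra set)"
    have mM: "m \<in> M" using m by (simp add: M_def)
    have mQ: "m \<in> polys_over (polys_over star_rat)"
      using m(1) polys_over_mono[OF polys_over_mono[OF kQ]] by blast
    have "\<forall>\<^sub>F n in ufilter. G m n"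
      unfolding G_def by (rule eventually_no_root[OF r rac m])
    then have "\<forall>\<^sub>F n in ufilter. poly (poly (component r m n) [:r v n:]) (g n) \<noteq> 0"
      using eventually_ufilter_ge[of "to_nat_on M m"]
      by (rule eventually_elim2) (rule g(3), simp add: F_def mM)
    then have "starq (\<lambda>n. poly (poly (component r m n) [:r v n:]) (g n)) \<noteq> (0 :: 'a ultra)"
      by (simp add: starq_eq_0_iff eventually_ufilter_not_iff)
    then show "poly (poly m [:v:]) (starq g) \<noteq> 0"
      using poly_component[OF r mQ, of "r v" g] r(1)[OF v] by simp
  qed
  ultimately show ?thesis using g(1) by blast
qed


section \<open>Extension of field homomorphisms to simple extensions\<close>

section \<open>Extending homomorphisms of subfields\<close>

definition field_hom_on :: "('a::field \<Rightarrow> 'b::field) \<Rightarrow> 'a set \<Rightarrow> bool" where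
  "field_hom_on \<sigma> K \<longleftrightarrow> \<sigma> 1 = 1 \<and> (\<forall>x\<in>K. \<forall>y\<in>K. \<sigma> (x + y) = \<sigma> x + \<sigma> y \<and> \<sigma> (x * y) = \<sigma> x * \<sigma> y)"

lemma field_hom_on_subset: "field_hom_on \<sigma> K \<Longrightarrow> F \<subseteq> K \<Longrightarrow> field_hom_on \<sigma> F"
  unfolding field_hom_on_def by blast

context
  fixes \<sigma> :: "'a::field \<Rightarrow> 'b::field" and K :: "'a set"
  assumes K: "subfld K" and \<sigma>: "field_hom_on \<sigma> K"
begin

lemma field_hom_1: "\<sigma> 1 = 1"
  and field_hom_add: "x \<in> K \<Longrightarrow> y \<in> K \<Longrightarrow> \<sigma> (x + y) = \<sigma> x + \<sigma> y"
  and field_hom_mult: "x \<in> K \<Longrightarrow> y \<in> K \<Longrightarrow> \<sigma> (x * y) = \<sigma> x * \<sigma> y"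
  using \<sigma> by (auto simp: field_hom_on_def)

lemma field_hom_0: "\<sigma> 0 = 0"
  using field_hom_add[OF subfld_0[OF K] subfld_0[OF K]] by (metis add_0_right add_cancel_right_right)

lemma field_hom_uminus: "x \<in> K \<Longrightarrow> \<sigma> (- x) = - \<sigma> x"
  using field_hom_add[OF _ subfld_uminus[OF K], of x x] by (simp add: field_hom_0 eq_neg_iff_add_eq_0 add.commute)

lemma field_hom_diff: "x \<in> K \<Longrightarrow> y \<in> K \<Longrightarrow> \<sigma> (x - y) = \<sigma> x - \<sigma> y"
  using field_hom_add[OF _ subfld_uminus[OF K], of x y] by (simp add: field_hom_uminus)

lemma field_hom_inverse: "x \<in> K \<Longrightarrow> \<sigma> (inverse x) = inverse (\<sigma> x)"
proof (cases "x = 0")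
  case False
  assume "x \<in> K"
  then have "\<sigma> x * \<sigma> (inverse x) = 1"
    using field_hom_mult[OF _ subfld_inverse[OF K], of x x] False by (simp add: field_hom_1)
  then show ?thesis by (metis inverse_unique)
qed (simp add: field_hom_0)

lemma field_hom_divide: "x \<in> K \<Longrightarrow> y \<in> K \<Longrightarrow> \<sigma> (x / y) = \<sigma> x / \<sigma> y"
  using field_hom_mult[OF _ subfld_inverse[OF K], of x y] by (simp add: divide_inverse field_hom_inverse)

lemma field_hom_eq_0_iff: "x \<in> K \<Longrightarrow> \<sigma> x = 0 \<longleftrightarrow> x = 0"
proof
  assume "x \<in> K" "\<sigma> x = 0"
  then show "x = 0"
    using field_hom_mult[OF _ subfld_inverse[OF K], of x x] field_hom_1 by (cases "x = 0") auto
qed (simp add: field_hom_0)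

lemma field_hom_inj: "inj_on \<sigma> K"
proof (rule inj_onI)
  fix x y assume "x \<in> K" "y \<in> K" "\<sigma> x = \<sigma> y"
  then show "x = y" using field_hom_eq_0_iff[OF subfld_diff[OF K], of x y] by (simp add: field_hom_diff)
qed

lemma subfld_image: "subfld (\<sigma> ` K)"
proof (rule subfldI)
  show "1 \<in> \<sigma> ` K" using field_hom_1 subfld_1[OF K] by (metis imageI)
next
  fix x y assume "x \<in> \<sigma> ` K" "y \<in> \<sigma> ` K"
  then obtain a b where "a \<in> K" "b \<in> K" "x = \<sigma> a" "y = \<sigma> b" by blast
  then show "x - y \<in> \<sigma> ` K" "x * y \<in> \<sigma> ` K"
    using subfld_diff[OF K] subfld_mult[OF K] by (auto simp flip: field_hom_diff field_hom_mult)
next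
  fix x assume "x \<in> \<sigma> ` K"
  then show "inverse x \<in> \<sigma> ` K"
    using subfld_inverse[OF K] by (auto simp flip: field_hom_inverse)
qed

lemma coeff_map_poly_hom: "coeff (map_poly \<sigma> p) i = \<sigma> (coeff p i)"
  by (simp add: coeff_map_poly field_hom_0)

lemma field_hom_sum: "(\<And>i. i \<in> I \<Longrightarrow> f i \<in> K) \<Longrightarrow> \<sigma> (sum f I) = (\<Sum>i\<in>I. \<sigma> (f i))"
  by (induction I rule: infinite_finite_induct)
     (simp_all add: field_hom_0 field_hom_add subfld_sum[OF K])

lemma map_poly_hom_mult:
  "p \<in> polys_over K \<Longrightarrow> q \<in> polys_over K \<Longrightarrow> map_poly \<sigma> (p * q) = map_poly \<sigma> p * map_poly \<sigma> q"
  by (rule poly_eqI)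
     (simp add: coeff_map_poly_hom coeff_mult field_hom_sum field_hom_mult polys_overD subfld_mult[OF K])

lemma map_poly_hom_diff:
  "p \<in> polys_over K \<Longrightarrow> q \<in> polys_over K \<Longrightarrow> map_poly \<sigma> (p - q) = map_poly \<sigma> p - map_poly \<sigma> q"
  by (rule poly_eqI) (simp add: coeff_map_poly_hom field_hom_diff polys_overD)

lemma map_poly_hom_add:
  "p \<in> polys_over K \<Longrightarrow> q \<in> polys_over K \<Longrightarrow> map_poly \<sigma> (p + q) = map_poly \<sigma> p + map_poly \<sigma> q"
  by (rule poly_eqI) (simp add: coeff_map_poly_hom field_hom_add polys_overD)

lemma map_poly_hom_1: "map_poly \<sigma> 1 = 1"
  by (rule poly_eqI) (simp add: coeff_map_poly_hom coeff_1 field_hom_1 field_hom_0)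

lemma map_poly_hom_eq_0_iff: "p \<in> polys_over K \<Longrightarrow> map_poly \<sigma> p = 0 \<longleftrightarrow> p = 0"
  by (auto simp: poly_eq_iff coeff_map_poly_hom field_hom_eq_0_iff polys_overD)

lemma degree_map_poly_hom: "p \<in> polys_over K \<Longrightarrow> degree (map_poly \<sigma> p) = degree p"
  by (rule antisym; rule degree_le)
     (auto simp: coeff_map_poly_hom field_hom_0 coeff_eq_0 dest: coeff_eq_0[of "map_poly \<sigma> p"]
       simp flip: field_hom_eq_0_iff[OF polys_overD])

lemma map_poly_hom_in: "p \<in> polys_over K \<Longrightarrow> map_poly \<sigma> p \<in> polys_over (\<sigma> ` K)"
  by (simp add: polys_over_def coeff_map_poly_hom)

lemma polys_over_image:
  assumes "q \<in> polys_over (\<sigma> ` K)"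
  shows "\<exists>p\<in>polys_over K. q = map_poly \<sigma> p"
proof -
  define p where "p = map_poly (inv_into K \<sigma>) q"
  have inv0: "inv_into K \<sigma> 0 = 0"
    using inv_into_f_f[OF field_hom_inj subfld_0[OF K]] by (simp add: field_hom_0)
  have "coeff p i = inv_into K \<sigma> (coeff q i)" for i unfolding p_def by (simp add: coeff_map_poly inv0)
  then have "coeff p i \<in> K" "\<sigma> (coeff p i) = coeff q i" for i
    using polys_overD[OF assms, of i] by (simp_all add: inv_into_into f_inv_into_f)
  then show ?thesis by (intro bexI[of _ p]) (auto simp: polys_over_def poly_eq_iff coeff_map_poly_hom)
qed

lemma field_hom_poly: "p \<in> polys_over K \<Longrightarrow> x \<in> K \<Longrightarrow> \<sigma> (poly p x) = poly (map_poly \<sigma> p) (\<sigma> x)"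
proof (induction p)
  case 0
  then show ?case by (simp add: field_hom_0)
next
  case (pCons a p)
  then have "a \<in> K" "p \<in> polys_over K" by (simp_all add: polys_over_pCons[OF K])
  then show ?case using pCons
    by (simp add: map_poly_pCons field_hom_0 field_hom_add field_hom_mult poly_in_subfld[OF K] subfld_mult[OF K])
qed

lemma image_acl: "F \<subseteq> K \<Longrightarrow> x \<in> K \<Longrightarrow> x \<in> acl F \<Longrightarrow> \<sigma> x \<in> acl (\<sigma> ` F)"
proof -
  assume F: "F \<subseteq> K" and x: "x \<in> K" "x \<in> acl F"
  then obtain p where p: "p \<in> polys_over F" "p \<noteq> 0" "poly p x = 0" by (auto simp: acl_def)
  then have pK: "p \<in> polys_over K" using polys_over_mono[OF F] by blast
  show ?thesis
  proof (rule aclI)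
    show "map_poly \<sigma> p \<in> polys_over (\<sigma> ` F)" using p(1) by (simp add: polys_over_def coeff_map_poly_hom)
    show "map_poly \<sigma> p \<noteq> 0" using p(2) pK map_poly_hom_eq_0_iff by blast
    show "poly (map_poly \<sigma> p) (\<sigma> x) = 0" using field_hom_poly[OF pK x(1)] p(3) field_hom_0 by simp
  qed
qed

text \<open>The extension must send p(x)/q(x) to the quotient of the transported polynomials at y.
  It is well defined because x and y satisfy corresponding equations.\<close>

lemma field_hom_extend:
  assumes zeros: "\<And>p. p \<in> polys_over K \<Longrightarrow> poly p x = 0 \<longleftrightarrow> poly (map_poly \<sigma> p) y = 0"
  shows "\<exists>\<tau>. field_hom_on \<tau> (adj K x) \<and> (\<forall>a\<in>K. \<tau> a = \<sigma> a) \<and> \<tau> x = y"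
proof -
  define R where "R u v \<longleftrightarrow> (\<exists>p\<in>polys_over K. \<exists>q\<in>polys_over K. poly q x \<noteq> 0 \<and> u = poly p x / poly q x \<and>
      v = poly (map_poly \<sigma> p) y / poly (map_poly \<sigma> q) y)" for u v
  define \<tau> where "\<tau> u = (SOME v. R u v)" for u
  have uniq: "v = v'" if uv: "R u v" "R u v'" for u v v'
  proof -
    obtain p q where pq: "p \<in> polys_over K" "q \<in> polys_over K" "poly q x \<noteq> 0" "u = poly p x / poly q x"
      "v = poly (map_poly \<sigma> p) y / poly (map_poly \<sigma> q) y" using uv(1) by (auto simp: R_def)
    obtain p' q' where pq': "p' \<in> polys_over K" "q' \<in> polys_over K" "poly q' x \<noteq> 0" "u = poly p' x / poly q' x"
      "v' = poly (map_poly \<sigma> p') y / poly (map_poly \<sigma> q') y" using uv(2) by (auto simp: R_def)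
    have "poly (p * q' - p' * q) x = 0" using pq pq' by (simp add: frac_eq_eq)
    then have "poly (map_poly \<sigma> (p * q' - p' * q)) y = 0"
      using zeros[of "p * q' - p' * q"] pq(1,2) pq'(1,2)
      by (simp only: polys_over_diff[OF K] polys_over_mult[OF K])
    then have "poly (map_poly \<sigma> p) y * poly (map_poly \<sigma> q') y = poly (map_poly \<sigma> p') y * poly (map_poly \<sigma> q) y"
      using pq(1,2) pq'(1,2) by (simp add: map_poly_hom_diff map_poly_hom_mult polys_over_mult[OF K])
    moreover have "poly (map_poly \<sigma> q) y \<noteq> 0" "poly (map_poly \<sigma> q') y \<noteq> 0"
      using zeros pq(2,3) pq'(2,3) by blast+
    ultimately show ?thesis using pq(5) pq'(5) by (simp add: frac_eq_eq)
  qed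
  have \<tau>_frac: "\<tau> (poly p x / poly q x) = poly (map_poly \<sigma> p) y / poly (map_poly \<sigma> q) y"
    if "p \<in> polys_over K" "q \<in> polys_over K" "poly q x \<noteq> 0" for p q
  proof -
    have "R (poly p x / poly q x) (poly (map_poly \<sigma> p) y / poly (map_poly \<sigma> q) y)"
      unfolding R_def using that by blast
    then show ?thesis unfolding \<tau>_def using uniq by (meson someI)
  qed
  have one: "1 \<in> polys_over K" using polys_over_1[OF K] .
  have \<tau>_poly: "\<tau> (poly p x) = poly (map_poly \<sigma> p) y" if "p \<in> polys_over K" for p
    using \<tau>_frac[OF that one] by (simp add: map_poly_hom_1)
  have base: "\<tau> a = \<sigma> a" if "a \<in> K" for a
    using \<tau>_poly[of "[:a:]"] that by (simp add: polys_over_const[OF K] map_poly_pCons field_hom_0)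
  have "\<tau> x = y"
    using \<tau>_poly[of "[:0, 1:]"] subfld_0[OF K] subfld_1[OF K] polys_over_0[OF K]
    by (simp add: polys_over_pCons[OF K] map_poly_pCons field_hom_0 field_hom_1)
  moreover have "field_hom_on \<tau> (adj K x)"
    unfolding field_hom_on_def
  proof (intro conjI ballI)
    show "\<tau> 1 = 1" using base[OF subfld_1[OF K]] field_hom_1 by simp
    fix u v assume "u \<in> adj K x" "v \<in> adj K x"
    then obtain p q p' q' where *: "p \<in> polys_over K" "q \<in> polys_over K" "poly q x \<noteq> 0" "u = poly p x / poly q x"
      "p' \<in> polys_over K" "q' \<in> polys_over K" "poly q' x \<noteq> 0" "v = poly p' x / poly q' x"
      by (auto simp: adj_def)
    have nz: "poly (map_poly \<sigma> q) y \<noteq> 0" "poly (map_poly \<sigma> q') y \<noteq> 0" using zeros * by blast+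
    have "u + v = poly (p * q' + p' * q) x / poly (q * q') x" using * by (simp add: add_frac_eq)
    then have "\<tau> (u + v) = poly (map_poly \<sigma> (p * q' + p' * q)) y / poly (map_poly \<sigma> (q * q')) y"
      using \<tau>_frac[of "p * q' + p' * q" "q * q'"] * by (simp add: polys_over_add[OF K] polys_over_mult[OF K])
    also have "\<dots> = \<tau> u + \<tau> v"
      using * nz by (simp add: \<tau>_frac map_poly_hom_add map_poly_hom_mult polys_over_mult[OF K] add_frac_eq)
    finally show "\<tau> (u + v) = \<tau> u + \<tau> v" .
    have "u * v = poly (p * p') x / poly (q * q') x" using * by simp
    then have "\<tau> (u * v) = poly (map_poly \<sigma> (p * p')) y / poly (map_poly \<sigma> (q * q')) y"
      using \<tau>_frac[of "p * p'" "q * q'"] * by (simp add: polys_over_mult[OF K])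
    also have "\<dots> = \<tau> u * \<tau> v"
      using * nz by (simp add: \<tau>_frac map_poly_hom_mult)
    finally show "\<tau> (u * v) = \<tau> u * \<tau> v" .
  qed
  ultimately show ?thesis using base by blast
qed

lemma field_hom_extend_transcendental:
  assumes "x \<notin> acl K" "y \<notin> acl (\<sigma> ` K)"
  shows "\<exists>\<tau>. field_hom_on \<tau> (adj K x) \<and> (\<forall>a\<in>K. \<tau> a = \<sigma> a) \<and> \<tau> x = y"
proof (rule field_hom_extend)
  fix p assume p: "p \<in> polys_over K"
  have "poly p x = 0 \<longleftrightarrow> p = 0" using assms(1) p aclI[of p K x] by auto
  moreover have "poly (map_poly \<sigma> p) y = 0 \<longleftrightarrow> map_poly \<sigma> p = 0"
    using assms(2) map_poly_hom_in[OF p] aclI[of "map_poly \<sigma> p" "\<sigma> ` K" y] by auto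
  ultimately show "poly p x = 0 \<longleftrightarrow> poly (map_poly \<sigma> p) y = 0"
    using map_poly_hom_eq_0_iff[OF p] by simp
qed

text \<open>Multiples of f vanish at x, and their transports at y. Conversely, if p(x) is nonzero
  then its inverse is some g(x); the polynomial p g - 1 vanishes at x, hence its transport vanishes
  at y, so the transport of p cannot.\<close>

lemma field_hom_extend_minpoly:
  assumes f: "minpoly_over K f x" and y: "poly (map_poly \<sigma> f) y = 0"
  shows "\<exists>\<tau>. field_hom_on \<tau> (adj K x) \<and> (\<forall>a\<in>K. \<tau> a = \<sigma> a) \<and> \<tau> x = y"
proof (rule field_hom_extend)
  have fK: "f \<in> polys_over K" using f by (simp add: minpoly_over_def)
  have zero: "poly (map_poly \<sigma> p) y = 0" if p: "p \<in> polys_over K" "poly p x = 0" for p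
  proof -
    obtain q where "q \<in> polys_over K" "p = f * q" using minpoly_over_dvd[OF K f p] by blast
    then show ?thesis using y by (simp add: map_poly_hom_mult[OF fK])
  qed
  fix p assume p: "p \<in> polys_over K"
  show "poly p x = 0 \<longleftrightarrow> poly (map_poly \<sigma> p) y = 0"
  proof
    assume py: "poly (map_poly \<sigma> p) y = 0"
    show "poly p x = 0"
    proof (rule ccontr)
      assume px: "poly p x \<noteq> 0"
      have "inverse (poly p x) \<in> adj K x"
        by (rule subfld_inverse[OF subfld_adj[OF K] poly_in_adj[OF K p]])
      then obtain g where g: "g \<in> polys_over K" "inverse (poly p x) = poly g x"
        using adj_algebraic[OF K f] by blast
      have "poly (p * g - 1) x = 0" using px by (simp flip: g(2))
      then have "poly (map_poly \<sigma> (p * g - 1)) y = 0"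
        by (intro zero polys_over_diff[OF K] polys_over_mult[OF K] p g polys_over_1[OF K])
      then show False
        using py p g(1) by (simp add: map_poly_hom_diff map_poly_hom_mult map_poly_hom_1 polys_over_mult[OF K] polys_over_1[OF K])
    qed
  qed (use zero p in blast)
qed

lemma image_adj:
  assumes F: "subfld F" "F \<subseteq> K" and x: "x \<in> K"
  shows "\<sigma> ` adj F x = adj (\<sigma> ` F) (\<sigma> x)"
proof -
  have FK: "polys_over F \<subseteq> polys_over K" using polys_over_mono[OF F(2)] .
  have val: "\<sigma> (poly p x / poly q x) = poly (map_poly \<sigma> p) (\<sigma> x) / poly (map_poly \<sigma> q) (\<sigma> x)"
    if "p \<in> polys_over F" "q \<in> polys_over F" for p q
    using that FK x by (simp add: field_hom_divide poly_in_subfld[OF K] field_hom_poly subset_iff)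
  have im: "map_poly \<sigma> p \<in> polys_over (\<sigma> ` F)" if "p \<in> polys_over F" for p
    using that by (simp add: polys_over_def coeff_map_poly_hom)
  have nz: "poly (map_poly \<sigma> q) (\<sigma> x) = 0 \<longleftrightarrow> poly q x = 0" if "q \<in> polys_over F" for q
    using that FK x field_hom_poly[of q x] field_hom_eq_0_iff[of "poly q x"] poly_in_subfld[OF K, of q x]
    by (metis subsetD)
  show ?thesis
  proof
    show "\<sigma> ` adj F x \<subseteq> adj (\<sigma> ` F) (\<sigma> x)"
    proof
      fix v assume "v \<in> \<sigma> ` adj F x"
      then obtain p q where "p \<in> polys_over F" "q \<in> polys_over F" "poly q x \<noteq> 0" "v = \<sigma> (poly p x / poly q x)"
        by (auto simp: adj_def)
      then show "v \<in> adj (\<sigma> ` F) (\<sigma> x)" using val im nz unfolding adj_def by blast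
    qed
    show "adj (\<sigma> ` F) (\<sigma> x) \<subseteq> \<sigma> ` adj F x"
    proof
      fix v assume "v \<in> adj (\<sigma> ` F) (\<sigma> x)"
      then obtain p q where pq: "p \<in> polys_over (\<sigma> ` F)" "q \<in> polys_over (\<sigma> ` F)" "poly q (\<sigma> x) \<noteq> 0"
        "v = poly p (\<sigma> x) / poly q (\<sigma> x)" by (auto simp: adj_def)
      have "\<exists>p'\<in>polys_over F. p = map_poly \<sigma> p'" if "p \<in> polys_over (\<sigma> ` F)" for p
      proof -
        have "p \<in> polys_over (\<sigma> ` K)" using that polys_over_mono[OF image_mono[OF F(2)]] by blast
        then obtain p' where p': "p' \<in> polys_over K" "p = map_poly \<sigma> p'" using polys_over_image by blast
        have "coeff p' i \<in> F" for i
        proof -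
          have "\<sigma> (coeff p' i) \<in> \<sigma> ` F" using that p'(2) by (simp add: polys_over_def coeff_map_poly_hom)
          then show ?thesis
            using inj_on_image_mem_iff[OF field_hom_inj polys_overD[OF p'(1)] F(2)] by blast
        qed
        then show ?thesis using p' by (auto simp: polys_over_def)
      qed
      then obtain p' q' where p': "p' \<in> polys_over F" "p = map_poly \<sigma> p'" "q' \<in> polys_over F" "q = map_poly \<sigma> q'"
        using pq(1,2) by blast
      then have "v = \<sigma> (poly p' x / poly q' x)" using pq(4) val by simp
      moreover have "poly q' x \<noteq> 0" using nz p' pq(3) by blast
      ultimately show "v \<in> \<sigma> ` adj F x" using p' unfolding adj_def by blast
    qed
  qed
qed

end

lemma field_hom_extend_algebraic:
  fixes \<sigma> :: "'a::field \<Rightarrow> 'b::alg_closed_field"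
  assumes K: "subfld K" and \<sigma>: "field_hom_on \<sigma> K" and x: "x \<in> acl K"
  shows "\<exists>\<tau>. field_hom_on \<tau> (adj K x) \<and> (\<forall>a\<in>K. \<tau> a = \<sigma> a)"
proof -
  obtain f where f: "minpoly_over K f x" using minpoly_over_exists[OF K x] .
  then have f0: "f \<in> polys_over K" "lead_coeff f = 1" "poly f x = 0" by (auto simp: minpoly_over_def)
  have "degree (map_poly \<sigma> f) > 0"
    using degree_map_poly_hom[OF K \<sigma> f0(1)] monic_root_degree[OF f0(2,3)] by simp
  then obtain y where "poly (map_poly \<sigma> f) y = 0" using alg_closed_imp_poly_has_root by blast
  then show ?thesis using field_hom_extend_minpoly[OF K \<sigma> f] by blast
qed


section \<open>Specialising a nonstandard witness to a number field with prescribed and excluded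
  elements\<close>

section \<open>Specialising existential witnesses\<close>

lemma qbar_algebraic: "(x :: qbar) \<in> acl \<rat>"
proof -
  obtain p :: "rat poly" where p: "p \<noteq> 0" "poly (map_poly to_ac p) x = 0" by (rule alg_closure_algebraic)
  have to_ac_rat: "to_ac q \<in> (\<rat> :: qbar set)" for q
    by (cases q) (simp add: Fract_of_int_quotient)
  show ?thesis
  proof (rule aclI[of "map_poly to_ac p"])
    show "map_poly to_ac p \<in> polys_over \<rat>" by (simp add: polys_over_def coeff_map_poly to_ac_rat)
    show "map_poly to_ac p \<noteq> 0" using p(1) by (auto simp: poly_eq_iff coeff_map_poly)
  qed (rule p)
qed

lemma acl_Rats_rat_poly:
  fixes x :: "'a::field_char_0"
  assumes "x \<in> acl \<rat>"
  obtains P :: "rat poly" where "P \<noteq> 0" "poly (map_poly of_rat P) x = 0"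
proof -
  obtain p where p: "p \<in> polys_over \<rat>" "p \<noteq> 0" "poly p x = 0" using assms by (auto simp: acl_def)
  have "\<forall>i. \<exists>q. coeff p i = of_rat q" using polys_overD[OF p(1)] by (meson Rats_cases)
  then obtain c where c: "\<And>i. coeff p i = of_rat (c i)" by metis
  define P where "P = Abs_poly c"
  have "c i = 0" if "i > degree p" for i using c[of i] that by (simp add: coeff_eq_0)
  then have "coeff P = c" unfolding P_def
    by (intro Abs_poly_inverse) (auto simp: MOST_nat)
  then have "p = map_poly of_rat P" by (intro poly_eqI) (simp add: coeff_map_poly c)
  then show thesis using p by (intro that[of P]) auto
qed

lemma poly_rat_star: 
  "poly (map_poly of_rat P) (star f) = star (\<lambda>n. poly (map_poly of_rat P) (f n) :: 'a::field_char_0)"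
proof (induction P)
  case 0
  then show ?case by (simp add: star_0)
next
  case (pCons a P)
  have "(of_rat a :: 'a ultra) = star (\<lambda>_. of_rat a)" using cst_of_rat[of a, where 'a = 'a] by (simp add: cst_def)
  then show ?case using pCons by (simp add: map_poly_pCons star_arith)
qed

text \<open>An element of the ultrapower that is algebraic over the rationals is standard.\<close>

lemma acl_Rats_star:
  assumes "star f \<in> acl (\<rat> :: 'a::field_char_0 ultra set)"
  shows "\<exists>a. \<forall>\<^sub>F n in ufilter. f n = a"
proof -
  obtain P where P: "P \<noteq> 0" "poly (map_poly of_rat P) (star f) = 0"
    using acl_Rats_rat_poly[OF assms] .
  then have ev: "\<forall>\<^sub>F n in ufilter. poly (map_poly of_rat P) (f n) = 0"
    by (simp add: poly_rat_star star_eq_0_iff)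
  have "map_poly of_rat P \<noteq> (0 :: 'a poly)" using P(1) by (auto simp: poly_eq_iff coeff_map_poly)
  then have "finite {x. poly (map_poly of_rat P) x = (0::'a)}" by (rule poly_roots_finite)
  moreover have "\<forall>\<^sub>F n in ufilter. \<exists>a\<in>{x. poly (map_poly of_rat P) x = 0}. f n = a"
    using ev by (rule eventually_mono) simp
  ultimately show ?thesis by (subst (asm) eventually_ufilter_bex_iff) auto
qed

lemma cst_algebraic: "cst (a :: qbar) \<in> acl \<rat>"
proof -
  obtain P where P: "P \<noteq> 0" "poly (map_poly of_rat P) a = 0"
    using acl_Rats_rat_poly[OF qbar_algebraic] .
  show ?thesis
  proof (rule aclI[of "map_poly of_rat P"])
    show "poly (map_poly of_rat P) (cst a) = 0"
      using P(2) by (simp add: cst_def poly_rat_star star_eq_0_iff)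
  qed (use P(1) in \<open>auto simp: polys_over_def coeff_map_poly poly_eq_iff\<close>)
qed

text \<open>The start of the construction: an element of *Q algebraic over the rationals is
  standard, and its standard value is one of the rational coordinates.\<close>

lemma rel_alg_closed_Rats: "rel_alg_closed (\<rat> :: 'a::field_char_0 ultra set) star_rat"
proof -
  have Q: "subfld (star_rat :: 'a ultra set)" by (intro subfld_star_set subfld_Rats)
  have "u \<in> \<rat>" if u: "u \<in> acl \<rat>" "u \<in> star_rat" for u :: "'a ultra"
  proof -
    have "(\<rat> :: 'a set) \<noteq> {}" by auto
    from star_setD[OF u(2) this] obtain f where f: "u = star f" "\<And>n. f n \<in> \<rat>" by blast
    obtain a where a: "\<forall>\<^sub>F n in ufilter. f n = a" using acl_Rats_star u(1) f(1) by blast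
    then have "\<exists>n. f n = a" using eventually_happens'[OF ufilter_not_bot] by blast
    then have "a \<in> \<rat>" using f(2) by blast
    moreover have "u = cst a" using a by (simp add: f(1) cst_def star_eq_iff)
    ultimately show ?thesis by (auto elim!: Rats_cases)
  qed
  then show ?thesis
    unfolding rel_alg_closed_def using Q subfld_Rats subfld_Rats_subset[OF Q] by blast
qed

text \<open>A partial embedding of the ultrapower into itself over the standard elements. The field \<open>F\<close>
  is generated over the rationals by the elements handled so far; \<open>K\<close> also contains
  the standard elements.\<close>

definition partial_embedding ::
  "qbar ultra set \<Rightarrow> qbar ultra set \<Rightarrow> (qbar ultra \<Rightarrow> qbar ultra) \<Rightarrow> bool" where
  "partial_embedding K F \<sigma> \<longleftrightarrow> subfld K \<and> subfld F \<and> range cst \<subseteq> K \<and> F \<subseteq> K \<and> K \<subseteq> acl F \<and>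
     field_hom_on \<sigma> K \<and> (\<forall>a. \<sigma> (cst a) = cst a) \<and> countable F"

lemma partial_embeddingD:
  assumes "partial_embedding K F \<sigma>"
  shows "subfld K" "subfld F" "range cst \<subseteq> K" "F \<subseteq> K" "K \<subseteq> acl F" "field_hom_on \<sigma> K"
    "\<And>a. \<sigma> (cst a) = cst a" "countable F" "acl K = acl F" "subfld (\<sigma> ` F)" "countable (\<sigma> ` F)"
    "inj_on \<sigma> K"
proof -
  show *: "subfld K" "subfld F" "range cst \<subseteq> K" "F \<subseteq> K" "K \<subseteq> acl F" "field_hom_on \<sigma> K"
    "\<And>a. \<sigma> (cst a) = cst a" "countable F"
    using assms by (auto simp: partial_embedding_def)
  show "acl K = acl F" using acl_mono[OF *(4)] acl_mono[OF *(5)] acl_acl[OF *(2)] by blast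
  show "subfld (\<sigma> ` F)" using subfld_image[OF *(2) field_hom_on_subset[OF *(6,4)]] .
  show "countable (\<sigma> ` F)" using *(8) by simp
  show "inj_on \<sigma> K" using field_hom_inj[OF *(1,6)] .
qed

lemma partial_embedding_adj:
  assumes P: "partial_embedding K F \<sigma>" and \<tau>: "field_hom_on \<tau> (adj K x)" "\<forall>a\<in>K. \<tau> a = \<sigma> a"
  shows "partial_embedding (adj K x) (adj F x) \<tau>" "\<tau> ` adj F x = adj (\<sigma> ` F) (\<tau> x)"
proof -
  note * = partial_embeddingD[OF P]
  have K': "subfld (adj K x)" using subfld_adj[OF *(1)] .
  have KK': "K \<subseteq> adj K x" using adj_base[OF *(1)] .
  have fixed: "\<tau> (cst a) = cst a" for a
  proof -
    have "cst a \<in> K" using *(3) by blast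
    then show ?thesis using \<tau>(2) *(7) by simp
  qed
  have "F \<subseteq> acl (adj F x)" "x \<in> acl (adj F x)"
    using adj_base[OF *(2)] adj_gen[OF *(2)] acl_base[OF subfld_adj[OF *(2)]] by blast+
  moreover have "K \<subseteq> acl (adj F x)" using *(5) acl_mono[OF adj_base[OF *(2)]] by blast
  ultimately have "adj K x \<subseteq> acl (adj F x)"
    by (intro adj_least subfld_acl subfld_adj *(2))
  then show "partial_embedding (adj K x) (adj F x) \<tau>"
    unfolding partial_embedding_def
    by (intro conjI allI K' subfld_adj *(2) subset_trans[OF *(3) KK'] adj_mono[OF *(4)] \<tau>(1) fixed
        countable_adj[OF *(8)])
  have "\<tau> ` F = \<sigma> ` F" using *(4) \<tau>(2) by force
  then show "\<tau> ` adj F x = adj (\<sigma> ` F) (\<tau> x)"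
    using image_adj[OF K' \<tau>(1) *(2) _ adj_gen[OF *(1)]] *(4) KK' by (metis subset_trans)
qed

lemma partial_embedding_id: "partial_embedding (range cst) \<rat> id"
proof -
  have sub: "subfld (range (cst :: qbar \<Rightarrow> qbar ultra))"
    by (rule subfldI) (auto simp flip: cst_simps)
  moreover have "countable (\<rat> :: qbar ultra set)" by (simp add: Rats_def)
  ultimately show ?thesis
    unfolding partial_embedding_def using subfld_Rats subfld_Rats_subset[OF sub] cst_algebraic
    by (auto simp: field_hom_on_def)
qed

text \<open>The image of a transcendental t may be any element transcendental over the image of K.
  The sequence supplied by \<open>hilbertian_specialisation\<close> has entries in \<open>Z\<close>
  and keeps the image of F relatively algebraically closed in *Q.\<close>

lemma partial_embedding_transcendental:
  assumes Z: "hilbertian_set Z" and P: "partial_embedding K F \<sigma>" and rac: "rel_alg_closed (\<sigma> ` F) star_rat"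
    and t: "t \<notin> acl F"
  shows "\<exists>\<tau> g. partial_embedding (adj K t) (adj F t) \<tau> \<and> rel_alg_closed (\<tau> ` adj F t) star_rat \<and>
    (\<forall>a\<in>K. \<tau> a = \<sigma> a) \<and> \<tau> t = starq g \<and> (\<forall>n. g n \<in> Z)"
proof -
  note * = partial_embeddingD[OF P]
  obtain g where g: "\<And>n. g n \<in> Z" "starq g \<notin> \<sigma> ` F" "rel_alg_closed (adj (\<sigma> ` F) (starq g)) star_rat"
    using hilbertian_specialisation[OF Z rac *(11)] by blast
  have "starq g \<notin> acl (\<sigma> ` F)" using rac g(2) by (auto simp: rel_alg_closed_def)
  moreover have "\<sigma> ` K \<subseteq> acl (\<sigma> ` F)" using image_acl[OF *(1,6,4)] *(5) by blast
  then have "acl (\<sigma> ` K) \<subseteq> acl (\<sigma> ` F)" using acl_mono acl_acl[OF *(10)] by blast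
  ultimately have "starq g \<notin> acl (\<sigma> ` K)" by blast
  then obtain \<tau> where \<tau>: "field_hom_on \<tau> (adj K t)" "\<forall>a\<in>K. \<tau> a = \<sigma> a" "\<tau> t = starq g"
    using field_hom_extend_transcendental[OF *(1,6), of t "starq g"] t *(9) by blast
  then show ?thesis
    using partial_embedding_adj[OF P \<tau>(1,2)] g by (intro exI[of _ \<tau>] exI[of _ g]) simp
qed

text \<open>Selects a transcendence basis from the list: an element algebraic over the field reached
  so far is passed over, any other is adjoined and sent to a sequence of rationals. Afterwards all
  listed elements are algebraic over F', while the target field is still *Q.\<close>

lemma partial_embedding_basis:
  assumes Z: "hilbertian_set Z" and L: "subfld L"
  shows "partial_embedding K F \<sigma> \<Longrightarrow> rel_alg_closed (\<sigma> ` F) star_rat \<Longrightarrow> F \<subseteq> L \<Longrightarrow> set ys \<subseteq> L \<Longrightarrow>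
    \<exists>K' F' \<tau>. partial_embedding K' F' \<tau> \<and> rel_alg_closed (\<tau> ` F') star_rat \<and> F' \<subseteq> L \<and> K \<subseteq> K' \<and>
      (\<forall>a\<in>K. \<tau> a = \<sigma> a) \<and> acl F \<subseteq> acl F' \<and> set ys \<subseteq> acl F'"
proof (induction ys arbitrary: K F \<sigma>)
  case Nil
  then show ?case by (intro exI[of _ K] exI[of _ F] exI[of _ \<sigma>]) auto
next
  case (Cons y ys)
  note * = partial_embeddingD[OF Cons.prems(1)]
  show ?case
  proof (cases "y \<in> acl F")
    case True
    have "set ys \<subseteq> L" using Cons.prems(4) by simp
    from Cons.IH[OF Cons.prems(1-3) this]
    obtain K' F' \<tau> where \<tau>: "partial_embedding K' F' \<tau>" "rel_alg_closed (\<tau> ` F') star_rat" "F' \<subseteq> L"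
      "K \<subseteq> K'" "\<forall>a\<in>K. \<tau> a = \<sigma> a" "acl F \<subseteq> acl F'" "set ys \<subseteq> acl F'" by blast
    have "set (y # ys) \<subseteq> acl F'" using True \<tau>(6,7) by auto
    then show ?thesis using \<tau>(1-6) by blast
  next
    case False
    obtain \<sigma>' where \<sigma>': "partial_embedding (adj K y) (adj F y) \<sigma>'" "rel_alg_closed (\<sigma>' ` adj F y) star_rat"
      "\<forall>a\<in>K. \<sigma>' a = \<sigma> a"
      using partial_embedding_transcendental[OF Z Cons.prems(1,2) False] by blast
    have "adj F y \<subseteq> L" using adj_least[OF L Cons.prems(3)] Cons.prems(4) by simp
    then obtain K' F' \<tau> where \<tau>: "partial_embedding K' F' \<tau>" "rel_alg_closed (\<tau> ` F') star_rat" "F' \<subseteq> L"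
      "adj K y \<subseteq> K'" "\<forall>a\<in>adj K y. \<tau> a = \<sigma>' a" "acl (adj F y) \<subseteq> acl F'" "set ys \<subseteq> acl F'"
      using Cons.IH[OF \<sigma>'(1,2)] Cons.prems(4) by auto
    have KK': "K \<subseteq> adj K y" using adj_base[OF *(1)] .
    have "y \<in> acl (adj F y)" using adj_gen[OF *(2)] acl_base[OF subfld_adj[OF *(2)]] by blast
    moreover have "acl F \<subseteq> acl (adj F y)" using acl_mono[OF adj_base[OF *(2)]] .
    ultimately show ?thesis
      using \<tau> KK' \<sigma>'(3) by (intro exI[of _ K'] exI[of _ F'] exI[of _ \<tau>]) auto
  qed
qed

text \<open>Each algebraic y has an image because the ultrapower is algebraically closed. To keep
  the image of F relatively algebraically closed, the internal field is enlarged in step with it: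
  coordinate n receives coordinate n of the image of y.\<close>

lemma partial_embedding_algebraic:
  assumes L: "subfld L"
  shows "partial_embedding K F \<sigma> \<Longrightarrow> (\<And>n. subfld (N n)) \<Longrightarrow> rel_alg_closed (\<sigma> ` F) (star_set N) \<Longrightarrow>
    F \<subseteq> L \<Longrightarrow> set ys \<subseteq> L \<Longrightarrow> set ys \<subseteq> acl F \<Longrightarrow>
    \<exists>K' F' \<tau> N'. partial_embedding K' F' \<tau> \<and> (\<forall>n. subfld (N' n)) \<and> rel_alg_closed (\<tau> ` F') (star_set N') \<and>
      F' \<subseteq> L \<and> K \<subseteq> K' \<and> (\<forall>a\<in>K. \<tau> a = \<sigma> a) \<and> F \<subseteq> F' \<and> set ys \<subseteq> F'"
proof (induction ys arbitrary: K F \<sigma> N)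
  case Nil
  then show ?case by (intro exI[of _ K] exI[of _ F] exI[of _ \<sigma>] exI[of _ N]) auto
next
  case (Cons y ys)
  note * = partial_embeddingD[OF Cons.prems(1)]
  have yF: "y \<in> acl F" using Cons.prems(6) by simp
  then have "y \<in> acl K" using *(9) by simp
  then obtain \<sigma>' where \<sigma>': "field_hom_on \<sigma>' (adj K y)" "\<forall>a\<in>K. \<sigma>' a = \<sigma> a"
    using field_hom_extend_algebraic[OF *(1,6)] by blast
  note P' = partial_embedding_adj[OF Cons.prems(1) \<sigma>']
  have KK': "K \<subseteq> adj K y" using adj_base[OF *(1)] .
  define M where "M = star_set N"
  have M: "subfld M" unfolding M_def using subfld_star_set[OF Cons.prems(2)] .
  have FM: "\<sigma> ` F \<subseteq> M" using Cons.prems(3) by (simp add: rel_alg_closed_def M_def)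
  obtain w where w: "\<sigma>' y = star w" by (cases "\<sigma>' y")
  have im: "\<sigma>' ` F = \<sigma> ` F" using *(4) \<sigma>'(2) by force
  have wF: "star w \<in> acl (\<sigma> ` F)"
    using image_acl[OF subfld_adj[OF *(1)] \<sigma>'(1) _ adj_gen[OF *(1)] yF] *(4) KK' im w by auto
  define N1 where "N1 n = adj (N n) (w n)" for n
  have N1: "subfld (N1 n)" for n unfolding N1_def using subfld_adj[OF Cons.prems(2)] .
  have "star w \<in> acl M" using wF acl_mono[OF FM] by blast
  then have sub: "star_set N1 \<subseteq> adj M (star w)"
    unfolding N1_def M_def by (intro star_set_adj_subset Cons.prems(2))
  have "star w \<in> star_set N1"
    unfolding star_in_star_set N1_def using adj_gen[OF Cons.prems(2)] by (simp add: always_eventually)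
  moreover have "M \<subseteq> star_set N1"
  proof
    fix u assume "u \<in> M"
    then obtain f where "u = star f" "\<forall>\<^sub>F n in ufilter. f n \<in> N n" by (auto simp: M_def star_set_def)
    moreover have "N n \<subseteq> N1 n" for n unfolding N1_def using adj_base[OF Cons.prems(2)] .
    ultimately show "u \<in> star_set N1"
      by (simp add: star_in_star_set) (erule eventually_mono, blast)
  qed
  ultimately have sub': "adj (\<sigma> ` F) (star w) \<subseteq> star_set N1"
    using FM by (intro adj_least subfld_star_set N1) auto
  have "rel_alg_closed (adj (\<sigma> ` F) (star w)) (adj M (star w))"
    using rel_alg_closed_adj_algebraic[OF Cons.prems(3) wF] by (simp add: M_def)
  \<comment> \<open>Relative closedness holds in the external extension of \<open>M\<close> by
    \<open>star w\<close> (\<open>rel_alg_closed_adj_algebraic\<close>) and is inherited by the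
    internal field \<open>star_set N1\<close> inside it.\<close>
  then have rac': "rel_alg_closed (\<sigma>' ` adj F y) (star_set N1)"
    unfolding P'(2) w using subfld_star_set[OF N1] sub' sub by (rule rel_alg_closed_subset)
  have F': "adj F y \<subseteq> L" using adj_least[OF L Cons.prems(4)] Cons.prems(5) by simp
  have FF': "F \<subseteq> adj F y" "y \<in> adj F y" using adj_base[OF *(2)] adj_gen[OF *(2)] .
  have "set ys \<subseteq> acl (adj F y)" using Cons.prems(6) acl_mono[OF FF'(1)] by auto
  then obtain K' F' \<tau> N' where \<tau>: "partial_embedding K' F' \<tau>" "\<forall>n. subfld (N' n)"
    "rel_alg_closed (\<tau> ` F') (star_set N')" "F' \<subseteq> L" "adj K y \<subseteq> K'" "\<forall>a\<in>adj K y. \<tau> a = \<sigma>' a"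
    "adj F y \<subseteq> F'" "set ys \<subseteq> F'"
    using Cons.IH[OF P'(1) N1 rac' F'] Cons.prems(5) by auto
  then show ?case
    using KK' \<sigma>'(2) FF' by (intro exI[of _ K'] exI[of _ F'] exI[of _ \<tau>] exI[of _ N']) auto
qed

subsection \<open>Transfer of quantifier-free formulas\<close>

lemma rterm_val_star:
  "rterm_val (\<lambda>i. star (w i)) (map_rterm cst s) = star (\<lambda>n. rterm_val (\<lambda>i. w i n) s)"
  for s :: "'a::field rterm"
  by (induction s) (auto simp: cst_def star_arith star_0 star_1)

text \<open>Los's theorem for quantifier-free formulas; the case of negation is where the filter
  must be an ultrafilter.\<close>

lemma qf_holds_star:
  "qf_holds (\<lambda>i. star (w i)) (map_qf_formula cst \<phi>) \<longleftrightarrow> (\<forall>\<^sub>F n in ufilter. qf_holds (\<lambda>i. w i n) \<phi>)"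
  for \<phi> :: "'a::field qf_formula"
  by (induction \<phi>)
     (simp_all add: rterm_val_star star_eq_iff eventually_ufilter_not_iff eventually_conj_iff
        eventually_ufilter_disj_iff)

lemma rterm_val_hom:
  assumes K: "subfld K" and \<sigma>: "field_hom_on \<sigma> K" "\<And>a. a \<in> rterm_params s \<Longrightarrow> a \<in> K \<and> \<sigma> a = a" "range e \<subseteq> K"
  shows "rterm_val e s \<in> K \<and> rterm_val (\<lambda>i. \<sigma> (e i)) s = \<sigma> (rterm_val e s)"
  using assms(3)
proof (induction s)
  case (Var i)
  then show ?case using \<sigma>(3) by auto
qed (auto simp: field_hom_0[OF K \<sigma>(1)] field_hom_1[OF K \<sigma>(1)] field_hom_add[OF K \<sigma>(1)] field_hom_mult[OF K \<sigma>(1)]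
    field_hom_uminus[OF K \<sigma>(1)] subfld_0[OF K] subfld_1[OF K] intro: subfld_add[OF K] subfld_mult[OF K] subfld_uminus[OF K])

lemma qf_holds_hom:
  assumes K: "subfld K" and \<sigma>: "field_hom_on \<sigma> K" "\<And>a. a \<in> qf_params \<phi> \<Longrightarrow> a \<in> K \<and> \<sigma> a = a" "range e \<subseteq> K"
  shows "qf_holds (\<lambda>i. \<sigma> (e i)) \<phi> \<longleftrightarrow> qf_holds e \<phi>"
  using assms(3)
proof (induction \<phi>)
  case (Equal s t)
  have "rterm_val e s \<in> K" "rterm_val (\<lambda>i. \<sigma> (e i)) s = \<sigma> (rterm_val e s)"
    "rterm_val e t \<in> K" "rterm_val (\<lambda>i. \<sigma> (e i)) t = \<sigma> (rterm_val e t)"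
    using rterm_val_hom[OF K \<sigma>(1) _ \<sigma>(3), of s] rterm_val_hom[OF K \<sigma>(1) _ \<sigma>(3), of t] Equal by auto
  then show ?case using inj_on_eq_iff[OF field_hom_inj[OF K \<sigma>(1)]] by simp
qed auto

primrec rterm_vars :: "'a rterm \<Rightarrow> nat set" where
  "rterm_vars (Param a) = {}"
| "rterm_vars (Var i) = {i}"
| "rterm_vars Zero = {}"
| "rterm_vars One = {}"
| "rterm_vars (Add s t) = rterm_vars s \<union> rterm_vars t"
| "rterm_vars (Minus s) = rterm_vars s"
| "rterm_vars (Mult s t) = rterm_vars s \<union> rterm_vars t"

primrec qf_vars :: "'a qf_formula \<Rightarrow> nat set" where
  "qf_vars (Equal s t) = rterm_vars s \<union> rterm_vars t"
| "qf_vars (Negation \<phi>) = qf_vars \<phi>"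
| "qf_vars (Conjunction \<phi> \<psi>) = qf_vars \<phi> \<union> qf_vars \<psi>"
| "qf_vars (Disjunction \<phi> \<psi>) = qf_vars \<phi> \<union> qf_vars \<psi>"

lemma finite_rterm_vars: "finite (rterm_vars s)"
  by (induction s) auto

lemma finite_qf_vars: "finite (qf_vars \<phi>)"
  by (induction \<phi>) (auto simp: finite_rterm_vars)

lemma rterm_val_cong_vars: "(\<And>i. i \<in> rterm_vars s \<Longrightarrow> e i = e' i) \<Longrightarrow> rterm_val e s = rterm_val e' s"
  by (induction s) auto

lemma qf_holds_cong_vars: "(\<And>i. i \<in> qf_vars \<phi> \<Longrightarrow> e i = e' i) \<Longrightarrow> qf_holds e \<phi> = qf_holds e' \<phi>"
proof (induction \<phi>)
  case (Equal s t)
  then show ?case using rterm_val_cong_vars[of s e e'] rterm_val_cong_vars[of t e e'] by simp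
qed auto

text \<open>Only the finitely many variables of \<open>\<phi>\<close> matter, so witnesses may be taken with finite range.\<close>

lemma qf_holds_finite_range:
  "\<exists>h. finite (range h) \<and> h 0 = 0 \<and> (\<forall>e :: nat \<Rightarrow> 'a::comm_ring_1. qf_holds (\<lambda>i. e (h i)) \<phi> = qf_holds e \<phi>)"
proof -
  define h :: "nat \<Rightarrow> nat" where "h i = (if i \<in> qf_vars \<phi> then i else 0)" for i
  have "finite (range h)"
    by (rule finite_subset[of _ "insert 0 (qf_vars \<phi>)"]) (auto simp: h_def finite_qf_vars)
  moreover have "qf_holds (\<lambda>i. e (h i)) \<phi> = qf_holds e \<phi>" for e :: "nat \<Rightarrow> 'a"
    by (rule qf_holds_cong_vars) (simp add: h_def)
  ultimately show ?thesis by (intro exI[of _ h]) (auto simp: h_def)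
qed

text \<open>The points \<open>e n 0\<close> with their witnesses define a nonstandard tuple E inside
  *L that violates the formula. The field F generated by E and A is embedded so that E 0 goes to a
  sequence from \<open>Z\<close> and the image is relatively algebraically closed in an internal
  field \<open>star_set N\<close>. Finitely many conditions hold in almost every coordinate: the
  formula fails, the witness and A lie in \<open>N n\<close>, the first entry is in
  \<open>Z\<close>, and B is missed. Any such coordinate is the required field.\<close>

theorem specialise_witness:
  fixes \<phi> :: "qbar qf_formula" and e :: "nat \<Rightarrow> nat \<Rightarrow> qbar"
  assumes Z: "hilbertian_set Z" and L: "subfld L"
    and e: "\<And>n. range (e n) \<subseteq> L" "inj (\<lambda>n. e n 0)" "\<And>n. \<not> qf_holds (e n) \<phi>"
    and A: "finite A" "A \<subseteq> L" and B: "finite B" "B \<inter> L = {}"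
  shows "\<exists>N z v. subfld N \<and> A \<subseteq> N \<and> B \<inter> N = {} \<and> z \<in> Z \<and> v 0 = of_rat z \<and> range v \<subseteq> N \<and>
    finite (range v) \<and> \<not> qf_holds v \<phi>"
proof -
  obtain h where h: "finite (range h)" "h 0 = 0"
    "\<And>e :: nat \<Rightarrow> qbar. qf_holds (\<lambda>i. e (h i)) \<phi> = qf_holds e \<phi>" using qf_holds_finite_range by blast
  define E where "E i = star (\<lambda>n. e n (h i))" for i
  define \<Phi> where "\<Phi> = map_qf_formula cst \<phi>"
  define L' where "L' = star_set (\<lambda>_. L)"
  have L': "subfld L'" unfolding L'_def by (rule subfld_star_set) (rule L)
  have EL: "E i \<in> L'" for i
    unfolding E_def L'_def star_in_star_set using subsetD[OF e(1) rangeI] by (intro always_eventually allI)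
  have notE: "\<not> qf_holds E \<Phi>"
    unfolding E_def \<Phi>_def qf_holds_star using h(3)[of "e n" for n] e(3) by simp
  have fin: "finite (range E)"
  proof -
    have "range E = (\<lambda>k. star (\<lambda>n. e n k)) ` range h" by (auto simp: E_def image_image)
    then show ?thesis using h(1) by simp
  qed
  \<comment> \<open>An algebraic element of the ultrapower is almost everywhere constant, which the
    injectivity of n |-> \<open>e n 0\<close> excludes.\<close>
  have trans: "E 0 \<notin> acl \<rat>"
  proof
    assume "E 0 \<in> acl \<rat>"
    then obtain a where a: "\<forall>\<^sub>F n in ufilter. e n 0 = a" using acl_Rats_star by (force simp: E_def h(2))
    then obtain n0 where n0: "e n0 0 = a" using eventually_happens'[OF ufilter_not_bot] by blast
    have "\<forall>\<^sub>F n in ufilter. False"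
      using a eventually_ufilter_ge[of "Suc n0"]
    proof (rule eventually_elim2)
      fix n assume "e n 0 = a" "Suc n0 \<le> n"
      then show False using n0 injD[OF e(2), of n n0] by simp
    qed
    then show False by simp
  qed
  have QL: "\<rat> \<subseteq> L'" using subfld_Rats_subset[OF L'] .
  have "rel_alg_closed (id ` \<rat>) (star_rat :: qbar ultra set)" using rel_alg_closed_Rats by simp
  \<comment> \<open>Opening the transcendence basis with \<open>E 0\<close> secures that its image
    is a sequence of elements of \<open>Z\<close>.\<close>
  from partial_embedding_transcendental[OF Z partial_embedding_id this trans]
  obtain \<sigma> g where \<sigma>: "partial_embedding (adj (range cst) (E 0)) (adj \<rat> (E 0)) \<sigma>"
    "rel_alg_closed (\<sigma> ` adj \<rat> (E 0)) star_rat" "\<sigma> (E 0) = starq g" and g: "\<And>n. g n \<in> Z" by blast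
  have E0: "E 0 \<in> adj (range cst) (E 0)"
    using adj_gen partial_embeddingD(1)[OF partial_embedding_id] by blast
  \<comment> \<open>The elements of A are listed too, so that they end up in F; since they are
    fixed, they then lie in the internal field.\<close>
  obtain ys where ys: "set ys = range E \<union> cst ` A" using finite_list[of "range E \<union> cst ` A"] fin A(1) by auto
  have ysL: "set ys \<subseteq> L'" using A(2) EL by (auto simp: ys L'_def cst_in_star_set)
  have "adj \<rat> (E 0) \<subseteq> L'" using adj_least[OF L' QL EL] .
  from partial_embedding_basis[OF Z L' \<sigma>(1,2) this ysL]
  obtain K1 F1 \<sigma>1 where \<sigma>1: "partial_embedding K1 F1 \<sigma>1" "rel_alg_closed (\<sigma>1 ` F1) star_rat" "F1 \<subseteq> L'"
    "adj (range cst) (E 0) \<subseteq> K1" "\<forall>a\<in>adj (range cst) (E 0). \<sigma>1 a = \<sigma> a" "set ys \<subseteq> acl F1" by blast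
  from partial_embedding_algebraic[OF L' \<sigma>1(1) subfld_Rats \<sigma>1(2,3) ysL \<sigma>1(6)]
  obtain K F \<tau> N where \<tau>: "partial_embedding K F \<tau>" "\<And>n. subfld (N n)" "rel_alg_closed (\<tau> ` F) (star_set N)"
    "F \<subseteq> L'" "K1 \<subseteq> K" "\<forall>a\<in>K1. \<tau> a = \<sigma>1 a" "set ys \<subseteq> F" by blast
  note * = partial_embeddingD[OF \<tau>(1)]
  have FN: "\<tau> ` F \<subseteq> star_set N" using \<tau>(3) by (simp add: rel_alg_closed_def)
  define w where "w i = rep_ultra (\<tau> (E i))" for i
  have w: "\<tau> (E i) = star (w i)" for i unfolding w_def by (simp add: Quotient3_abs_rep[OF Quotient3_ultra])
  have EF: "range E \<subseteq> F" using \<tau>(7) ys by auto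
  have "\<not> qf_holds (\<lambda>i. \<tau> (E i)) \<Phi>"
  proof (subst qf_holds_hom[OF *(1,6)])
    show "range E \<subseteq> K" using EF *(4) by blast
    show "a \<in> K \<and> \<tau> a = a" if "a \<in> qf_params \<Phi>" for a
      using that *(3,7) by (auto simp: \<Phi>_def qf_formula.set_map)
  qed (rule notE)
  then have ev1: "\<forall>\<^sub>F n in ufilter. \<not> qf_holds (\<lambda>i. w i n) \<phi>"
    by (simp add: w \<Phi>_def qf_holds_star eventually_ufilter_not_iff)
  have "\<forall>\<^sub>F n in ufilter. \<forall>u\<in>\<tau> ` range E. rep_ultra u n \<in> N n"
  proof (rule eventually_ball_finite)
    show "finite (\<tau> ` range E)" using fin by simp
    show "\<forall>u\<in>\<tau> ` range E. \<forall>\<^sub>F n in ufilter. rep_ultra u n \<in> N n"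
    proof
      fix u assume "u \<in> \<tau> ` range E"
      then have "u \<in> star_set N" using FN EF by blast
      then have "star (rep_ultra u) \<in> star_set N" by (simp add: Quotient3_abs_rep[OF Quotient3_ultra])
      then show "\<forall>\<^sub>F n in ufilter. rep_ultra u n \<in> N n" by (simp add: star_in_star_set)
    qed
  qed
  then have ev2: "\<forall>\<^sub>F n in ufilter. \<forall>i. w i n \<in> N n"
    by (rule eventually_mono) (simp add: w_def)
  have "\<tau> (E 0) = starq g" using \<tau>(6) \<sigma>1(4,5) E0 \<sigma>(3) by auto
  then have ev3: "\<forall>\<^sub>F n in ufilter. w 0 n = of_rat (g n)" by (simp add: w starq_def star_eq_iff)
  have ev4: "\<forall>\<^sub>F n in ufilter. \<forall>a\<in>A. a \<in> N n"
  proof (intro eventually_ball_finite ballI A)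
    fix a assume "a \<in> A"
    then have "cst a \<in> F" using \<tau>(7) ys by auto
    then have "\<tau> (cst a) \<in> star_set N" using FN by blast
    then show "\<forall>\<^sub>F n in ufilter. a \<in> N n" using *(7) by (simp add: cst_in_star_set)
  qed
  have ev5: "\<forall>\<^sub>F n in ufilter. \<forall>b\<in>B. b \<notin> N n"
  proof (intro eventually_ball_finite ballI B)
    fix b assume b: "b \<in> B"
    \<comment> \<open>Relative algebraic closedness pays off here: a standard b in
      \<open>star_set N\<close> is algebraic over the image of F, so it is in that image; as the
      embedding is injective and fixes b, it lies in F and thus in *L, whence b is in L.\<close>
    have "cst b \<notin> star_set N"
    proof
      assume bN: "cst b \<in> star_set N"
      have "cst b \<in> acl (\<tau> ` F)"
        using cst_algebraic acl_mono[OF subfld_Rats_subset[OF *(10)]] by blast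
      then have "cst b \<in> \<tau> ` F" using bN \<tau>(3) by (auto simp: rel_alg_closed_def)
      then obtain f where f: "f \<in> F" "cst b = \<tau> f" by blast
      have "f \<in> K" "cst b \<in> K" using f(1) *(3,4) by auto
      moreover have "\<tau> f = \<tau> (cst b)" using f(2) *(7)[of b] by simp
      ultimately have "f = cst b" using inj_onD[OF *(12)] by blast
      then have "cst b \<in> L'" using f \<tau>(4) by blast
      then show False using b B(2) by (auto simp: L'_def cst_in_star_set)
    qed
    then show "\<forall>\<^sub>F n in ufilter. b \<notin> N n" by (simp add: cst_in_star_set eventually_ufilter_not_iff)
  qed
  have "\<forall>\<^sub>F n in ufilter. \<not> qf_holds (\<lambda>i. w i n) \<phi> \<and> (\<forall>i. w i n \<in> N n) \<and> w 0 n = of_rat (g n) \<and>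
      (\<forall>a\<in>A. a \<in> N n) \<and> (\<forall>b\<in>B. b \<notin> N n)"
    using ev1 ev2 ev3 ev4 ev5 by (simp add: eventually_conj_iff)
  then obtain n where n: "\<not> qf_holds (\<lambda>i. w i n) \<phi>" "\<forall>i. w i n \<in> N n" "w 0 n = of_rat (g n)"
      "\<forall>a\<in>A. a \<in> N n" "\<forall>b\<in>B. b \<notin> N n" using eventually_happens'[OF ufilter_not_bot] by blast
  have "range (\<lambda>i. w i n) = (\<lambda>u. rep_ultra (\<tau> u) n) ` range E" by (auto simp: w_def image_image)
  then have "finite (range (\<lambda>i. w i n))" using fin by simp
  then show ?thesis
    using n g \<tau>(2) by (intro exI[of _ "N n"] exI[of _ "g n"] exI[of _ "\<lambda>i. w i n"]) auto
qed


section \<open>Polynomial functions, regular functions and the Zariski topology\<close>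

section \<open>Polynomial functions and the Zariski topology\<close>

text \<open>Evaluation of a polynomial through a ring homomorphism on its coefficients.\<close>

locale coeff_hom =
  fixes \<phi> :: "'a::comm_ring_1 \<Rightarrow> 'b::comm_ring_1"
  assumes hom_0 [simp]: "\<phi> 0 = 0" and hom_1 [simp]: "\<phi> 1 = 1"
    and hom_add [simp]: "\<phi> (a + b) = \<phi> a + \<phi> b" and hom_mult [simp]: "\<phi> (a * b) = \<phi> a * \<phi> b"
begin

lemma hom_uminus [simp]: "\<phi> (- a) = - \<phi> a"
  using hom_add[of "- a" a] by (simp add: eq_neg_iff_add_eq_0 del: hom_add)

lemma eval_pCons: "poly (map_poly \<phi> (pCons a p)) y = \<phi> a + y * poly (map_poly \<phi> p) y"
  by (simp add: map_poly_pCons)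

lemma eval_add: "poly (map_poly \<phi> (p + q)) y = poly (map_poly \<phi> p) y + poly (map_poly \<phi> q) y"
proof -
  have "map_poly \<phi> (p + q) = map_poly \<phi> p + map_poly \<phi> q"
    by (rule poly_eqI) (simp add: coeff_map_poly)
  then show ?thesis by simp
qed

lemma eval_smult: "poly (map_poly \<phi> (smult a q)) y = \<phi> a * poly (map_poly \<phi> q) y"
proof -
  have "map_poly \<phi> (smult a q) = smult (\<phi> a) (map_poly \<phi> q)"
    by (rule poly_eqI) (simp add: coeff_map_poly)
  then show ?thesis by simp
qed

lemma eval_mult: "poly (map_poly \<phi> (p * q)) y = poly (map_poly \<phi> p) y * poly (map_poly \<phi> q) y"
  by (induction p) (simp_all add: eval_add eval_smult map_poly_pCons algebra_simps)

text \<open>Evaluation is again a homomorphism on coefficients, so the locale can be applied to its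
  own result; iterating gives evaluation in two variables.\<close>

lemma coeff_hom_eval: "coeff_hom (\<lambda>p. poly (map_poly \<phi> p) y)"
  by unfold_locales (simp_all add: eval_add eval_mult map_poly_1)

lemma eval_hom: "\<phi> (poly p x) = poly (map_poly \<phi> p) (\<phi> x)"
  by (induction p) (simp_all add: map_poly_pCons)

end

interpretation to_ac: coeff_hom "to_ac :: 'k::field \<Rightarrow> 'k alg_closure"
  by unfold_locales simp_all

definition ev1 :: "'k::field poly \<Rightarrow> 'k alg_closure \<Rightarrow> 'k alg_closure" where
  "ev1 p t = poly (map_poly to_ac p) t"

text \<open>P is read as a polynomial in the second coordinate y whose coefficients are polynomials
  in the first coordinate t.\<close>

definition ev2 :: "'k::field poly poly \<Rightarrow> 'k alg_closure \<Rightarrow> 'k alg_closure \<Rightarrow> 'k alg_closure" where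
  "ev2 P t y = poly (map_poly (\<lambda>p. ev1 p t) P) y"

interpretation ev1: coeff_hom "\<lambda>p. ev1 p t"
  unfolding ev1_def by (rule to_ac.coeff_hom_eval)

interpretation ev2: coeff_hom "\<lambda>P. ev2 P t y"
  unfolding ev2_def by (rule ev1.coeff_hom_eval)

lemma ev1_pCons [simp]: "ev1 (pCons a p) t = to_ac a + t * ev1 p t"
  by (simp add: ev1_def map_poly_pCons)

lemma ev2_pCons [simp]: "ev2 (pCons a p) t y = ev1 a t + y * ev2 p t y"
  by (simp add: ev2_def map_poly_pCons)

lemma ev2_monom: "ev2 (monom a i) t y = ev1 a t * y ^ i"
  by (simp add: ev2_def map_poly_monom poly_monom)

lemma ev1_to_ac: "ev1 p (to_ac z) = to_ac (poly p z)"
  by (simp add: ev1_def to_ac.eval_hom)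

lemma ev2_to_ac: "ev2 P (to_ac z) (to_ac u) = to_ac (poly (poly P [:u:]) z)"
  by (induction P) (simp_all add: ev1_to_ac)

lemma finite_ev1_zeros: "p \<noteq> 0 \<Longrightarrow> finite {t. ev1 p t = 0}"
  unfolding ev1_def by (rule poly_roots_finite) (auto simp: poly_eq_iff coeff_map_poly)

lemma ev1_nonzero_point:
  assumes "(p :: 'k::field_char_0 poly) \<noteq> 0"
  shows "\<exists>t. ev1 p t \<noteq> 0"
proof (rule ccontr)
  assume "\<nexists>t. ev1 p t \<noteq> 0"
  then have "{t. ev1 p t = 0} = UNIV" by auto
  then show False using finite_ev1_zeros[OF assms] by (simp add: infinite_UNIV_char_0)
qed

lemma polyfun_minus: "p \<in> polyfun n \<Longrightarrow> (\<lambda>x. - p x) \<in> polyfun n"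
  using polyfun.mult[OF polyfun.const[where c = "-1"], of p n] by simp

lemma polyfun_diff: "p \<in> polyfun n \<Longrightarrow> q \<in> polyfun n \<Longrightarrow> (\<lambda>x. p x - q x) \<in> polyfun n"
  using polyfun.add[OF _ polyfun_minus, of p n q] by simp

lemma polyfun_ev1: "p \<in> polyfun n \<Longrightarrow> (\<lambda>x. ev1 q (p x)) \<in> polyfun n"
proof (induction q)
  case 0
  then show ?case using polyfun.const[of 0] by simp
next
  case (pCons a q)
  then show ?case using polyfun.add[OF polyfun.const[of a] polyfun.mult[of p n "\<lambda>x. ev1 q (p x)"]] by simp
qed

lemma polyfun_ev2: "i < n \<Longrightarrow> j < n \<Longrightarrow> (\<lambda>x. ev2 P (x ! i) (x ! j)) \<in> polyfun n"
proof (induction P)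
  case 0
  then show ?case using polyfun.const[of 0] by simp
next
  case (pCons a P)
  then have "(\<lambda>x. ev1 a (x ! i)) \<in> polyfun n" by (intro polyfun_ev1 polyfun.coord)
  then show ?case
    using polyfun.add[OF _ polyfun.mult[OF polyfun.coord]] pCons by simp
qed

lemma polyfun_2_iff: "p \<in> polyfun 2 \<longleftrightarrow> (\<exists>P. p = (\<lambda>x. ev2 P (x ! 0) (x ! 1)))"
proof
  assume "p \<in> polyfun 2"
  then show "\<exists>P. p = (\<lambda>x. ev2 P (x ! 0) (x ! 1))"
  proof induction
    case (const c)
    then show ?case by (intro exI[of _ "[:[:c:]:]"]) simp
  next
    case (coord i)
    then consider "i = 0" | "i = 1" by linarith
    then show ?case
    proof cases
      case 1
      then show ?thesis by (intro exI[of _ "[:[:0, 1:]:]"]) simp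
    next
      case 2
      then show ?thesis by (intro exI[of _ "[:0, 1:]"]) simp
    qed
  next
    case (add p q)
    then obtain P Q where "p = (\<lambda>x. ev2 P (x ! 0) (x ! 1))" "q = (\<lambda>x. ev2 Q (x ! 0) (x ! 1))" by blast
    then show ?case by (intro exI[of _ "P + Q"]) simp
  next
    case (mult p q)
    then obtain P Q where "p = (\<lambda>x. ev2 P (x ! 0) (x ! 1))" "q = (\<lambda>x. ev2 Q (x ! 0) (x ! 1))" by blast
    then show ?case by (intro exI[of _ "P * Q"]) simp
  qed
qed (auto intro: polyfun_ev2)

lemma polyfun_1_iff: "p \<in> polyfun 1 \<longleftrightarrow> (\<exists>P. p = (\<lambda>x. ev1 P (x ! 0)))"
proof
  assume "p \<in> polyfun 1"
  then show "\<exists>P. p = (\<lambda>x. ev1 P (x ! 0))"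
  proof induction
    case (const c)
    then show ?case by (intro exI[of _ "[:c:]"]) simp
  next
    case (coord i)
    then show ?case by (intro exI[of _ "[:0, 1:]"]) simp
  next
    case (add p q)
    then obtain P Q where "p = (\<lambda>x. ev1 P (x ! 0))" "q = (\<lambda>x. ev1 Q (x ! 0))" by blast
    then show ?case by (intro exI[of _ "P + Q"]) simp
  next
    case (mult p q)
    then obtain P Q where "p = (\<lambda>x. ev1 P (x ! 0))" "q = (\<lambda>x. ev1 Q (x ! 0))" by blast
    then show ?case by (intro exI[of _ "P * Q"]) simp
  qed
qed (auto intro: polyfun_ev1 polyfun.coord)

text \<open>Nonvanishing sets of single polynomials are closed under finite intersection, by taking
  products, so they form a basis and not only a subbasis.\<close>

lemma openin_zariski_iff:
  "openin (zariski n) V \<longleftrightarrow>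
     (\<forall>x\<in>V. length x = n \<and> (\<exists>p\<in>polyfun n. p x \<noteq> 0 \<and> (\<forall>y. length y = n \<longrightarrow> p y \<noteq> 0 \<longrightarrow> y \<in> V)))"
  (is "_ \<longleftrightarrow> (\<forall>x\<in>V. ?P V x)")
proof
  assume "openin (zariski n) V"
  then have "generate_topology_on {{x. length x = n \<and> p x \<noteq> 0} | p. p \<in> polyfun n} V"
    by (simp add: zariski_def openin_topology_generated_by_iff)
  then show "\<forall>x\<in>V. ?P V x"
  proof induction
    case Empty
    then show ?case by simp
  next
    case (Int A B)
    show ?case
    proof
      fix x assume x: "x \<in> A \<inter> B"
      then obtain p q where p: "p \<in> polyfun n" "p x \<noteq> 0" "\<And>y. length y = n \<Longrightarrow> p y \<noteq> 0 \<Longrightarrow> y \<in> A"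
        and q: "q \<in> polyfun n" "q x \<noteq> 0" "\<And>y. length y = n \<Longrightarrow> q y \<noteq> 0 \<Longrightarrow> y \<in> B"
        using Int by blast
      have "p x * q x \<noteq> 0" using p(2) q(2) by simp
      moreover have "\<forall>y. length y = n \<longrightarrow> p y * q y \<noteq> 0 \<longrightarrow> y \<in> A \<inter> B" using p(3) q(3) by simp
      moreover have "length x = n" using x Int by blast
      ultimately show "?P (A \<inter> B) x"
        by (intro conjI bexI[of _ "\<lambda>x. p x * q x"] polyfun.mult[OF p(1) q(1)])
    qed
  next
    case (UN K)
    show ?case
    proof
      fix x assume "x \<in> \<Union>K"
      then obtain k where k: "k \<in> K" "x \<in> k" by blast
      then have "?P k x" using UN by blast
      then show "?P (\<Union>K) x" using k by blast
    qed
  next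
    case (Basis s)
    then show ?case by blast
  qed
next
  assume V: "\<forall>x\<in>V. ?P V x"
  define B where "B = {{y. length y = n \<and> p y \<noteq> 0} | p. p \<in> polyfun n \<and> (\<forall>y. length y = n \<longrightarrow> p y \<noteq> 0 \<longrightarrow> y \<in> V)}"
  have "V = \<Union>B"
  proof
    show "V \<subseteq> \<Union>B"
    proof
      fix x assume "x \<in> V"
      then obtain p where "length x = n" "p \<in> polyfun n" "p x \<noteq> 0" "\<forall>y. length y = n \<longrightarrow> p y \<noteq> 0 \<longrightarrow> y \<in> V"
        using V by blast
      then show "x \<in> \<Union>B" unfolding B_def by blast
    qed
  qed (auto simp: B_def)
  moreover have "openin (zariski n) b" if "b \<in> B" for b
    using that unfolding zariski_def B_def by (intro topology_generated_by_Basis) auto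
  ultimately show "openin (zariski n) V" by auto
qed

lemma topspace_zariski [simp]: "topspace (zariski n) = {x. length x = n}"
proof -
  have "openin (zariski n) {x :: 'a alg_closure list. length x = n}"
    unfolding openin_zariski_iff by (auto intro!: bexI[OF _ polyfun.const[of 1]])
  moreover have "topspace (zariski n) \<subseteq> {x :: 'a alg_closure list. length x = n}"
    using openin_zariski_iff[of n "topspace (zariski n) :: 'a alg_closure list set"] by auto
  ultimately show ?thesis using openin_subset by blast
qed

lemma closedin_zariski_zeros:
  assumes p: "p \<in> polyfun n"
  shows "closedin (zariski n) {x. length x = n \<and> p x = 0}"
  unfolding closedin_def using p by (auto simp: openin_zariski_iff intro!: bexI[OF _ p])

lemma topology_generated_by_openin: "topology_generated_by (Collect (openin X)) = X"
proof (rule topology_eq[THEN iffD2], intro allI iffI)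
  fix S assume "openin (topology_generated_by (Collect (openin X))) S"
  then have "generate_topology_on (Collect (openin X)) S" by (simp add: openin_topology_generated_by_iff)
  then show "openin X S" by induction auto
next
  fix S assume "openin X S"
  then show "openin (topology_generated_by (Collect (openin X))) S"
    by (intro topology_generated_by_Basis) simp
qed

lemma variety_topology_closed_subset:
  "variety_topology [(n, U, id)] = subtopology (zariski n) U"
proof -
  have "pullback_topology U id (zariski n) = subtopology (zariski n) U"
    unfolding topology_eq openin_pullback_topology openin_subtopology by auto
  then show ?thesis by (simp add: variety_topology_def topology_generated_by_openin)
qed

lemma regular_on_cong: "regular_on n S f \<Longrightarrow> (\<And>x. x \<in> S \<Longrightarrow> f x = g x) \<Longrightarrow> regular_on n S g"
  unfolding regular_on_def by metis

lemma regular_onD: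
  assumes "regular_on n S f" "x \<in> S"
  shows "\<exists>p q. p \<in> polyfun n \<and> q \<in> polyfun n \<and> q x \<noteq> 0 \<and> (\<forall>y\<in>S. q y \<noteq> 0 \<longrightarrow> f y = p y / q y)"
  using assms unfolding regular_on_def by blast

lemma regular_onI:
  assumes "\<And>x. x \<in> S \<Longrightarrow> \<exists>p q. p \<in> polyfun n \<and> q \<in> polyfun n \<and> q x \<noteq> 0 \<and> (\<forall>y\<in>S. q y \<noteq> 0 \<longrightarrow> f y = p y / q y)"
  shows "regular_on n S f"
  using assms unfolding regular_on_def by blast

lemma regular_on_subset:
  assumes "regular_on n S f" "T \<subseteq> S"
  shows "regular_on n T f"
proof (rule regular_onI)
  fix x assume "x \<in> T"
  then obtain p q where "p \<in> polyfun n" "q \<in> polyfun n" "q x \<noteq> 0" "\<forall>y\<in>S. q y \<noteq> 0 \<longrightarrow> f y = p y / q y"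
    using regular_onD[OF assms(1), of x] assms(2) by blast
  then show "\<exists>p q. p \<in> polyfun n \<and> q \<in> polyfun n \<and> q x \<noteq> 0 \<and> (\<forall>y\<in>T. q y \<noteq> 0 \<longrightarrow> f y = p y / q y)"
    using assms(2) by (intro exI[of _ p] exI[of _ q]) auto
qed

lemma regular_on_polyfun: "p \<in> polyfun n \<Longrightarrow> regular_on n S p"
  using polyfun.const[of 1 n] by (intro regular_onI exI[of _ p] exI[of _ "\<lambda>_. 1"]) simp

lemma regular_on_quotient:
  "p \<in> polyfun n \<Longrightarrow> q \<in> polyfun n \<Longrightarrow> (\<And>x. x \<in> S \<Longrightarrow> q x \<noteq> 0) \<Longrightarrow> regular_on n S (\<lambda>x. p x / q x)"
  unfolding regular_on_def by blast

lemma regular_on_add: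
  assumes "regular_on n S f" "regular_on n S g"
  shows "regular_on n S (\<lambda>x. f x + g x)"
proof (rule regular_onI)
  fix x assume "x \<in> S"
  obtain p q where p: "p \<in> polyfun n" "q \<in> polyfun n" "q x \<noteq> 0" "\<forall>y\<in>S. q y \<noteq> 0 \<longrightarrow> f y = p y / q y"
    using regular_onD[OF assms(1) \<open>x \<in> S\<close>] by blast
  obtain p' q' where p': "p' \<in> polyfun n" "q' \<in> polyfun n" "q' x \<noteq> 0" "\<forall>y\<in>S. q' y \<noteq> 0 \<longrightarrow> g y = p' y / q' y"
    using regular_onD[OF assms(2) \<open>x \<in> S\<close>] by blast
  note * = p p'
  show "\<exists>a b. a \<in> polyfun n \<and> b \<in> polyfun n \<and> b x \<noteq> 0 \<and> (\<forall>y\<in>S. b y \<noteq> 0 \<longrightarrow> f y + g y = a y / b y)"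
  proof (intro exI conjI ballI impI)
    show "(\<lambda>x. p x * q' x + p' x * q x) \<in> polyfun n" "(\<lambda>x. q x * q' x) \<in> polyfun n"
      by (intro polyfun.add polyfun.mult *)+
    show "q x * q' x \<noteq> 0" using * by simp
    fix y assume "y \<in> S" "q y * q' y \<noteq> 0"
    then show "f y + g y = (p y * q' y + p' y * q y) / (q y * q' y)" using *(4,8) by (simp add: add_frac_eq)
  qed
qed

lemma regular_on_mult:
  assumes "regular_on n S f" "regular_on n S g"
  shows "regular_on n S (\<lambda>x. f x * g x)"
proof (rule regular_onI)
  fix x assume "x \<in> S"
  obtain p q where p: "p \<in> polyfun n" "q \<in> polyfun n" "q x \<noteq> 0" "\<forall>y\<in>S. q y \<noteq> 0 \<longrightarrow> f y = p y / q y"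
    using regular_onD[OF assms(1) \<open>x \<in> S\<close>] by blast
  obtain p' q' where p': "p' \<in> polyfun n" "q' \<in> polyfun n" "q' x \<noteq> 0" "\<forall>y\<in>S. q' y \<noteq> 0 \<longrightarrow> g y = p' y / q' y"
    using regular_onD[OF assms(2) \<open>x \<in> S\<close>] by blast
  note * = p p'
  show "\<exists>a b. a \<in> polyfun n \<and> b \<in> polyfun n \<and> b x \<noteq> 0 \<and> (\<forall>y\<in>S. b y \<noteq> 0 \<longrightarrow> f y * g y = a y / b y)"
  proof (intro exI conjI ballI impI)
    show "(\<lambda>x. p x * p' x) \<in> polyfun n" "(\<lambda>x. q x * q' x) \<in> polyfun n"
      by (intro polyfun.add polyfun.mult *)+
    show "q x * q' x \<noteq> 0" using * by simp
    fix y assume "y \<in> S" "q y * q' y \<noteq> 0"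
    then show "f y * g y = (p y * p' y) / (q y * q' y)" using *(4,8) by (simp add: add_frac_eq)
  qed
qed

lemma regular_on_uminus: "regular_on n S f \<Longrightarrow> regular_on n S (\<lambda>x. - f x)"
  using regular_on_mult[OF regular_on_polyfun[OF polyfun.const[of "-1"]], of n S f] by simp

lemma irreducible_in_closure_of_point:
  assumes "x \<in> topspace X"
  shows "irreducible_in X (X closure_of {x})"
  unfolding irreducible_in_def
proof (intro conjI allI impI)
  have x: "x \<in> X closure_of {x}" using closure_of_subset[of "{x}" X] assms by auto
  then show "X closure_of {x} \<noteq> {}" by blast
  show "X closure_of {x} \<subseteq> topspace X" by (rule closure_of_subset_topspace)
  fix C D assume "closedin X C" "closedin X D" "X closure_of {x} \<subseteq> C \<union> D"
  with x show "X closure_of {x} \<subseteq> C \<or> X closure_of {x} \<subseteq> D"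
    by (metis UnE closure_of_minimal empty_subsetI insert_subset subsetD)
qed

lemma irreducible_in_finite_cover:
  assumes "irreducible_in X S" "finite I" "\<And>i. i \<in> I \<Longrightarrow> closedin X (C i)" "S \<subseteq> (\<Union>i\<in>I. C i)"
  shows "\<exists>i\<in>I. S \<subseteq> C i"
  using assms(2-)
proof (induction I rule: finite_induct)
  case empty
  then show ?case using assms(1) by (auto simp: irreducible_in_def)
next
  case (insert i I)
  have "closedin X (C i)" "closedin X (\<Union>i\<in>I. C i)"
    using insert by (auto intro!: closedin_Union)
  then have "S \<subseteq> C i \<or> S \<subseteq> (\<Union>i\<in>I. C i)"
    using assms(1) insert.prems(2) by (simp add: irreducible_in_def)
  then show ?case using insert by auto
qed


section \<open>Geometry of an irreducible plane curve that is monic in the second variable\<close>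

section \<open>Plane curves\<close>

text \<open>The curve h(t,y) = 0. Primality is demanded over the rationals only, which matches
  irreducibility for the Zariski topology over the base field. Monicity in y makes every fibre of
  the projection to t nonempty and finite.\<close>

locale plane_curve =
  fixes h :: "rat poly poly"
  assumes prime: "prime_elem h" and monic: "lead_coeff h = 1"
begin

definition U :: "qbar list set" where
  "U = {x. length x = 2 \<and> ev2 h (x ! 0) (x ! 1) = 0}"

abbreviation W :: "(rat, qbar list) chart list" where
  "W \<equiv> [(2, U, id)]"

abbreviation X :: "qbar list topology" where
  "X \<equiv> subtopology (zariski 2) U"

definition val :: "rat poly poly \<Rightarrow> qbar list \<Rightarrow> qbar" where
  "val P x = ev2 P (x ! 0) (x ! 1)"

lemma val_simps [simp]: "val 0 x = 0" "val 1 x = 1" "val (P + Q) x = val P x + val Q x"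
  "val (P * Q) x = val P x * val Q x" "val (- P) x = - val P x" "val [:p:] x = ev1 p (x ! 0)"
  by (simp_all add: val_def)

lemma val_diff [simp]: "val (P - Q) x = val P x - val Q x"
  using val_simps(3)[of P "- Q" x] by simp

lemma polyfun_val: "p \<in> polyfun 2 \<longleftrightarrow> (\<exists>P. p = val P)"
  unfolding polyfun_2_iff val_def[abs_def] ..

lemma val_polyfun [intro]: "val P \<in> polyfun 2"
  using polyfun_val by blast

lemma val_h: "x \<in> U \<Longrightarrow> val h x = 0"
  by (simp add: U_def val_def)

lemma U_length: "x \<in> U \<Longrightarrow> length x = 2"
  by (simp add: U_def)

lemma degree_h: "degree h > 0"
proof (rule ccontr)
  assume "\<not> degree h > 0"
  then have "h = 1" using monic by (metis degree_eq_zeroE gr0I lead_coeff_pCons(2) one_pCons)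
  then show False using prime by simp
qed

lemma fibre_polynomial: "lead_coeff (map_poly (\<lambda>p. ev1 p t) h) = 1" "degree (map_poly (\<lambda>p. ev1 p t) h) = degree h"
proof -
  have c: "coeff (map_poly (\<lambda>p. ev1 p t) h) (degree h) = 1" by (simp add: coeff_map_poly monic)
  show "degree (map_poly (\<lambda>p. ev1 p t) h) = degree h"
  proof (rule antisym)
    show "degree (map_poly (\<lambda>p. ev1 p t) h) \<le> degree h"
      by (rule degree_le) (simp add: coeff_map_poly coeff_eq_0)
    show "degree h \<le> degree (map_poly (\<lambda>p. ev1 p t) h)"
      by (rule le_degree) (simp add: c)
  qed
  then show "lead_coeff (map_poly (\<lambda>p. ev1 p t) h) = 1" using c by simp
qed

lemma U_surj: "\<exists>y. [t, y] \<in> U"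
proof -
  have "\<exists>y. poly (map_poly (\<lambda>p. ev1 p t) h) y = 0"
    using degree_h by (intro alg_closed_imp_poly_has_root) (simp add: fibre_polynomial)
  then show ?thesis by (simp add: U_def ev2_def)
qed

lemma finite_fibre: "finite {y. [t, y] \<in> U}"
proof -
  have "map_poly (\<lambda>p. ev1 p t) h \<noteq> 0" using fibre_polynomial(1)[of t] by auto
  then show ?thesis by (simp add: U_def ev2_def poly_roots_finite)
qed

text \<open>Elimination of the second variable: an element of least degree in the ideal generated by \<open>h\<close> and \<open>g\<close>
  divides, up to a factor from the coefficient ring, both \<open>h\<close> and \<open>g\<close>.\<close>

lemma elimination:
  assumes g: "\<not> h dvd g"
  shows "\<exists>a c r. r \<noteq> 0 \<and> a * g + c * h = [:r:]"
proof -
  define I where "I w \<longleftrightarrow> w \<noteq> 0 \<and> (\<exists>a c. w = a * g + c * h)" for w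
  have h0: "h \<noteq> 0" using monic by auto
  have "h = 0 * g + 1 * h" by simp
  then have "I h" unfolding I_def using h0 by blast
  define w where "w = arg_min degree I"
  have w: "I w" "\<And>v. I v \<Longrightarrow> degree w \<le> degree v"
    using arg_min_nat_lemma[of I h degree] \<open>I h\<close> unfolding w_def by auto
  obtain a c where ac: "w = a * g + c * h" using w(1) by (auto simp: I_def)
  have "w \<noteq> 0" using w(1) by (simp add: I_def)
  have div: "\<exists>l q. l \<noteq> 0 \<and> smult l f = w * q" if f: "\<exists>a c. f = a * g + c * h" for f
  proof -
    obtain q r where qr: "pseudo_divmod f w = (q, r)" by force
    define l where "l = lead_coeff w ^ (Suc (degree f) - degree w)"
    have eq: "smult l f = w * q + r" and deg: "r = 0 \<or> degree r < degree w"
      using pseudo_divmod[OF \<open>w \<noteq> 0\<close> qr] by (auto simp: l_def)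
    obtain a' c' where f': "f = a' * g + c' * h" using f by blast
    have "r = smult l f - w * q" using eq by simp
    also have "\<dots> = (smult l a' - a * q) * g + (smult l c' - c * q) * h"
      by (simp add: f' ac algebra_simps smult_add_right)
    finally have "r \<noteq> 0 \<Longrightarrow> I r" unfolding I_def by blast
    then have "r = 0" using deg w(2)[of r] by force
    moreover have "l \<noteq> 0" using \<open>w \<noteq> 0\<close> by (simp add: l_def)
    ultimately show ?thesis using eq by auto
  qed
  \<comment> \<open>Otherwise write l h = w q. The prime h divides w or q, and if it divided q then
    w would divide l, against its positive degree. So h divides w, hence l' g for some nonzero l' of
    degree 0 in y, hence g.\<close>
  have "degree w = 0"
  proof (rule ccontr)
    assume dw: "degree w \<noteq> 0"
    have "\<exists>a c. h = a * g + c * h" by (intro exI[of _ 0] exI[of _ 1]) simp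
    then obtain l q where lq: "l \<noteq> 0" "smult l h = w * q" using div by blast
    then have "h dvd w * q" by (metis dvd_smult dvd_refl)
    then have "h dvd w \<or> h dvd q" using prime prime_elem_dvd_mult_iff by blast
    moreover have "\<not> h dvd q"
    proof
      assume "h dvd q"
      then obtain q' where "q = h * q'" by (auto elim: dvdE)
      then have "h * [:l:] = h * (w * q')" using lq by simp
      then have "[:l:] = w * q'" using h0 by (simp only: mult_cancel_left) simp
      then have "degree (w * q') = 0" by (metis degree_pCons_0)
      moreover have "w * q' \<noteq> 0" using \<open>[:l:] = w * q'\<close> lq(1) by (metis pCons_eq_0_iff)
      ultimately show False using dw by (simp add: degree_mult_eq)
    qed
    ultimately have hw: "h dvd w" by blast
    have "\<exists>a c. g = a * g + c * h" by (intro exI[of _ 1] exI[of _ 0]) simp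
    then obtain l q where lq: "l \<noteq> 0" "smult l g = w * q" using div by blast
    then have "h dvd [:l:] * g" using hw by simp
    then have "h dvd [:l:] \<or> h dvd g" using prime prime_elem_dvd_mult_iff by blast
    then have "h dvd [:l:]" using g by blast
    then have "degree h \<le> degree [:l:]" using lq(1) by (intro dvd_imp_degree_le) auto
    then show False using degree_h by simp
  qed
  then obtain r where "w = [:r:]" by (auto elim: degree_eq_zeroE)
  then show ?thesis using ac \<open>w \<noteq> 0\<close> by (intro exI[of _ a] exI[of _ c] exI[of _ r]) auto
qed

text \<open>The eliminant r is nonzero at some t; at any point of the curve above such a t the
  polynomial P cannot vanish.\<close>

lemma nonvanishing_point:
  assumes "\<not> h dvd P"
  shows "\<exists>x\<in>U. val P x \<noteq> 0"
proof -
  obtain a c r where *: "r \<noteq> 0" "a * P + c * h = [:r:]" using elimination[OF assms] by blast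
  obtain t where t: "ev1 r t \<noteq> 0" using ev1_nonzero_point[OF *(1)] by blast
  obtain y where y: "[t, y] \<in> U" using U_surj by blast
  have "val (a * P + c * h) [t, y] \<noteq> 0" unfolding *(2) using t by simp
  then have "val P [t, y] \<noteq> 0" using val_h[OF y] by auto
  then show ?thesis using y by blast
qed

text \<open>The Nullstellensatz for this curve. It turns statements about functions on
  \<open>U\<close> into divisibility by the prime h.\<close>

lemma vanishing_iff: "(\<forall>x\<in>U. val P x = 0) \<longleftrightarrow> h dvd P"
proof
  show "\<forall>x\<in>U. val P x = 0 \<Longrightarrow> h dvd P" using nonvanishing_point by blast
qed (auto elim!: dvdE simp: val_h)

lemma not_dvd_mult: "\<not> h dvd P \<Longrightarrow> \<not> h dvd Q \<Longrightarrow> \<not> h dvd P * Q"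
  using prime prime_elem_dvd_mult_iff by blast

lemma not_dvd_const: "q \<noteq> 0 \<Longrightarrow> \<not> h dvd [:q:]"
proof
  assume "q \<noteq> 0" "h dvd [:q:]"
  then have "degree h \<le> degree [:q:]" by (intro dvd_imp_degree_le) auto
  then show False using degree_h by simp
qed

lemma openin_X_iff: "openin X S \<longleftrightarrow> S \<subseteq> U \<and> (\<forall>x\<in>S. \<exists>P. val P x \<noteq> 0 \<and> (\<forall>y\<in>U. val P y \<noteq> 0 \<longrightarrow> y \<in> S))"
proof
  assume "openin X S"
  then obtain V where V: "openin (zariski 2) V" "S = V \<inter> U" by (auto simp: openin_subtopology)
  have "\<exists>P. val P x \<noteq> 0 \<and> (\<forall>y\<in>U. val P y \<noteq> 0 \<longrightarrow> y \<in> S)" if x: "x \<in> S" for x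
  proof -
    have "x \<in> V" using V(2) x by blast
    then obtain p where p: "p \<in> polyfun 2" "p x \<noteq> 0" "\<forall>y. length y = 2 \<longrightarrow> p y \<noteq> 0 \<longrightarrow> y \<in> V"
      using V(1)[unfolded openin_zariski_iff] by blast
    obtain P where "p = val P" using p(1) polyfun_val by blast
    then show ?thesis using p V(2) U_length by (intro exI[of _ P]) auto
  qed
  then show "S \<subseteq> U \<and> (\<forall>x\<in>S. \<exists>P. val P x \<noteq> 0 \<and> (\<forall>y\<in>U. val P y \<noteq> 0 \<longrightarrow> y \<in> S))" using V by blast
next
  assume S: "S \<subseteq> U \<and> (\<forall>x\<in>S. \<exists>P. val P x \<noteq> 0 \<and> (\<forall>y\<in>U. val P y \<noteq> 0 \<longrightarrow> y \<in> S))"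
  define V where "V = {x. length x = 2 \<and> (\<exists>P. val P x \<noteq> 0 \<and> (\<forall>y\<in>U. val P y \<noteq> 0 \<longrightarrow> y \<in> S))}"
  have "openin (zariski 2) V"
    unfolding openin_zariski_iff
  proof
    fix x assume "x \<in> V"
    then obtain P where P: "length x = 2" "val P x \<noteq> 0" "\<forall>y\<in>U. val P y \<noteq> 0 \<longrightarrow> y \<in> S" by (auto simp: V_def)
    then have "\<forall>y. length y = 2 \<longrightarrow> val P y \<noteq> 0 \<longrightarrow> y \<in> V" by (auto simp: V_def)
    then show "length x = 2 \<and> (\<exists>p\<in>polyfun 2. p x \<noteq> 0 \<and> (\<forall>y. length y = 2 \<longrightarrow> p y \<noteq> 0 \<longrightarrow> y \<in> V))"
      using P by (intro conjI bexI[of _ "val P"] val_polyfun)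
  qed
  moreover have "S = V \<inter> U"
  proof
    show "S \<subseteq> V \<inter> U" using S U_length by (auto simp: V_def)
    show "V \<inter> U \<subseteq> S" by (auto simp: V_def)
  qed
  ultimately show "openin X S" by (auto simp: openin_subtopology)
qed

lemma topspace_X: "topspace X = U"
  using U_length by auto

lemma closedin_X_iff: "closedin X C \<longleftrightarrow> C \<subseteq> U \<and> openin X (U - C)"
  by (simp only: closedin_def topspace_X)

lemma openin_nonvanishing: "openin X {x \<in> U. val P x \<noteq> 0}"
  unfolding openin_X_iff by (intro conjI ballI exI[of _ P]) auto

lemma open_nonempty:
  assumes "openin X S" "S \<noteq> {}"
  shows "\<exists>P. \<not> h dvd P \<and> (\<forall>y\<in>U. val P y \<noteq> 0 \<longrightarrow> y \<in> S)"
proof -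
  obtain x where x: "x \<in> S" using assms(2) by blast
  then obtain P where P: "val P x \<noteq> 0" "\<forall>y\<in>U. val P y \<noteq> 0 \<longrightarrow> y \<in> S"
    using assms(1) unfolding openin_X_iff by blast
  have "x \<in> U" using assms(1) x unfolding openin_X_iff by blast
  then have "\<not> h dvd P" using P(1) vanishing_iff by blast
  then show ?thesis using P(2) by blast
qed

text \<open>Irreducibility in terms of open sets: h is prime, so the product of two polynomials that
  do not vanish on all of \<open>U\<close> does not vanish on all of \<open>U\<close>.\<close>

lemma open_Int_nonempty:
  assumes "openin X S" "S \<noteq> {}" "openin X T" "T \<noteq> {}"
  shows "S \<inter> T \<noteq> {}"
proof -
  obtain P where P: "\<not> h dvd P" "\<forall>y\<in>U. val P y \<noteq> 0 \<longrightarrow> y \<in> S" using open_nonempty[OF assms(1,2)] by blast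
  obtain Q where Q: "\<not> h dvd Q" "\<forall>y\<in>U. val Q y \<noteq> 0 \<longrightarrow> y \<in> T" using open_nonempty[OF assms(3,4)] by blast
  obtain x where x: "x \<in> U" "val (P * Q) x \<noteq> 0" using nonvanishing_point[OF not_dvd_mult[OF P(1) Q(1)]] by blast
  then have "x \<in> S" "x \<in> T" using P(2) Q(2) x by auto
  then show ?thesis by blast
qed

lemma U_nonempty: "U \<noteq> {}"
  using U_surj by blast

lemma irreducible_U: "irreducible_in X U"
  unfolding irreducible_in_def
proof (intro conjI allI impI)
  fix C D assume C: "closedin X C" and D: "closedin X D" and sub: "U \<subseteq> C \<union> D"
  have "openin X (U - C)" "openin X (U - D)" using C D by (simp_all only: closedin_X_iff)
  then have "U - C = {} \<or> U - D = {}" using open_Int_nonempty[of "U - C" "U - D"] sub by blast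
  then show "U \<subseteq> C \<or> U \<subseteq> D" by blast
next
  show "U \<subseteq> topspace X" by (simp only: topspace_X)
  show "U \<noteq> {}" by (rule U_nonempty)
qed

text \<open>A proper closed subset satisfies an equation not divisible by h. Its eliminant confines
  t to finitely many values, and fibres are finite.\<close>

lemma proper_closed_finite:
  assumes C: "closedin X C" "C \<noteq> U"
  shows "finite C"
proof -
  have CU: "C \<subseteq> U" and op: "openin X (U - C)" using C(1) by (simp_all only: closedin_X_iff)
  have ne: "U - C \<noteq> {}" using C(2) CU by blast
  obtain P where P: "\<not> h dvd P" "\<forall>y\<in>U. val P y \<noteq> 0 \<longrightarrow> y \<in> U - C"
    using open_nonempty[OF op ne] by blast
  obtain a c r where *: "r \<noteq> 0" "a * P + c * h = [:r:]" using elimination[OF P(1)] by blast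
  have "C \<subseteq> (\<Union>t\<in>{t. ev1 r t = 0}. (\<lambda>y. [t, y]) ` {y. [t, y] \<in> U})"
  proof
    fix x assume x: "x \<in> C"
    then have xU: "x \<in> U" using CU by blast
    then have "val P x = 0" using P(2) x by blast
    then have "val (a * P + c * h) x = 0" using val_h[OF xU] by simp
    then have "ev1 r (x ! 0) = 0" unfolding *(2) by simp
    moreover have "x = [x ! 0, x ! 1]" using U_length[OF xU]
      by (intro nth_equalityI) (auto simp: less_2_cases_iff nth_Cons')
    ultimately show "x \<in> (\<Union>t\<in>{t. ev1 r t = 0}. (\<lambda>y. [t, y]) ` {y. [t, y] \<in> U})" using xU by auto
  qed
  moreover have "finite (\<Union>t\<in>{t. ev1 r t = 0}. (\<lambda>y. [t, y]) ` {y. [t, y] \<in> U})"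
    using finite_ev1_zeros[OF *(1)] finite_fibre by blast
  ultimately show ?thesis by (rule finite_subset)
qed

text \<open>Conjugate points are not separated: the value of a polynomial at a point is algebraic, so a polynomial in
  it vanishes there without vanishing where the original one does.\<close>

lemma closure_of_point_sym:
  assumes x: "x \<in> U" and x': "x' \<in> X closure_of {x}"
  shows "x \<in> X closure_of {x'}"
proof -
  have x'U: "x' \<in> U" using x' closure_of_subset_topspace[of X "{x}"] topspace_X by blast
  have "val P x' \<noteq> 0" if P: "val P x \<noteq> 0" for P
  proof
    assume P': "val P x' = 0"
    obtain q0 :: "rat poly" where "q0 \<noteq> 0" "ev1 q0 (val P x) = 0"
      unfolding ev1_def by (rule alg_closure_algebraic)
    define R where "R q \<longleftrightarrow> q \<noteq> 0 \<and> ev1 q (val P x) = 0" for q :: "rat poly"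
    define q where "q = arg_min degree R"
    have q: "R q" "\<And>p. R p \<Longrightarrow> degree q \<le> degree p"
      using arg_min_nat_lemma[of R q0 degree] \<open>q0 \<noteq> 0\<close> \<open>ev1 q0 (val P x) = 0\<close> unfolding q_def R_def by auto
    obtain b p where bp: "q = pCons b p" by (metis pCons_cases)
    have "b \<noteq> 0"
    proof
      assume "b = 0"
      then have "R p" using q(1) bp P by (auto simp: R_def)
      then have "degree q \<le> degree p" "p \<noteq> 0" using q(2) by (auto simp: R_def)
      then show False using bp by simp
    qed
    have "(\<lambda>y. ev1 q (val P y)) \<in> polyfun 2" by (intro polyfun_ev1 val_polyfun)
    then obtain Q where Q: "(\<lambda>y. ev1 q (val P y)) = val Q" using polyfun_val by blast
    have "val Q x' \<noteq> 0" using fun_cong[OF Q, of x'] P' bp \<open>b \<noteq> 0\<close> by auto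
    then have "x' \<in> {y \<in> U. val Q y \<noteq> 0}" using x'U by simp
    then have "x \<in> {y \<in> U. val Q y \<noteq> 0}"
      using x'[unfolded in_closure_of, THEN conjunct2, rule_format, of "{y \<in> U. val Q y \<noteq> 0}"]
        openin_nonvanishing[of Q] by simp
    then have "val Q x \<noteq> 0" by simp
    then show False using fun_cong[OF Q, of x] q(1) by (simp add: R_def)
  qed
  note * = this
  have "x' \<in> T" if T: "x \<in> T" "openin X T" for T
  proof -
    obtain P where "val P x \<noteq> 0" "\<forall>y\<in>U. val P y \<noteq> 0 \<longrightarrow> y \<in> T"
      using T unfolding openin_X_iff by blast
    then show ?thesis using *[of P] x'U by blast
  qed
  then show ?thesis unfolding in_closure_of topspace_X using x by blast
qed

text \<open>The closure of a point over t = 0 is irreducible and misses the points over t = 1, which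
  gives a chain of length 1. In a longer chain the second member is a proper closed subset, so
  finite, so contained in the closure of one of its points x; by the symmetry of
  \<open>closure_of_point_sym\<close>, every nonempty closed subset of it has x in it too, which
  leaves no room for a strictly smaller member.\<close>

lemma krull_dim_curve: "krull_dim X = enat 1"
proof -
  define chain where "chain n Z \<longleftrightarrow> (\<forall>i\<le>n. closedin X (Z i) \<and> irreducible_in X (Z i)) \<and> (\<forall>i<n. Z i \<subset> Z (Suc i))"
    for n and Z :: "nat \<Rightarrow> qbar list set"
  obtain y0 where y0: "[0, y0] \<in> U" using U_surj by blast
  obtain y1 where y1: "[1, y1] \<in> U" using U_surj by blast
  define Z0 where "Z0 = X closure_of {[0, y0]}"
  have "closedin X {x \<in> U. val [:[:0, 1:]:] x = 0}"
  proof -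
    have "U - {x \<in> U. val [:[:0, 1:]:] x = 0} = {x \<in> U. val [:[:0, 1:]:] x \<noteq> 0}" by blast
    then show ?thesis unfolding closedin_X_iff using openin_nonvanishing[of "[:[:0, 1:]:]"] by auto
  qed
  then have "Z0 \<subseteq> {x \<in> U. val [:[:0, 1:]:] x = 0}"
    unfolding Z0_def using y0 by (intro closure_of_minimal) auto
  then have "[1, y1] \<notin> Z0" by auto
  moreover have "Z0 \<subseteq> U" unfolding Z0_def using closure_of_subset_topspace[of X] topspace_X by blast
  ultimately have Z0U: "Z0 \<subset> U" using y1 by blast
  have irr: "irreducible_in X Z0" unfolding Z0_def by (rule irreducible_in_closure_of_point) (use y0 topspace_X in blast)
  have "closedin X U" using closedin_topspace[of X] by (simp only: topspace_X)
  then have "chain 1 (\<lambda>i. if i = 0 then Z0 else U)"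
    unfolding chain_def using irr irreducible_U Z0U by (auto simp: Z0_def)
  then have lower: "\<exists>Z. chain 1 Z" by blast
  have upper: "n \<le> 1" if ch: "chain n Z" for n Z
  proof (rule ccontr)
    assume "\<not> n \<le> 1"
    then have cl: "closedin X (Z 0)" "closedin X (Z 1)" "closedin X (Z 2)"
      and ir: "irreducible_in X (Z 0)" "irreducible_in X (Z 1)" and sub: "Z 0 \<subset> Z 1" "Z 1 \<subset> Z 2"
      using ch by (auto simp: chain_def numeral_2_eq_2)
    have "Z 2 \<subseteq> U" using cl(3) by (simp only: closedin_X_iff)
    then have "Z 1 \<noteq> U" "Z 1 \<subseteq> U" using sub by auto
    then have fin: "finite (Z 1)" using proper_closed_finite[OF cl(2)] by blast
    have "x \<in> X closure_of {x}" if "x \<in> Z 1" for x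
      using closure_of_subset[of "{x}" X] \<open>Z 1 \<subseteq> U\<close> that topspace_X by blast
    then have "Z 1 \<subseteq> (\<Union>x\<in>Z 1. X closure_of {x})" by blast
    then obtain x where x: "x \<in> Z 1" "Z 1 \<subseteq> X closure_of {x}"
      using irreducible_in_finite_cover[OF ir(2) fin, of "\<lambda>x. X closure_of {x}"] by auto
    obtain x' where x': "x' \<in> Z 0" using ir(1) by (auto simp: irreducible_in_def)
    then have "x' \<in> X closure_of {x}" using sub x(2) by blast
    moreover have "x \<in> U" using x(1) \<open>Z 1 \<subseteq> U\<close> by blast
    ultimately have "x \<in> X closure_of {x'}" by (rule closure_of_point_sym[rotated])
    moreover have "X closure_of {x'} \<subseteq> Z 0" using x' cl(1) by (intro closure_of_minimal) auto
    ultimately have "X closure_of {x} \<subseteq> Z 0" using cl(1) by (intro closure_of_minimal) auto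
    then show False using x(2) sub(1) by blast
  qed
  have "krull_dim X = Sup {enat n | n. \<exists>Z. chain n Z}" unfolding krull_dim_def chain_def ..
  also have "\<dots> = enat 1"
  proof (rule antisym)
    show "Sup {enat n | n. \<exists>Z. chain n Z} \<le> enat 1"
    proof (rule Sup_least)
      fix e assume "e \<in> {enat n | n. \<exists>Z. chain n Z}"
      then obtain n Z where "e = enat n" "chain n Z" by blast
      then show "e \<le> enat 1" using upper by simp
    qed
    show "enat 1 \<le> Sup {enat n | n. \<exists>Z. chain n Z}" using lower by (intro Sup_upper) blast
  qed
  finally show ?thesis .
qed

lemma geom_points_W [simp]: "geom_points W = U"
  by (simp add: geom_points_def)

lemma variety_topology_W: "variety_topology W = X"
  by (rule variety_topology_closed_subset)

lemma inv_into_id: "x \<in> U \<Longrightarrow> inv_into U id x = x"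
  by (metis id_apply inj_on_id inv_into_f_f)

lemma regular_fun_iff: "S \<subseteq> U \<Longrightarrow> regular_fun W S f \<longleftrightarrow> regular_on 2 S f"
proof -
  assume S: "S \<subseteq> U"
  then have [simp]: "S \<inter> U = S" by blast
  show ?thesis
    unfolding regular_fun_def using S inv_into_id
      regular_on_cong[of 2 S "\<lambda>v. f (inv_into U id v)" f] regular_on_cong[of 2 S f "\<lambda>v. f (inv_into U id v)"]
    by (auto simp: subset_iff)
qed

lemma variety_W: "variety W"
proof -
  have closed: "closedin (zariski 2) U"
    unfolding U_def by (rule closedin_zariski_zeros) (rule polyfun_ev2, simp_all)
  have opn: "openin X U" using openin_topspace[of X] by (simp only: topspace_X)
  have coord: "regular_on 2 U (\<lambda>v. inv_into U id v ! j)" if "j < 2" for j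
    by (rule regular_on_cong[OF regular_on_polyfun[OF polyfun.coord[OF that]]]) (simp add: inv_into_id)
  \<comment> \<open>The diagonal in affine 4-space: the curve equation for the first pair of
    coordinates and equality of the two pairs.\<close>
  define D where "D = {x :: qbar list. length x = 4 \<and> ev2 h (x ! 0) (x ! 1) = 0} \<inter>
      ({x. length x = 4 \<and> x ! 0 - x ! 2 = 0} \<inter> {x. length x = 4 \<and> x ! 1 - x ! 3 = 0})"
  have "closedin (zariski 4) D"
    unfolding D_def
    by (intro closedin_Int closedin_zariski_zeros polyfun_ev2 polyfun_diff polyfun.coord) simp_all
  moreover have "(\<lambda>x. x @ x) ` U = D"
  proof
    show "(\<lambda>x. x @ x) ` U \<subseteq> D" by (auto simp: U_def D_def nth_append)
    show "D \<subseteq> (\<lambda>x. x @ x) ` U"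
    proof
      fix x assume x: "x \<in> D"
      then have "length x = 4" by (simp add: D_def)
      then obtain a b c d where "x = [a, b, c, d]"
        by (auto simp: length_Suc_conv numeral_eq_Suc)
      then have "x = [a, b] @ [a, b]" "[a, b] \<in> U" using x by (auto simp: D_def U_def numeral_3_eq_3 numeral_2_eq_2)
      then show "x \<in> (\<lambda>x. x @ x) ` U" by blast
    qed
  qed
  ultimately have diag: "closedin (zariski 4) ((\<lambda>x. x @ x) ` U)" by simp
  show ?thesis unfolding variety_def using closed opn coord diag by simp
qed

lemma rational_points_W: "rational_points W = {x \<in> U. set x \<subseteq> range to_ac}"
  by (auto simp: rational_points_def)

definition proj :: "qbar list \<Rightarrow> qbar list" where "proj x = [x ! 0]"

abbreviation A1 :: "(rat, qbar list) chart list" where "A1 \<equiv> affine_space 1"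

lemma geom_points_A1 [simp]: "geom_points A1 = {x. length x = 1}"
  by (simp add: geom_points_def affine_space_def)

lemma variety_topology_A1: "variety_topology A1 = zariski 1"
proof -
  have "subtopology (zariski 1) {x :: qbar list. length x = 1} = zariski 1"
    using subtopology_topspace[of "zariski 1 :: qbar list topology"] by simp
  then show ?thesis by (simp add: affine_space_def variety_topology_closed_subset)
qed

lemma proj_image: "proj ` U = {x. length x = 1}"
proof
  show "{x. length x = 1} \<subseteq> proj ` U"
  proof
    fix x :: "qbar list" assume "x \<in> {x. length x = 1}"
    then obtain t where t: "x = [t]" by (auto simp: length_Suc_conv)
    obtain y where "[t, y] \<in> U" using U_surj by blast
    then show "x \<in> proj ` U" using t by (intro image_eqI[of _ _ "[t, y]"]) (simp_all add: proj_def)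
  qed
qed (auto simp: proj_def)

lemma morphism_proj: "morphism W A1 proj"
proof -
  have eq: "{x \<in> U. length (proj x) = 1} = U" by (auto simp: proj_def)
  have "openin X U" using openin_topspace[of X] by (simp only: topspace_X)
  moreover have "regular_on 2 U (\<lambda>x. proj x ! 0)"
    by (rule regular_on_cong[OF regular_on_polyfun[OF polyfun.coord[of 0]]]) (simp_all add: proj_def)
  ultimately show ?thesis
    unfolding morphism_def using proj_image
    by (auto simp: affine_space_def geom_points_def variety_topology_W eq regular_fun_iff proj_def)
qed

lemma dominant_proj: "dominant W A1 proj"
  unfolding dominant_def variety_topology_A1 geom_points_W geom_points_A1 proj_image
  using closure_of_topspace[of "zariski 1 :: qbar list topology"] by simp

end


section \<open>The function field of the curve and the degree of its projection to the line\<close>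

subsection \<open>The function field of a plane curve\<close>

lemma UN_pairs_const:
  assumes "\<And>S f. (S, f) \<in> \<alpha> \<Longrightarrow> G S f = C" "\<alpha> \<noteq> {}"
  shows "(\<Union>(S, f)\<in>\<alpha>. G S f) = C"
proof -
  have "(\<Union>x\<in>\<alpha>. case x of (S, f) \<Rightarrow> G S f) = (\<Union>x\<in>\<alpha>. C)"
    by (rule SUP_cong[OF refl]) (auto simp: assms(1))
  then show ?thesis using assms(2) by simp
qed

context plane_curve
begin

lemma local_funs_iff: "(S, f) \<in> local_funs W \<longleftrightarrow> openin X S \<and> S \<noteq> {} \<and> regular_on 2 S f"
proof -
  have "openin X S \<Longrightarrow> S \<subseteq> U" by (simp only: openin_X_iff)
  then show ?thesis
    by (auto simp: local_funs_def variety_topology_W regular_fun_iff)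
qed

text \<open>Identity principle. Near x write f = P/Q, and let R be a polynomial, not divisible by h,
  that vanishes on \<open>U\<close> outside T. Then P Q R vanishes on all of \<open>U\<close>; h
  divides neither Q nor R, so it divides P.\<close>

lemma regular_zero:
  assumes f: "regular_on 2 S f" and S: "openin X S" and T: "openin X T" "T \<noteq> {}" "T \<subseteq> S"
    and zero: "\<And>x. x \<in> T \<Longrightarrow> f x = 0" and x: "x \<in> S"
  shows "f x = 0"
proof -
  obtain p q where pq: "p \<in> polyfun 2" "q \<in> polyfun 2" "q x \<noteq> 0" "\<forall>y\<in>S. q y \<noteq> 0 \<longrightarrow> f y = p y / q y"
    using regular_onD[OF f x] by blast
  obtain P where P: "p = val P" using pq(1) polyfun_val by blast
  obtain Q where Q: "q = val Q" using pq(2) polyfun_val by blast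
  obtain R where R: "\<not> h dvd R" "\<forall>y\<in>U. val R y \<noteq> 0 \<longrightarrow> y \<in> T" using open_nonempty[OF T(1,2)] by blast
  have SU: "S \<subseteq> U" using S by (simp only: openin_X_iff)
  have "val (P * (Q * R)) y = 0" if y: "y \<in> U" for y
  proof (cases "val Q y = 0 \<or> val R y = 0")
    case False
    then have "y \<in> T" using R(2) y by blast
    then have "p y / q y = 0" using zero[of y] pq(4) T(3) False Q by auto
    then show ?thesis using False P Q by simp
  qed auto
  then have "h dvd P * (Q * R)" using vanishing_iff by blast
  moreover have "\<not> h dvd Q" using vanishing_iff pq(3) Q x SU by blast
  ultimately have "h dvd P" using not_dvd_mult R(1) by blast
  then have "val P x = 0" using vanishing_iff x SU by blast
  then show ?thesis using pq(3,4) x P by simp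
qed

lemma regular_eq:
  assumes f: "regular_on 2 S f" and g: "regular_on 2 S g" and S: "openin X S"
    and T: "openin X T" "T \<noteq> {}" "T \<subseteq> S" and eq: "\<And>x. x \<in> T \<Longrightarrow> f x = g x" and x: "x \<in> S"
  shows "f x = g x"
proof -
  have "f x + - g x = 0"
    by (rule regular_zero[OF regular_on_add[OF f regular_on_uminus[OF g]] S T _ x]) (simp add: eq)
  then show ?thesis by simp
qed

lemma local_rel_iff: "((S, f), (T, g)) \<in> local_rel W \<longleftrightarrow>
    (S, f) \<in> local_funs W \<and> (T, g) \<in> local_funs W \<and> (\<forall>x\<in>S \<inter> T. f x = g x)"
  by (simp add: local_rel_def)

text \<open>Transitivity is the point: f and k agree on the triple intersection, which is nonempty
  by irreducibility, and then on all of their common domain by the identity principle.\<close>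

lemma equiv_local_rel: "equiv (local_funs W) (local_rel W)"
proof (rule equivI)
  show "local_rel W \<subseteq> local_funs W \<times> local_funs W" by (auto simp: local_rel_def)
  show "refl_on (local_funs W) (local_rel W)" by (auto simp: refl_on_def local_rel_def)
  show "sym (local_rel W)" by (auto simp: sym_def local_rel_def)
  show "trans (local_rel W)"
  proof (rule transI, clarify)
    fix S f T g R k assume 1: "((S, f), (T, g)) \<in> local_rel W" and 2: "((T, g), (R, k)) \<in> local_rel W"
    have lf: "openin X S" "S \<noteq> {}" "regular_on 2 S f" "openin X T" "T \<noteq> {}" "openin X R" "R \<noteq> {}" "regular_on 2 R k"
      using 1 2 by (simp_all add: local_rel_iff local_funs_iff)
    have eq: "f x = k x" if "x \<in> S \<inter> T \<inter> R" for x
      using 1 2 that by (auto simp: local_rel_iff)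
    have "S \<inter> T \<noteq> {}" by (rule open_Int_nonempty[OF lf(1,2,4,5)])
    then have ne: "S \<inter> T \<inter> R \<noteq> {}"
      by (rule open_Int_nonempty[OF openin_Int[OF lf(1,4)] _ lf(6,7)])
    have "f x = k x" if x: "x \<in> S \<inter> R" for x
      by (rule regular_eq[OF regular_on_subset[OF lf(3)] regular_on_subset[OF lf(8)] openin_Int[OF lf(1,6)] openin_Int[OF openin_Int[OF lf(1,4)] lf(6)] ne _ eq x]) auto
    then show "((S, f), (R, k)) \<in> local_rel W" using 1 2 by (simp add: local_rel_iff)
  qed
qed

abbreviation rf where "rf \<equiv> rational_fun W"
abbreviation FF where "FF \<equiv> function_field W"

lemma rf_eq_iff:
  "(S, f) \<in> local_funs W \<Longrightarrow> (T, g) \<in> local_funs W \<Longrightarrow> rf S f = rf T g \<longleftrightarrow> (\<forall>x\<in>S \<inter> T. f x = g x)"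
  unfolding rational_fun_def using eq_equiv_class_iff[OF equiv_local_rel] by (simp add: local_rel_iff)

lemma in_rf_iff: "(S, f) \<in> local_funs W \<Longrightarrow> (T, g) \<in> rf S f \<longleftrightarrow> (T, g) \<in> local_funs W \<and> rf T g = rf S f"
proof -
  assume lf: "(S, f) \<in> local_funs W"
  have "(T, g) \<in> rf S f \<longleftrightarrow> (T, g) \<in> local_funs W \<and> (\<forall>x\<in>S \<inter> T. f x = g x)"
    using lf by (simp add: rational_fun_def local_rel_iff)
  also have "\<dots> \<longleftrightarrow> (T, g) \<in> local_funs W \<and> rf S f = rf T g"
    by (rule conj_cong[OF refl]) (rule rf_eq_iff[OF lf, symmetric])
  finally show ?thesis by (simp only: eq_commute)
qed

lemma carrier_FF: "carrier FF = {rf S f | S f. (S, f) \<in> local_funs W}"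
  by (auto simp: function_field_def quotient_def rational_fun_def)

lemma rf_in_carrier: "(S, f) \<in> local_funs W \<Longrightarrow> rf S f \<in> carrier FF"
  using carrier_FF by blast

lemma local_funs_op:
  assumes "(S, f) \<in> local_funs W" "(T, g) \<in> local_funs W"
  shows local_funs_add: "(S \<inter> T, \<lambda>x. f x + g x) \<in> local_funs W"
    and local_funs_mult: "(S \<inter> T, \<lambda>x. f x * g x) \<in> local_funs W"
proof -
  have *: "openin X S" "S \<noteq> {}" "regular_on 2 S f" "openin X T" "T \<noteq> {}" "regular_on 2 T g"
    using assms by (simp_all add: local_funs_iff)
  have op: "openin X (S \<inter> T)" by (rule openin_Int[OF *(1,4)])
  have ne: "S \<inter> T \<noteq> {}" by (rule open_Int_nonempty[OF *(1,2,4,5)])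
  have f: "regular_on 2 (S \<inter> T) f" by (rule regular_on_subset[OF *(3)]) simp
  have g: "regular_on 2 (S \<inter> T) g" by (rule regular_on_subset[OF *(6)]) simp
  show "(S \<inter> T, \<lambda>x. f x + g x) \<in> local_funs W"
    unfolding local_funs_iff by (intro conjI op ne regular_on_add[OF f g])
  show "(S \<inter> T, \<lambda>x. f x * g x) \<in> local_funs W"
    unfolding local_funs_iff by (intro conjI op ne regular_on_mult[OF f g])
qed

lemma local_funs_uminus: "(S, f) \<in> local_funs W \<Longrightarrow> (S, \<lambda>x. - f x) \<in> local_funs W"
  by (simp add: local_funs_iff regular_on_uminus)

lemma local_funs_const: "(U, \<lambda>_. to_ac c) \<in> local_funs W"
proof -
  have "openin X U" using openin_topspace[of X] by (simp only: topspace_X)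
  then show ?thesis
    unfolding local_funs_iff by (intro conjI U_nonempty regular_on_polyfun polyfun.const)
qed

text \<open>The operations of \<open>function_field\<close> are unions over all pairs of
  representatives; each pair yields the same class, so the union collapses to it.\<close>

lemma rf_op_aux:
  assumes lf: "(S, f) \<in> local_funs W" "(T, g) \<in> local_funs W"
    and op: "\<And>S f T g. (S, f) \<in> local_funs W \<Longrightarrow> (T, g) \<in> local_funs W \<Longrightarrow> (S \<inter> T, \<lambda>x. op (f x) (g x)) \<in> local_funs W"
  shows "(\<Union>(S', f')\<in>rf S f. \<Union>(T', g')\<in>rf T g. rf (S' \<inter> T') (\<lambda>x. op (f' x) (g' x))) =
    rf (S \<inter> T) (\<lambda>x. op (f x) (g x))"
proof (rule UN_pairs_const)
  show "rf S f \<noteq> {}" using in_rf_iff[OF lf(1), of S f] lf(1) by auto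
  fix S' f' assume 1: "(S', f') \<in> rf S f"
  show "(\<Union>(T', g')\<in>rf T g. rf (S' \<inter> T') (\<lambda>x. op (f' x) (g' x))) = rf (S \<inter> T) (\<lambda>x. op (f x) (g x))"
  proof (rule UN_pairs_const)
    show "rf T g \<noteq> {}" using in_rf_iff[OF lf(2), of T g] lf(2) by auto
    fix T' g' assume 2: "(T', g') \<in> rf T g"
    have f': "(S', f') \<in> local_funs W" "\<forall>x\<in>S' \<inter> S. f' x = f x"
      using 1 in_rf_iff[OF lf(1), of S' f'] rf_eq_iff[OF _ lf(1), of S' f'] by auto
    have g': "(T', g') \<in> local_funs W" "\<forall>x\<in>T' \<inter> T. g' x = g x"
      using 2 in_rf_iff[OF lf(2), of T' g'] rf_eq_iff[OF _ lf(2), of T' g'] by auto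
    show "rf (S' \<inter> T') (\<lambda>x. op (f' x) (g' x)) = rf (S \<inter> T) (\<lambda>x. op (f x) (g x))"
      by (subst rf_eq_iff[OF op[OF f'(1) g'(1)] op[OF lf]]) (use f'(2) g'(2) in simp)
  qed
qed

lemma FF_mult: "(S, f) \<in> local_funs W \<Longrightarrow> (T, g) \<in> local_funs W \<Longrightarrow>
    rf S f \<otimes>\<^bsub>FF\<^esub> rf T g = rf (S \<inter> T) (\<lambda>x. f x * g x)"
proof -
  assume lf: "(S, f) \<in> local_funs W" "(T, g) \<in> local_funs W"
  have "rf S f \<otimes>\<^bsub>FF\<^esub> rf T g =
      (\<Union>(S', f')\<in>rf S f. \<Union>(T', g')\<in>rf T g. rf (S' \<inter> T') (\<lambda>x. f' x * g' x))"
    by (simp only: function_field_def monoid.simps ring.simps)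
  also have "\<dots> = rf (S \<inter> T) (\<lambda>x. f x * g x)"
    by (rule rf_op_aux[where op = "(*)"]) (fact lf(1), fact lf(2), erule (1) local_funs_mult)
  finally show ?thesis .
qed

lemma FF_add: "(S, f) \<in> local_funs W \<Longrightarrow> (T, g) \<in> local_funs W \<Longrightarrow>
    rf S f \<oplus>\<^bsub>FF\<^esub> rf T g = rf (S \<inter> T) (\<lambda>x. f x + g x)"
proof -
  assume lf: "(S, f) \<in> local_funs W" "(T, g) \<in> local_funs W"
  have "rf S f \<oplus>\<^bsub>FF\<^esub> rf T g =
      (\<Union>(S', f')\<in>rf S f. \<Union>(T', g')\<in>rf T g. rf (S' \<inter> T') (\<lambda>x. f' x + g' x))"
    by (simp only: function_field_def monoid.simps ring.simps)
  also have "\<dots> = rf (S \<inter> T) (\<lambda>x. f x + g x)"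
    by (rule rf_op_aux[where op = "(+)"]) (fact lf(1), fact lf(2), erule (1) local_funs_add)
  finally show ?thesis .
qed

lemma FF_one: "\<one>\<^bsub>FF\<^esub> = rf U (\<lambda>_. 1)" and FF_zero: "\<zero>\<^bsub>FF\<^esub> = rf U (\<lambda>_. 0)"
  by (simp_all add: function_field_def)

lemma local_funs_1: "(U, \<lambda>_. 1) \<in> local_funs W" and local_funs_0: "(U, \<lambda>_. 0) \<in> local_funs W"
  using local_funs_const[of 1] local_funs_const[of 0] by simp_all

lemma carrierD: "\<alpha> \<in> carrier FF \<Longrightarrow> \<exists>S f. \<alpha> = rf S f \<and> (S, f) \<in> local_funs W"
  using carrier_FF by blast

lemma ring_FF: "ring FF"
proof (rule ringI)
  show "abelian_group FF"
  proof (rule abelian_groupI)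
    fix \<alpha> \<beta> assume \<alpha>: "\<alpha> \<in> carrier FF" and \<beta>: "\<beta> \<in> carrier FF"
    obtain S f T g where *: "\<alpha> = rf S f" "(S, f) \<in> local_funs W" "\<beta> = rf T g" "(T, g) \<in> local_funs W"
      using carrierD[OF \<alpha>] carrierD[OF \<beta>] by blast
    show "\<alpha> \<oplus>\<^bsub>FF\<^esub> \<beta> \<in> carrier FF" using * by (simp add: FF_add rf_in_carrier local_funs_add)
    show "\<alpha> \<oplus>\<^bsub>FF\<^esub> \<beta> = \<beta> \<oplus>\<^bsub>FF\<^esub> \<alpha>" using * by (simp add: FF_add Int_commute add.commute)
    fix \<gamma> assume car: "\<gamma> \<in> carrier FF"
    from carrierD[OF car] obtain R k where **: "\<gamma> = rf R k" "(R, k) \<in> local_funs W" by blast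
    show "\<alpha> \<oplus>\<^bsub>FF\<^esub> \<beta> \<oplus>\<^bsub>FF\<^esub> \<gamma> = \<alpha> \<oplus>\<^bsub>FF\<^esub> (\<beta> \<oplus>\<^bsub>FF\<^esub> \<gamma>)"
      using * ** by (simp add: FF_add local_funs_add Int_assoc add.assoc)
  next
    show "\<zero>\<^bsub>FF\<^esub> \<in> carrier FF" by (simp add: FF_zero rf_in_carrier local_funs_0)
  next
    fix \<alpha> assume car: "\<alpha> \<in> carrier FF"
    from carrierD[OF car] obtain S f where *: "\<alpha> = rf S f" "(S, f) \<in> local_funs W" by blast
    show "\<zero>\<^bsub>FF\<^esub> \<oplus>\<^bsub>FF\<^esub> \<alpha> = \<alpha>"
      using * local_funs_0 local_funs_add[OF local_funs_0 *(2)]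
      by (simp add: FF_zero FF_add rf_eq_iff)
    have "rf S (\<lambda>x. - f x) \<oplus>\<^bsub>FF\<^esub> \<alpha> = \<zero>\<^bsub>FF\<^esub>"
      using * local_funs_0 local_funs_uminus[OF *(2)] local_funs_add[OF local_funs_uminus[OF *(2)] *(2)]
      by (simp add: FF_zero FF_add rf_eq_iff)
    then show "\<exists>\<beta>\<in>carrier FF. \<beta> \<oplus>\<^bsub>FF\<^esub> \<alpha> = \<zero>\<^bsub>FF\<^esub>"
      using rf_in_carrier[OF local_funs_uminus[OF *(2)]] by blast
  qed
next
  show "Group.monoid FF"
  proof (rule monoidI)
    show "\<one>\<^bsub>FF\<^esub> \<in> carrier FF" by (simp add: FF_one rf_in_carrier local_funs_1)
    fix \<alpha> assume car: "\<alpha> \<in> carrier FF"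
    from carrierD[OF car] obtain S f where *: "\<alpha> = rf S f" "(S, f) \<in> local_funs W" by blast
    show "\<one>\<^bsub>FF\<^esub> \<otimes>\<^bsub>FF\<^esub> \<alpha> = \<alpha>" "\<alpha> \<otimes>\<^bsub>FF\<^esub> \<one>\<^bsub>FF\<^esub> = \<alpha>"
      using * local_funs_1 local_funs_mult[OF local_funs_1 *(2)] local_funs_mult[OF *(2) local_funs_1]
      by (simp_all add: FF_one FF_mult rf_eq_iff)
    fix \<beta> assume car: "\<beta> \<in> carrier FF"
    from carrierD[OF car] obtain T g where **: "\<beta> = rf T g" "(T, g) \<in> local_funs W" by blast
    show "\<alpha> \<otimes>\<^bsub>FF\<^esub> \<beta> \<in> carrier FF" using * ** by (simp add: FF_mult rf_in_carrier local_funs_mult)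
    fix \<gamma> assume car: "\<gamma> \<in> carrier FF"
    from carrierD[OF car] obtain R k where ***: "\<gamma> = rf R k" "(R, k) \<in> local_funs W" by blast
    show "\<alpha> \<otimes>\<^bsub>FF\<^esub> \<beta> \<otimes>\<^bsub>FF\<^esub> \<gamma> = \<alpha> \<otimes>\<^bsub>FF\<^esub> (\<beta> \<otimes>\<^bsub>FF\<^esub> \<gamma>)"
      using * ** *** by (simp add: FF_mult local_funs_mult Int_assoc mult.assoc)
  qed
next
  fix \<alpha> \<beta> \<gamma> assume \<alpha>: "\<alpha> \<in> carrier FF" and \<beta>: "\<beta> \<in> carrier FF" and \<gamma>: "\<gamma> \<in> carrier FF"
  obtain S f T g R k where *: "\<alpha> = rf S f" "(S, f) \<in> local_funs W" "\<beta> = rf T g" "(T, g) \<in> local_funs W"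
    "\<gamma> = rf R k" "(R, k) \<in> local_funs W"
    using carrierD[OF \<alpha>] carrierD[OF \<beta>] carrierD[OF \<gamma>] by blast
  have sets: "S \<inter> R \<inter> (T \<inter> R) = S \<inter> T \<inter> R" "R \<inter> S \<inter> (R \<inter> T) = R \<inter> (S \<inter> T)" by blast+
  show "(\<alpha> \<oplus>\<^bsub>FF\<^esub> \<beta>) \<otimes>\<^bsub>FF\<^esub> \<gamma> = \<alpha> \<otimes>\<^bsub>FF\<^esub> \<gamma> \<oplus>\<^bsub>FF\<^esub> \<beta> \<otimes>\<^bsub>FF\<^esub> \<gamma>"
    "\<gamma> \<otimes>\<^bsub>FF\<^esub> (\<alpha> \<oplus>\<^bsub>FF\<^esub> \<beta>) = \<gamma> \<otimes>\<^bsub>FF\<^esub> \<alpha> \<oplus>\<^bsub>FF\<^esub> \<gamma> \<otimes>\<^bsub>FF\<^esub> \<beta>"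
    using * sets by (simp_all add: FF_mult FF_add local_funs_mult local_funs_add distrib_left distrib_right)
qed

subsection \<open>Elements as quotients\<close>

definition quot :: "rat poly poly \<Rightarrow> rat poly \<Rightarrow> (qbar list set \<times> (qbar list \<Rightarrow> qbar)) set" where
  "quot P q = rf {x \<in> U. ev1 q (x ! 0) \<noteq> 0} (\<lambda>x. val P x / ev1 q (x ! 0))"

lemma quot_local_fun:
  assumes q: "q \<noteq> 0"
  shows "({x \<in> U. ev1 q (x ! 0) \<noteq> 0}, \<lambda>x. val P x / ev1 q (x ! 0)) \<in> local_funs W"
proof -
  have eq: "{x \<in> U. ev1 q (x ! 0) \<noteq> 0} = {x \<in> U. val [:q:] x \<noteq> 0}" by simp
  have "openin X {x \<in> U. ev1 q (x ! 0) \<noteq> 0}" unfolding eq by (rule openin_nonvanishing)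
  moreover have "{x \<in> U. ev1 q (x ! 0) \<noteq> 0} \<noteq> {}"
    unfolding eq using nonvanishing_point[OF not_dvd_const[OF q]] by blast
  moreover have "regular_on 2 {x \<in> U. ev1 q (x ! 0) \<noteq> 0} (\<lambda>x. val P x / val [:q:] x)"
    by (rule regular_on_quotient[OF val_polyfun val_polyfun]) simp
  ultimately show ?thesis by (simp add: local_funs_iff)
qed

text \<open>Cross-multiplication on the curve; the nonzero denominators have degree 0 in y, so h
  does not divide them and they cancel.\<close>

lemma quot_eq_iff:
  assumes "q \<noteq> 0" "q' \<noteq> 0"
  shows "quot P q = quot P' q' \<longleftrightarrow> h dvd P * [:q':] - P' * [:q:]"
proof -
  have "quot P q = quot P' q' \<longleftrightarrow> (\<forall>x\<in>U. ev1 q (x ! 0) \<noteq> 0 \<longrightarrow> ev1 q' (x ! 0) \<noteq> 0 \<longrightarrow>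
      val P x / ev1 q (x ! 0) = val P' x / ev1 q' (x ! 0))"
    unfolding quot_def rf_eq_iff[OF quot_local_fun[OF assms(1)] quot_local_fun[OF assms(2)]] by auto
  also have "\<dots> \<longleftrightarrow> (\<forall>x\<in>U. val ((P * [:q':] - P' * [:q:]) * ([:q:] * [:q':])) x = 0)"
  proof (rule ball_cong[OF refl])
    fix x assume "x \<in> U"
    show "(ev1 q (x ! 0) \<noteq> 0 \<longrightarrow> ev1 q' (x ! 0) \<noteq> 0 \<longrightarrow> val P x / ev1 q (x ! 0) = val P' x / ev1 q' (x ! 0)) \<longleftrightarrow>
      val ((P * [:q':] - P' * [:q:]) * ([:q:] * [:q':])) x = 0"
      by (auto simp: frac_eq_eq simp del: mult_pCons_left mult_pCons_right)
  qed
  also have "\<dots> \<longleftrightarrow> h dvd (P * [:q':] - P' * [:q:]) * ([:q:] * [:q':])" by (rule vanishing_iff)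
  also have "\<dots> \<longleftrightarrow> h dvd P * [:q':] - P' * [:q:]"
    using not_dvd_mult[OF _ not_dvd_mult[OF not_dvd_const[OF assms(1)] not_dvd_const[OF assms(2)]]] dvd_mult2 by blast
  finally show ?thesis .
qed

lemma quot_add:
  assumes "q \<noteq> 0" "q' \<noteq> 0"
  shows "quot P q \<oplus>\<^bsub>FF\<^esub> quot P' q' = quot (P * [:q':] + P' * [:q:]) (q * q')"
proof -
  have "q * q' \<noteq> 0" using assms by simp
  note lf = quot_local_fun[OF assms(1), of P] quot_local_fun[OF assms(2), of P']
  show ?thesis
    unfolding quot_def FF_add[OF lf] rf_eq_iff[OF local_funs_add[OF lf] quot_local_fun[OF \<open>q * q' \<noteq> 0\<close>]]
    by (auto simp: add_frac_eq simp del: mult_pCons_left mult_pCons_right)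
qed

lemma quot_mult:
  assumes "q \<noteq> 0" "q' \<noteq> 0"
  shows "quot P q \<otimes>\<^bsub>FF\<^esub> quot P' q' = quot (P * P') (q * q')"
proof -
  have "q * q' \<noteq> 0" using assms by simp
  note lf = quot_local_fun[OF assms(1), of P] quot_local_fun[OF assms(2), of P']
  show ?thesis
    unfolding quot_def FF_mult[OF lf] rf_eq_iff[OF local_funs_mult[OF lf] quot_local_fun[OF \<open>q * q' \<noteq> 0\<close>]]
    by auto
qed

lemma quot_in_carrier: "q \<noteq> 0 \<Longrightarrow> quot P q \<in> carrier FF"
  unfolding quot_def by (rule rf_in_carrier[OF quot_local_fun])

text \<open>Denominators can be taken free of y: if a Q + c h = r with r in Q[t], then P/Q = P a / r
  on the curve.\<close>

lemma carrier_quot: "carrier FF = {quot P q | P q. q \<noteq> 0}"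
proof
  show "carrier FF \<subseteq> {quot P q | P q. q \<noteq> 0}"
  proof
    fix \<alpha> assume car: "\<alpha> \<in> carrier FF"
    from carrierD[OF car] obtain S f where \<alpha>: "\<alpha> = rf S f" "(S, f) \<in> local_funs W" by blast
    then have S: "openin X S" "S \<noteq> {}" "regular_on 2 S f" by (simp_all add: local_funs_iff)
    obtain x where x: "x \<in> S" using S(2) by blast
    obtain p q where pq: "p \<in> polyfun 2" "q \<in> polyfun 2" "q x \<noteq> 0" "\<forall>y\<in>S. q y \<noteq> 0 \<longrightarrow> f y = p y / q y"
      using regular_onD[OF S(3) x] by blast
    obtain P where P: "p = val P" using pq(1) polyfun_val by blast
    obtain Q where Q: "q = val Q" using pq(2) polyfun_val by blast
    have "x \<in> U" using S(1) x by (simp only: openin_X_iff) blast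
    then have "\<not> h dvd Q" using vanishing_iff pq(3) Q by blast
    then obtain a c r where *: "r \<noteq> 0" "a * Q + c * h = [:r:]" using elimination by blast
    have "f y = val (P * a) y / ev1 r (y ! 0)" if y: "y \<in> S" "y \<in> U" "ev1 r (y ! 0) \<noteq> 0" for y
    proof -
      have "val (a * Q + c * h) y = ev1 r (y ! 0)" unfolding *(2) by simp
      then have r: "val a y * val Q y = ev1 r (y ! 0)" using val_h[OF y(2)] by simp
      then have "val Q y \<noteq> 0" "val a y \<noteq> 0" using y(3) by auto
      then have "f y = val P y / val Q y" using pq(4) y(1) P Q by simp
      also have "\<dots> = val (P * a) y / ev1 r (y ! 0)"
        using \<open>val Q y \<noteq> 0\<close> \<open>val a y \<noteq> 0\<close> by (simp add: field_simps flip: r)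
      finally show ?thesis .
    qed
    then have "\<alpha> = quot (P * a) r"
      unfolding \<alpha>(1) quot_def rf_eq_iff[OF \<alpha>(2) quot_local_fun[OF *(1)]] by blast
    then show "\<alpha> \<in> {quot P q | P q. q \<noteq> 0}" using *(1) by blast
  qed
qed (auto intro: quot_in_carrier)

lemma local_funs_A1_iff: "(T, g) \<in> local_funs A1 \<longleftrightarrow> openin (zariski 1) T \<and> T \<noteq> {} \<and> regular_on 1 T g"
proof -
  have "T \<subseteq> {x. length x = 1}" if "openin (zariski 1) T" using openin_subset[OF that] by simp
  moreover have "regular_fun A1 T g \<longleftrightarrow> regular_on 1 T g" if T: "T \<subseteq> {x. length x = 1}"
  proof -
    have id1: "inv_into {x :: qbar list. length x = 1} id x = x" if "x \<in> T" for x
      using T that by (metis id_apply inj_on_id inv_into_f_f subsetD)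
    have "T \<inter> {x. length x = 1} = T" using T by blast
    then show ?thesis
      using regular_on_cong[of 1 T "\<lambda>v. g (inv_into {x. length x = 1} id v)" g]
        regular_on_cong[of 1 T g "\<lambda>v. g (inv_into {x. length x = 1} id v)"] id1
      by (auto simp: regular_fun_def affine_space_def)
  qed
  ultimately show ?thesis
    unfolding local_funs_def variety_topology_A1 mem_Collect_eq case_prod_conv by blast
qed

lemma proj_quot:
  assumes "(T, g) \<in> local_funs A1"
  shows "\<exists>p q. q \<noteq> 0 \<and> rf {x \<in> U. proj x \<in> T} (\<lambda>x. g (proj x)) = quot [:p:] q"
proof -
  have T: "openin (zariski 1) T" "T \<noteq> {}" "regular_on 1 T g" using assms unfolding local_funs_A1_iff by blast+
  have comp: "(\<lambda>x. p (proj x)) \<in> polyfun 2" if p: "p \<in> polyfun 1" for p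
  proof -
    obtain P where P: "p = (\<lambda>x. ev1 P (x ! 0))" using p polyfun_1_iff by blast
    have "(\<lambda>x. p (proj x)) = val [:P:]" by (simp add: fun_eq_iff P proj_def)
    then show ?thesis using val_polyfun by simp
  qed
  define S where "S = {x \<in> U. proj x \<in> T}"
  have "openin X S"
    unfolding openin_X_iff
  proof (intro conjI ballI)
    fix x assume x: "x \<in> S"
    then have "proj x \<in> T" by (simp add: S_def)
    then obtain p where p: "p \<in> polyfun 1" "p (proj x) \<noteq> 0" "\<forall>y. length y = 1 \<longrightarrow> p y \<noteq> 0 \<longrightarrow> y \<in> T"
      using T(1)[unfolded openin_zariski_iff] by blast
    obtain P where P: "(\<lambda>x. p (proj x)) = val P" using comp[OF p(1)] polyfun_val by blast
    have "\<forall>y\<in>U. val P y \<noteq> 0 \<longrightarrow> y \<in> S"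
      using p(3) by (simp add: S_def flip: P) (simp add: proj_def)
    moreover have "val P x \<noteq> 0" using p(2) by (simp flip: P)
    ultimately show "\<exists>P. val P x \<noteq> 0 \<and> (\<forall>y\<in>U. val P y \<noteq> 0 \<longrightarrow> y \<in> S)" by blast
  qed (auto simp: S_def)
  moreover have "S \<noteq> {}"
  proof -
    obtain t where t: "t \<in> T" using T(2) by blast
    then have "t \<in> proj ` U" using openin_subset[OF T(1)] proj_image by auto
    then show ?thesis using t by (auto simp: S_def)
  qed
  moreover have "regular_on 2 S (\<lambda>x. g (proj x))"
  proof (rule regular_onI)
    fix x assume "x \<in> S"
    then have "proj x \<in> T" by (simp add: S_def)
    then obtain p q where pq: "p \<in> polyfun 1" "q \<in> polyfun 1" "q (proj x) \<noteq> 0" "\<forall>y\<in>T. q y \<noteq> 0 \<longrightarrow> g y = p y / q y"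
      using regular_onD[OF T(3)] by blast
    have "\<forall>y\<in>S. q (proj y) \<noteq> 0 \<longrightarrow> g (proj y) = p (proj y) / q (proj y)"
      using pq(4) by (simp add: S_def)
    then show "\<exists>p q. p \<in> polyfun 2 \<and> q \<in> polyfun 2 \<and> q x \<noteq> 0 \<and> (\<forall>y\<in>S. q y \<noteq> 0 \<longrightarrow> g (proj y) = p y / q y)"
      using comp[OF pq(1)] comp[OF pq(2)] pq(3)
      by (intro exI[of _ "\<lambda>x. p (proj x)"] exI[of _ "\<lambda>x. q (proj x)"]) simp
  qed
  ultimately have lf: "(S, \<lambda>x. g (proj x)) \<in> local_funs W" unfolding local_funs_iff by blast
  obtain t where t: "t \<in> T" using T(2) by blast
  obtain p q where pq: "p \<in> polyfun 1" "q \<in> polyfun 1" "q t \<noteq> 0" "\<forall>y\<in>T. q y \<noteq> 0 \<longrightarrow> g y = p y / q y"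
    using regular_onD[OF T(3) t] by blast
  obtain P where P: "p = (\<lambda>x. ev1 P (x ! 0))" using pq(1) polyfun_1_iff by blast
  obtain Q where Q: "q = (\<lambda>x. ev1 Q (x ! 0))" using pq(2) polyfun_1_iff by blast
  have "Q \<noteq> 0" using pq(3) Q by auto
  moreover have "rf S (\<lambda>x. g (proj x)) = quot [:P:] Q"
    unfolding quot_def rf_eq_iff[OF lf quot_local_fun[OF \<open>Q \<noteq> 0\<close>]]
  proof
    fix x assume "x \<in> S \<inter> {x \<in> U. ev1 Q (x ! 0) \<noteq> 0}"
    then have "proj x \<in> T" "q (proj x) \<noteq> 0" by (simp_all add: S_def Q proj_def)
    then have "g (proj x) = p (proj x) / q (proj x)" using pq(4) by blast
    then show "g (proj x) = val [:P:] x / ev1 Q (x ! 0)" by (simp add: P Q proj_def)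
  qed
  ultimately show ?thesis unfolding S_def by blast
qed

lemma pullback_field_proj: "pullback_field W A1 proj = {quot [:p:] q | p q. q \<noteq> 0}"
proof
  show "pullback_field W A1 proj \<subseteq> {quot [:p:] q | p q. q \<noteq> 0}"
    unfolding pullback_field_def geom_points_W using proj_quot by blast
  show "{quot [:p:] q | p q. q \<noteq> 0} \<subseteq> pullback_field W A1 proj"
  proof
    fix \<alpha> assume "\<alpha> \<in> {quot [:p:] q | p q. q \<noteq> 0}"
    then obtain p q where \<alpha>: "\<alpha> = quot [:p:] q" "q \<noteq> 0" by blast
    define T where "T = {x :: qbar list. length x = 1 \<and> ev1 q (x ! 0) \<noteq> 0}"
    define g where "g = (\<lambda>x :: qbar list. ev1 p (x ! 0) / ev1 q (x ! 0))"
    have pf: "(\<lambda>x. ev1 p (x ! 0)) \<in> polyfun 1" for p :: "rat poly" using polyfun_1_iff by blast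
    have "openin (zariski 1) T"
      unfolding openin_zariski_iff using pf[of q] by (auto simp: T_def)
    moreover obtain t where "ev1 q t \<noteq> 0" using ev1_nonzero_point[OF \<alpha>(2)] by blast
    then have "[t] \<in> T" by (simp add: T_def)
    then have "T \<noteq> {}" by blast
    moreover have "regular_on 1 T g" unfolding g_def
      by (rule regular_on_quotient[OF pf pf]) (simp add: T_def)
    ultimately have lf: "(T, g) \<in> local_funs A1" unfolding local_funs_A1_iff by blast
    have "{x \<in> U. proj x \<in> T} = {x \<in> U. ev1 q (x ! 0) \<noteq> 0}" by (simp add: T_def proj_def)
    moreover have "(\<lambda>x. g (proj x)) = (\<lambda>x. val [:p:] x / ev1 q (x ! 0))" by (simp add: g_def proj_def)
    ultimately have "\<alpha> = rf {x \<in> U. proj x \<in> T} (\<lambda>x. g (proj x))" using \<alpha>(1) by (simp add: quot_def)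
    then show "\<alpha> \<in> pullback_field W A1 proj"
      unfolding pullback_field_def geom_points_W using lf by blast
  qed
qed

text \<open>The span of 1, y, ..., y^(i-1) over the pulled-back field Q(t).\<close>

definition quots_below :: "nat \<Rightarrow> (qbar list set \<times> (qbar list \<Rightarrow> qbar)) set set" where
  "quots_below i = {quot P q | P q. q \<noteq> 0 \<and> (P = 0 \<or> degree P < i)}"

text \<open>Splitting off the term of degree i in y matches the inductive step by which
  \<open>ring.dimension\<close> is defined.\<close>

lemma quots_below_Suc:
  "quots_below (Suc i) = ring.line_extension FF (pullback_field W A1 proj) (quot (monom 1 i) 1) (quots_below i)"
  (is "_ = ?E")
proof -
  interpret FF: ring FF by (rule ring_FF)
  have E: "?E = {quot [:p:] q \<otimes>\<^bsub>FF\<^esub> quot (monom 1 i) 1 \<oplus>\<^bsub>FF\<^esub> \<beta> | p q \<beta>. q \<noteq> 0 \<and> \<beta> \<in> quots_below i}"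
    unfolding FF.line_extension_def pullback_field_proj by (auto simp: set_add_def' r_coset_def)
  show ?thesis
  proof
    show "quots_below (Suc i) \<subseteq> ?E"
    proof
      fix \<alpha> assume "\<alpha> \<in> quots_below (Suc i)"
      then obtain P q where \<alpha>: "\<alpha> = quot P q" "q \<noteq> 0" "P = 0 \<or> degree P < Suc i" by (auto simp: quots_below_def)
      define P' where "P' = P - monom (coeff P i) i"
      have "P' = 0 \<or> degree P' < i"
      proof (cases "P' = 0")
        case False
        have "degree P' \<le> i" unfolding P'_def using \<alpha>(3)
          by (intro degree_diff_le degree_monom_le) auto
        moreover have "coeff P' i = 0" by (simp add: P'_def)
        then have "degree P' \<noteq> i" using False by (metis leading_coeff_0_iff)
        ultimately show ?thesis by simp
      qed simp
      then have "quot P' q \<in> quots_below i" using \<alpha>(2) by (auto simp: quots_below_def)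
      moreover have "\<alpha> = quot [:coeff P i:] q \<otimes>\<^bsub>FF\<^esub> quot (monom 1 i) 1 \<oplus>\<^bsub>FF\<^esub> quot P' q"
      proof -
        have m: "[:coeff P i:] * monom 1 i = monom (coeff P i) i" by (simp add: smult_monom)
        have "P * [:q * 1 * q:] - (monom (coeff P i) i * [:q:] + P' * [:q * 1:]) * [:q:] = 0"
          by (simp add: P'_def algebra_simps smult_diff_right smult_add_right)
        then have "h dvd P * [:q * 1 * q:] - (monom (coeff P i) i * [:q:] + P' * [:q * 1:]) * [:q:]" by simp
        then show ?thesis
          unfolding \<alpha>(1) using \<alpha>(2) by (subst quot_mult, simp_all only: m) (subst quot_add, simp_all, subst quot_eq_iff, simp_all)
      qed
      ultimately show "\<alpha> \<in> ?E" unfolding E using \<alpha>(2) by blast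
    qed
    show "?E \<subseteq> quots_below (Suc i)"
    proof
      fix \<alpha> assume "\<alpha> \<in> ?E"
      then obtain p q \<beta> where "\<alpha> = quot [:p:] q \<otimes>\<^bsub>FF\<^esub> quot (monom 1 i) 1 \<oplus>\<^bsub>FF\<^esub> \<beta>" "q \<noteq> 0"
        and \<beta>: "\<beta> \<in> quots_below i" unfolding E by blast
      moreover obtain P' q' where "\<beta> = quot P' q'" "q' \<noteq> 0" "P' = 0 \<or> degree P' < i"
        using \<beta> unfolding quots_below_def by blast
      ultimately have *: "\<alpha> = quot [:p:] q \<otimes>\<^bsub>FF\<^esub> quot (monom 1 i) 1 \<oplus>\<^bsub>FF\<^esub> quot P' q'"
        "q \<noteq> 0" "q' \<noteq> 0" "P' = 0 \<or> degree P' < i" by simp_all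
      have "\<alpha> = quot (([:p:] * monom 1 i) * [:q':] + P' * [:q * 1:]) (q * 1 * q')"
        unfolding *(1) using *(2,3) by (subst quot_mult, simp_all only:) (subst quot_add, simp_all)
      moreover have "degree (([:p:] * monom 1 i) * [:q':] + P' * [:q * 1:]) \<le> i"
        using *(4) by (intro degree_add_le) (auto simp: smult_monom degree_monom_le intro: order_trans[OF degree_smult_le])
      ultimately show "\<alpha> \<in> quots_below (Suc i)"
        unfolding quots_below_def using *(2,3) by fastforce
    qed
  qed
qed

text \<open>For i < degree h the power y^i is independent of the lower ones: clearing denominators
  in a relation would give a nonzero multiple of h of degree at most i in y.\<close>

lemma dimension_quots_below: "i \<le> degree h \<Longrightarrow> ring.dimension FF i (pullback_field W A1 proj) (quots_below i)"
proof (induction i)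
  interpret FF: ring FF by (rule ring_FF)
  case 0
  have "quot 0 q = \<zero>\<^bsub>FF\<^esub>" if "q \<noteq> 0" for q
    unfolding quot_def FF_zero rf_eq_iff[OF quot_local_fun[OF that] local_funs_0] by simp
  then have "quots_below 0 = {\<zero>\<^bsub>FF\<^esub>}" by (auto simp: quots_below_def intro: exI[of _ 1])
  then show ?case by (simp only: FF.zero_dim)
next
  interpret FF: ring FF by (rule ring_FF)
  case (Suc i)
  have "quot (monom 1 i) 1 \<notin> quots_below i"
  proof
    assume "quot (monom 1 i) 1 \<in> quots_below i"
    then obtain P q where P: "quot (monom 1 i) 1 = quot P q" "q \<noteq> 0" "P = 0 \<or> degree P < i"
      by (auto simp: quots_below_def)
    define G where "G = monom 1 i * [:q:] - P * [:1:]"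
    have "h dvd G" using P(1) quot_eq_iff[OF _ P(2), of 1] by (simp add: G_def)
    moreover have c: "coeff G i = q" using P(3) by (auto simp: G_def coeff_eq_0)
    then have "G \<noteq> 0" using P(2) by auto
    moreover have "degree G \<le> i" unfolding G_def using P(3)
      by (intro degree_diff_le) (auto simp: smult_monom degree_monom_le)
    ultimately have "degree h \<le> i" using dvd_imp_degree_le[of h G] by simp
    then show False using Suc.prems by simp
  qed
  then show ?case
    unfolding quots_below_Suc
    by (rule FF.Suc_dim[OF quot_in_carrier[OF one_neq_zero] _ Suc.IH]) (use Suc.prems in auto)
qed

text \<open>As h is monic, pseudo-division by h is division, and every numerator may be reduced
  modulo h.\<close>

lemma quots_below_degree: "quots_below (degree h) = carrier FF"
proof
  show "quots_below (degree h) \<subseteq> carrier FF" unfolding quots_below_def carrier_quot by blast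
  show "carrier FF \<subseteq> quots_below (degree h)"
  proof
    fix \<alpha> assume "\<alpha> \<in> carrier FF"
    then obtain P q where \<alpha>: "\<alpha> = quot P q" "q \<noteq> 0" unfolding carrier_quot by blast
    obtain a b where ab: "pseudo_divmod P h = (a, b)" by force
    have h0: "h \<noteq> 0" using monic by auto
    have "P = h * a + b" "b = 0 \<or> degree b < degree h" using pseudo_divmod[OF h0 ab] by (simp_all add: monic)
    moreover have "quot P q = quot b q"
      unfolding quot_eq_iff[OF \<alpha>(2) \<alpha>(2)] \<open>P = h * a + b\<close>
      by (simp add: algebra_simps smult_add_right dvd_smult)
    ultimately show "\<alpha> \<in> quots_below (degree h)" unfolding quots_below_def using \<alpha> by blast
  qed
qed

lemma has_degree_proj: "has_degree W A1 proj (degree h)"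
  unfolding has_degree_def using dimension_quots_below[OF order_refl] by (simp only: quots_below_degree)

text \<open>The rational points of the curve above z are the rational roots of h(z,y), and the
  projection has degree \<open>degree h\<close>.\<close>

lemma thin_type2_curve:
  assumes "degree h \<ge> 2"
  shows "thin_type2 1 {a. \<exists>z u. a = [z] \<and> poly (poly h [:u:]) z = 0}"
proof -
  have "{a. \<exists>z u. a = [z] \<and> poly (poly h [:u:]) z = 0} = {a. map to_ac a \<in> proj ` rational_points W}"
  proof (intro equalityI subsetI)
    fix a assume "a \<in> {a. \<exists>z u. a = [z] \<and> poly (poly h [:u:]) z = 0}"
    then obtain z u where zu: "a = [z]" "poly (poly h [:u:]) z = 0" by blast
    then have "[to_ac z, to_ac u] \<in> rational_points W"
      unfolding rational_points_W by (simp add: U_def ev2_to_ac)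
    moreover have "map to_ac a = proj [to_ac z, to_ac u]" by (simp add: zu proj_def)
    ultimately show "a \<in> {a. map to_ac a \<in> proj ` rational_points W}" by blast
  next
    fix a assume "a \<in> {a. map to_ac a \<in> proj ` rational_points W}"
    then obtain x where a: "map to_ac a = proj x" and x: "x \<in> rational_points W" by blast
    then have xU: "x \<in> U" "set x \<subseteq> range to_ac" by (simp_all add: rational_points_W)
    then have "x ! 0 \<in> range to_ac" "x ! 1 \<in> range to_ac" using U_length nth_mem[of _ x] by auto
    then obtain z u where zu: "x ! 0 = to_ac z" "x ! 1 = to_ac u" by blast
    then have "to_ac (poly (poly h [:u:]) z) = 0" using xU(1) by (simp add: U_def flip: ev2_to_ac)
    moreover have "a = [z]" using a zu(1) by (cases a) (auto simp: proj_def)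
    ultimately show "a \<in> {a. \<exists>z u. a = [z] \<and> poly (poly h [:u:]) z = 0}" by auto
  qed
  then show ?thesis
    unfolding thin_type2_def
    by (intro exI[of _ W] exI[of _ proj] exI[of _ "degree h"])
      (unfold variety_topology_W geom_points_W, intro conjI variety_W irreducible_U krull_dim_curve
        morphism_proj dominant_proj has_degree_proj assms)
qed

end

section \<open>From sets that are not thin to the specialisation property\<close>

section \<open>Sets that are not thin\<close>

lemma thin_type1_finite:
  assumes "finite A"
  shows "thin_type1 1 ((\<lambda>z. [z]) ` (A :: rat set))"
proof -
  define p where "p = (\<Prod>a\<in>A. [:- a, 1:])"
  have p: "p \<noteq> 0" using assms by (simp add: p_def)
  have zero: "poly p z = 0 \<longleftrightarrow> z \<in> A" for z using assms by (auto simp: p_def poly_prod)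
  define V where "V = {x :: qbar list. length x = 1 \<and> ev1 p (x ! 0) = 0}"
  have "(\<lambda>x. ev1 p (x ! 0)) \<in> polyfun 1" using polyfun_1_iff by blast
  then have "closedin (zariski 1) V" unfolding V_def by (rule closedin_zariski_zeros)
  moreover obtain t where "ev1 p t \<noteq> 0" using ev1_nonzero_point[OF p] by blast
  then have "[t] \<notin> V" by (simp add: V_def)
  then have "V \<noteq> {x. length x = 1}" by auto
  moreover have "(\<lambda>z. [z]) ` A = {a. map to_ac a \<in> V}"
  proof (intro equalityI subsetI)
    fix a assume "a \<in> {a. map to_ac a \<in> V}"
    then obtain z where "a = [z]" "ev1 p (to_ac z) = 0" by (auto simp: V_def length_Suc_conv)
    then show "a \<in> (\<lambda>z. [z]) ` A" using zero by (simp add: ev1_to_ac)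
  qed (auto simp: V_def ev1_to_ac zero)
  ultimately show ?thesis unfolding thin_type1_def by blast
qed

text \<open>Were the conclusion false, each z in Z outside A would give m(z,y) a rational root,
  which is a root of f(z,y) for a prime factor f of m. So Z would be covered by A and the images of
  rational points on the curves f = 0, all of degree at least 2 over the line, and would be
  thin.\<close>

lemma not_thin_imp_hilbertian_set:
  assumes Z: "\<not> thin 1 ((\<lambda>q. [q]) ` Z)"
  shows "hilbertian_set Z"
  unfolding hilbertian_set_def
proof (intro allI impI)
  fix m :: "rat poly poly" and A :: "rat set"
  assume m: "lead_coeff m = 1" "\<forall>p. poly m p \<noteq> 0" and A: "finite A"
  have m0: "m \<noteq> 0" using m(1) by auto
  define H where "H = prime_factors m"
  define T where "T f = {a. \<exists>z u. a = [z] \<and> poly (poly f [:u:]) z = 0}" for f :: "rat poly poly"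
  have T: "thin_type2 1 (T f)" if f: "f \<in> H" for f
  proof -
    have pf: "prime_elem f" and fm: "f dvd m"
      using f unfolding H_def by (blast intro: prime_imp_prime_elem in_prime_factors_imp_prime, blast intro: in_prime_factors_imp_dvd)
    obtain k where k: "m = f * k" using fm by (auto elim: dvdE)
    have lk: "lead_coeff f * lead_coeff k = 1" using m(1) unfolding k by (simp only: lead_coeff_mult)
    \<comment> \<open>The leading coefficients of f and k multiply to 1, so scaling f by that of k
      makes it monic and changes it only by a unit.\<close>
    define h where "h = smult (lead_coeff k) f"
    have "k \<noteq> 0" using m0 k by auto
    then have lh: "lead_coeff h = 1" using lk by (simp add: h_def mult.commute)
    have unit: "is_unit [:lead_coeff k:]"
      using lk \<open>k \<noteq> 0\<close> by (intro dvdI[of _ _ "[:lead_coeff f:]"]) (auto simp: one_pCons mult.commute)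
    have hf: "h = [:lead_coeff k:] * f" by (simp add: h_def)
    have ph: "prime_elem h" unfolding hf by (rule iffD2[OF prime_elem_mult_unit_left[OF unit] pf])
    interpret plane_curve h by unfold_locales (fact ph, fact lh)
    have "degree h \<ge> 2"
    proof (rule ccontr)
      assume "\<not> degree h \<ge> 2"
      \<comment> \<open>A monic factor y + a of m would give m the root -a in Q[t].\<close>
      then have "degree h = 1" using degree_h by simp
      define a b where "a = coeff h 0" and "b = coeff h 1"
      have ab: "h = [:a, b:]"
        using \<open>degree h = 1\<close> by (intro poly_eqI) (auto simp: a_def b_def coeff_pCons coeff_eq_0 split: nat.splits)
      have "b = 1" using lh \<open>degree h = 1\<close> by (simp add: b_def)
      then have "poly h (- a) = 0" using ab by simp
      then have "lead_coeff k * poly f (- a) = 0" by (simp add: h_def)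
      then have "lead_coeff f * (lead_coeff k * poly f (- a)) = 0" by simp
      then have "poly f (- a) = 0" using lk by (simp flip: mult.assoc)
      then have "poly m (- a) = 0" by (simp add: k)
      then show False using m(2) by blast
    qed
    moreover have "T h = T f"
    proof -
      have "poly (lead_coeff f) z * poly (lead_coeff k) z = 1" for z using lk by (metis poly_1 poly_mult)
      then have "poly (lead_coeff k) z \<noteq> 0" for z by (metis mult_zero_right zero_neq_one)
      then show ?thesis by (simp add: T_def h_def)
    qed
    ultimately show ?thesis using thin_type2_curve by (simp add: T_def)
  qed
  show "\<exists>z\<in>Z - A. \<forall>u. poly (poly m [:u:]) z \<noteq> 0"
  proof (rule ccontr)
    assume neg: "\<not> ?thesis"
    define F where "F = insert ((\<lambda>z. [z]) ` A) (T ` H)"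
    have "finite F" by (simp add: F_def H_def)
    moreover have "\<forall>S\<in>F. thin_type1 1 S \<or> thin_type2 1 S"
      unfolding F_def using T thin_type1_finite[OF A] by auto
    moreover have "(\<lambda>q. [q]) ` Z \<subseteq> \<Union>F"
    proof
      fix a assume "a \<in> (\<lambda>q. [q]) ` Z"
      then obtain z where z: "z \<in> Z" "a = [z]" by blast
      show "a \<in> \<Union>F"
      proof (cases "z \<in> A")
        case True
        then show ?thesis using z by (auto simp: F_def)
      next
        case False
        then obtain u where u: "poly (poly m [:u:]) z = 0" using neg z(1) by blast
        have "m dvd prod_mset (prime_factorization m)" using prod_mset_prime_factorization_weak[OF m0] by (metis dvd_normalize_iff dvd_refl)
        then obtain k where "prod_mset (prime_factorization m) = m * k" by (auto elim: dvdE)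
        then have "poly (poly (prod_mset (prime_factorization m)) [:u:]) z = 0" using u by simp
        then have "\<exists>f\<in>#prime_factorization m. poly (poly f [:u:]) z = 0"
        proof -
          have "poly (poly (prod_mset B) [:u:]) z = 0 \<Longrightarrow> \<exists>f\<in>#B. poly (poly f [:u:]) z = 0" for B
            by (induction B) auto
          then show ?thesis using \<open>poly (poly (prod_mset _) _) _ = 0\<close> by blast
        qed
        then obtain f where f: "f \<in> H" "poly (poly f [:u:]) z = 0" by (auto simp: H_def)
        then have "a \<in> T f" using z by (auto simp: T_def)
        then show ?thesis using f(1) by (auto simp: F_def)
      qed
    qed
    ultimately have "thin 1 ((\<lambda>q. [q]) ` Z)" unfolding thin_def by auto
    then show False using Z by blast
  qed
qed


section \<open>Countability and automorphisms of the algebraic closure\<close>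

section \<open>Automorphisms of the algebraic closure\<close>

lemma finite_rat_roots: "(P :: rat poly) \<noteq> 0 \<Longrightarrow> finite {x :: qbar. poly (map_poly of_rat P) x = 0}"
  by (rule poly_roots_finite) (auto simp: poly_eq_iff coeff_map_poly)

lemma countable_qbar: "countable (UNIV :: qbar set)"
proof -
  have "countable (UNIV :: rat poly set)"
    using countable_polys_over[of "UNIV :: rat set"] by (simp add: polys_over_def)
  then have "countable {P :: rat poly. P \<noteq> 0}" by (rule countable_subset[rotated]) simp
  then have "countable (\<Union>P\<in>{P :: rat poly. P \<noteq> 0}. {x :: qbar. poly (map_poly of_rat P) x = 0})"
    by (rule countable_UN) (use finite_rat_roots in \<open>auto intro: countable_finite\<close>)
  moreover have "(UNIV :: qbar set) \<subseteq> (\<Union>P\<in>{P :: rat poly. P \<noteq> 0}. {x. poly (map_poly of_rat P) x = 0})"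
  proof
    fix x :: qbar
    obtain P :: "rat poly" where "P \<noteq> 0" "poly (map_poly of_rat P) x = 0"
      using acl_Rats_rat_poly[OF qbar_algebraic] .
    then show "x \<in> (\<Union>P\<in>{P :: rat poly. P \<noteq> 0}. {x. poly (map_poly of_rat P) x = 0})" by auto
  qed
  ultimately show ?thesis by (rule countable_subset[rotated])
qed

lemma qbar_in_acl: "subfld K \<Longrightarrow> (x :: qbar) \<in> acl K"
  using qbar_algebraic acl_mono[OF subfld_Rats_subset] by blast

lemma field_hom_fixes_Rats:
  assumes K: "subfld K" and \<sigma>: "field_hom_on \<sigma> K" and x: "x \<in> \<rat>"
  shows "\<sigma> x = (x :: 'a::field_char_0)"
proof -
  have "subfld {x \<in> K. \<sigma> x = x}"
  proof (rule subfldI)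
    show "1 \<in> {x \<in> K. \<sigma> x = x}" using field_hom_1[OF K \<sigma>] subfld_1[OF K] by simp
    fix x y assume "x \<in> {x \<in> K. \<sigma> x = x}" "y \<in> {x \<in> K. \<sigma> x = x}"
    then show "x - y \<in> {x \<in> K. \<sigma> x = x}" "x * y \<in> {x \<in> K. \<sigma> x = x}"
      by (simp_all add: field_hom_diff[OF K \<sigma>] field_hom_mult[OF K \<sigma>] subfld_diff[OF K] subfld_mult[OF K])
  next
    fix x assume "x \<in> {x \<in> K. \<sigma> x = x}"
    then show "inverse x \<in> {x \<in> K. \<sigma> x = x}"
      by (simp add: field_hom_inverse[OF K \<sigma>] subfld_inverse[OF K])
  qed
  then have "\<rat> \<subseteq> {x \<in> K. \<sigma> x = x}" by (rule subfld_Rats_subset)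
  then show ?thesis using x by blast
qed

definition automorphism :: "(qbar \<Rightarrow> qbar) \<Rightarrow> bool" where
  "automorphism \<tau> \<longleftrightarrow> field_hom_on \<tau> UNIV \<and> bij \<tau>"

lemma field_hom_permutes_roots:
  fixes \<tau> :: "qbar \<Rightarrow> qbar"
  assumes \<tau>: "field_hom_on \<tau> UNIV" and x: "poly (map_poly of_rat P) x = 0"
  shows "poly (map_poly of_rat P) (\<tau> x) = 0"
proof -
  have p: "map_poly of_rat P \<in> polys_over UNIV" by (simp add: polys_over_def)
  have "map_poly \<tau> (map_poly of_rat P) = map_poly of_rat P"
    by (rule poly_eqI)
       (simp add: coeff_map_poly_hom[OF subfld_UNIV \<tau>] coeff_map_poly field_hom_fixes_Rats[OF subfld_UNIV \<tau>])
  then show ?thesis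
    using field_hom_poly[OF subfld_UNIV \<tau> p, of x] x field_hom_0[OF subfld_UNIV \<tau>] by simp
qed

text \<open>Surjectivity is automatic: each element lies in the finite root set of a rational
  polynomial, which an injective endomorphism permutes.\<close>

lemma automorphismI:
  assumes \<tau>: "field_hom_on \<tau> UNIV"
  shows "automorphism \<tau>"
proof -
  have inj: "inj \<tau>" using field_hom_inj[OF subfld_UNIV \<tau>] .
  have "y \<in> range \<tau>" for y
  proof -
    obtain P where P: "P \<noteq> 0" "poly (map_poly of_rat P) y = 0" using acl_Rats_rat_poly[OF qbar_algebraic] .
    define R where "R = {x :: qbar. poly (map_poly of_rat P) x = 0}"
    have "\<tau> ` R \<subseteq> R" using field_hom_permutes_roots[OF \<tau>] by (auto simp: R_def)
    moreover have "inj_on \<tau> R" by (rule inj_on_subset[OF inj]) simp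
    ultimately have "\<tau> ` R = R" using finite_rat_roots[OF P(1)] by (intro endo_inj_surj) (simp_all add: R_def)
    moreover have "y \<in> R" using P(2) by (simp add: R_def)
    ultimately show ?thesis by blast
  qed
  then have "surj \<tau>" by blast
  then show ?thesis using \<tau> inj by (simp add: automorphism_def bij_def)
qed

text \<open>As \<open>qbar\<close> is countable and algebraic over L, its elements can be adjoined
  one after the other, extending the homomorphism each time; the union is an endomorphism of
  \<open>qbar\<close>, hence an automorphism.\<close>

lemma extend_to_automorphism:
  assumes L: "subfld L" and f: "field_hom_on f L"
  shows "\<exists>\<tau>. automorphism \<tau> \<and> (\<forall>x\<in>L. \<tau> x = f x)"
proof -
  define e :: "nat \<Rightarrow> qbar" where "e = from_nat_into UNIV"
  have e: "range e = UNIV" unfolding e_def by (rule range_from_nat_into) (use countable_qbar in auto)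
  define G where "G s \<longleftrightarrow> subfld (fst s) \<and> field_hom_on (snd s) (fst s)" for s :: "qbar set \<times> (qbar \<Rightarrow> qbar)"
  define Q where "Q n s t \<longleftrightarrow> fst s \<subseteq> fst t \<and> (\<forall>a\<in>fst s. snd t a = snd s a) \<and> e n \<in> fst t"
    for n :: nat and s t :: "qbar set \<times> (qbar \<Rightarrow> qbar)"
  have "\<exists>S. \<forall>n. (G (S n) \<and> (n = 0 \<longrightarrow> S n = (L, f))) \<and> Q n (S n) (S (Suc n))"
  proof (rule dependent_nat_choice)
    show "\<exists>s. G s \<and> (0 = (0::nat) \<longrightarrow> s = (L, f))" using L f by (intro exI[of _ "(L, f)"]) (simp add: G_def)
    fix s and n :: nat assume "G s \<and> (n = 0 \<longrightarrow> s = (L, f))"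
    then have s: "subfld (fst s)" "field_hom_on (snd s) (fst s)" by (simp_all add: G_def)
    obtain \<tau> where \<tau>: "field_hom_on \<tau> (adj (fst s) (e n))" "\<forall>a\<in>fst s. \<tau> a = snd s a"
      using field_hom_extend_algebraic[OF s qbar_in_acl[OF s(1)]] by blast
    then show "\<exists>t. (G t \<and> (Suc n = 0 \<longrightarrow> t = (L, f))) \<and> Q n s t"
      using subfld_adj[OF s(1)] adj_base[OF s(1)] adj_gen[OF s(1)]
      by (intro exI[of _ "(adj (fst s) (e n), \<tau>)"]) (simp add: G_def Q_def)
  qed
  then obtain S where S: "\<And>n. G (S n)" "S 0 = (L, f)" "\<And>n. Q n (S n) (S (Suc n))" by blast
  define K where "K n = fst (S n)" for n
  define \<sigma> where "\<sigma> n = snd (S n)" for n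
  have K: "subfld (K n)" "field_hom_on (\<sigma> n) (K n)" for n using S(1)[of n] by (simp_all add: G_def K_def \<sigma>_def)
  have mono: "K n \<subseteq> K m \<and> (\<forall>a\<in>K n. \<sigma> m a = \<sigma> n a)" if "n \<le> m" for n m
    using that
  proof (induction m rule: dec_induct)
    case (step m)
    have "K m \<subseteq> K (Suc m)" "\<forall>a\<in>K m. \<sigma> (Suc m) a = \<sigma> m a"
      using S(3)[of m] by (simp_all add: Q_def K_def \<sigma>_def)
    then show ?case using step.IH by (simp add: subset_iff)
  qed simp
  have ex: "\<exists>n. x \<in> K n" for x
  proof -
    have "x \<in> range e" using e by simp
    then obtain n where "x = e n" by blast
    then have "x \<in> K (Suc n)" using S(3)[of n] by (simp add: Q_def K_def)
    then show ?thesis ..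
  qed
  define \<tau> where "\<tau> x = \<sigma> (LEAST n. x \<in> K n) x" for x
  have \<tau>: "\<tau> x = \<sigma> n x" if x: "x \<in> K n" for x n
  proof -
    have "x \<in> K (LEAST n. x \<in> K n)" "(LEAST n. x \<in> K n) \<le> n" using x by (rule LeastI, rule Least_le)
    then show ?thesis using mono[of "LEAST n. x \<in> K n" n] by (simp add: \<tau>_def)
  qed
  have "field_hom_on \<tau> UNIV"
    unfolding field_hom_on_def
  proof (intro conjI ballI)
    show "\<tau> 1 = 1" using \<tau>[OF subfld_1[OF K(1)[of 0]]] field_hom_1[OF K] by simp
    fix x y
    obtain n m where "x \<in> K n" "y \<in> K m" using ex by blast
    then have xy: "x \<in> K (max n m)" "y \<in> K (max n m)" using mono[of n "max n m"] mono[of m "max n m"] by auto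
    show "\<tau> (x + y) = \<tau> x + \<tau> y"
      using \<tau>[OF subfld_add[OF K(1) xy]] \<tau>[OF xy(1)] \<tau>[OF xy(2)] field_hom_add[OF K xy] by simp
    show "\<tau> (x * y) = \<tau> x * \<tau> y"
      using \<tau>[OF subfld_mult[OF K(1) xy]] \<tau>[OF xy(1)] \<tau>[OF xy(2)] field_hom_mult[OF K xy] by simp
  qed
  then have "automorphism \<tau>" by (rule automorphismI)
  moreover have "\<tau> x = f x" if "x \<in> L" for x
    using \<tau>[of x 0] that S(2) by (simp add: K_def \<sigma>_def)
  ultimately show ?thesis by blast
qed

lemma automorphism_image:
  assumes "automorphism \<tau>" "subfld L"
  shows "subfld (\<tau> ` L)"
  using subfld_image[OF assms(2) field_hom_on_subset[of \<tau> UNIV]] assms(1) by (simp add: automorphism_def)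

section \<open>The topology on subfields and on their isomorphism classes\<close>

section \<open>The space of subfields\<close>

definition basic_open :: "qbar set \<Rightarrow> qbar set \<Rightarrow> qbar set set" where
  "basic_open A B = {L. subfld L \<and> A \<subseteq> L \<and> B \<inter> L = {}}"

lemma openin_subfields_iff:
  "openin qbar_subfield_topology S \<longleftrightarrow>
    S \<subseteq> qbar_subfields \<and> (\<forall>L\<in>S. \<exists>A B. finite A \<and> finite B \<and> L \<in> basic_open A B \<and> basic_open A B \<subseteq> S)"
proof
  let ?P = "product_topology (\<lambda>_. discrete_topology (UNIV :: bool set)) (UNIV :: qbar set)"
  assume "openin qbar_subfield_topology S"
  then obtain V where V: "openin ?P V" "S = (\<lambda>L x. x \<in> L) -` V \<inter> qbar_subfields"
    by (auto simp: qbar_subfield_topology_def openin_pullback_topology)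
  have "\<exists>A B. finite A \<and> finite B \<and> L \<in> basic_open A B \<and> basic_open A B \<subseteq> S" if L: "L \<in> S" for L
  proof -
    have "(\<lambda>x. x \<in> L) \<in> V" using L V(2) by simp
    then obtain W where W: "finite {i. W i \<noteq> UNIV}" "(\<lambda>x. x \<in> L) \<in> Pi\<^sub>E UNIV W" "Pi\<^sub>E UNIV W \<subseteq> V"
      using V(1) unfolding openin_product_topology_alt by fastforce
    define A where "A = {i. W i \<noteq> UNIV} \<inter> L"
    define B where "B = {i. W i \<noteq> UNIV} - L"
    have "basic_open A B \<subseteq> S"
    proof
      fix L' assume L': "L' \<in> basic_open A B"
      have "(i \<in> L') \<in> W i" for i
      proof (cases "W i = UNIV")
        case False
        then have "i \<in> L' \<longleftrightarrow> i \<in> L" using L' by (auto simp: basic_open_def A_def B_def)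
        then show ?thesis using PiE_mem[OF W(2), of i] by simp
      qed simp
      then have "(\<lambda>x. x \<in> L') \<in> V" using W(3) by (auto simp: PiE_UNIV_domain)
      then show "L' \<in> S" using L' V(2) by (simp add: basic_open_def qbar_subfields_def)
    qed
    moreover have "L \<in> basic_open A B" using L V(2) by (auto simp: basic_open_def A_def B_def qbar_subfields_def)
    moreover have "finite A" "finite B" using W(1) by (simp_all add: A_def B_def)
    ultimately show ?thesis by blast
  qed
  moreover have "S \<subseteq> qbar_subfields" using V(2) by simp
  ultimately show "S \<subseteq> qbar_subfields \<and> (\<forall>L\<in>S. \<exists>A B. finite A \<and> finite B \<and> L \<in> basic_open A B \<and> basic_open A B \<subseteq> S)"
    by (intro conjI ballI)
next
  let ?P = "product_topology (\<lambda>_. discrete_topology (UNIV :: bool set)) (UNIV :: qbar set)"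
  assume S: "S \<subseteq> qbar_subfields \<and> (\<forall>L\<in>S. \<exists>A B. finite A \<and> finite B \<and> L \<in> basic_open A B \<and> basic_open A B \<subseteq> S)"
  have basic: "openin qbar_subfield_topology (basic_open A B)" if AB: "finite A" "finite B" for A B
  proof -
    define W where "W i = {c. (i \<in> A \<longrightarrow> c) \<and> (i \<in> B \<longrightarrow> \<not> c)}" for i
    have "{i \<in> UNIV. W i \<noteq> topspace (discrete_topology (UNIV :: bool set))} \<subseteq> A \<union> B" by (auto simp: W_def)
    then have "finite {i \<in> UNIV. W i \<noteq> topspace (discrete_topology (UNIV :: bool set))}"
      by (rule finite_subset) (use AB in simp)
    then have "openin ?P (Pi\<^sub>E UNIV W)"
      unfolding openin_product_topology_alt by (intro ballI exI[of _ W]) auto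
    moreover have "basic_open A B = (\<lambda>L x. x \<in> L) -` (Pi\<^sub>E UNIV W) \<inter> qbar_subfields"
      by (auto simp: basic_open_def qbar_subfields_def PiE_UNIV_domain W_def) blast+
    ultimately show ?thesis unfolding qbar_subfield_topology_def openin_pullback_topology by blast
  qed
  have "\<exists>T. openin qbar_subfield_topology T \<and> L \<in> T \<and> T \<subseteq> S" if "L \<in> S" for L
    using S that basic by blast
  then show "openin qbar_subfield_topology S" by (subst openin_subopen) blast
qed

lemma topspace_subfields: "topspace qbar_subfield_topology = qbar_subfields"
proof -
  have "openin qbar_subfield_topology qbar_subfields"
    unfolding openin_subfields_iff
    by (intro conjI ballI exI[of _ "{}"]) (auto simp: basic_open_def qbar_subfields_def)
  moreover have "topspace qbar_subfield_topology \<subseteq> qbar_subfields"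
    using openin_topspace[of qbar_subfield_topology] unfolding openin_subfields_iff by blast
  ultimately show ?thesis using openin_subset by blast
qed

text \<open>An isomorphism between subfields extends to an automorphism of \<open>qbar\<close>, so
  classes are orbits.\<close>

lemma iso_class_iff:
  assumes L: "subfld L" and L': "subfld L'"
  shows "L' \<in> iso_class L \<longleftrightarrow> (\<exists>\<tau>. automorphism \<tau> \<and> \<tau> ` L = L')"
proof
  assume "L' \<in> iso_class L"
  then obtain f where f: "f \<in> ring_iso (ring_of_type_algebra\<lparr>carrier := L\<rparr>) (ring_of_type_algebra\<lparr>carrier := L'\<rparr>)"
    by (auto simp: iso_class_def is_ring_iso_def)
  then have "field_hom_on f L" "f ` L = L'"
    by (auto simp: field_hom_on_def ring_iso_def ring_hom_def bij_betw_def)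
  then show "\<exists>\<tau>. automorphism \<tau> \<and> \<tau> ` L = L'"
    using extend_to_automorphism[OF L, of f] by (metis image_cong)
next
  assume "\<exists>\<tau>. automorphism \<tau> \<and> \<tau> ` L = L'"
  then obtain \<tau> where \<tau>: "field_hom_on \<tau> UNIV" "bij \<tau>" "\<tau> ` L = L'" by (auto simp: automorphism_def)
  have "inj_on \<tau> L" using \<tau>(2) by (meson bij_is_inj inj_on_subset subset_UNIV)
  then have "\<tau> \<in> ring_iso (ring_of_type_algebra\<lparr>carrier := L\<rparr>) (ring_of_type_algebra\<lparr>carrier := L'\<rparr>)"
    using \<tau>(1,3) by (auto simp: field_hom_on_def ring_iso_def ring_hom_def bij_betw_def)
  then show "L' \<in> iso_class L" using L' by (auto simp: iso_class_def qbar_subfields_def is_ring_iso_def)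
qed

lemma automorphism_comp: "automorphism \<sigma> \<Longrightarrow> automorphism \<tau> \<Longrightarrow> automorphism (\<sigma> \<circ> \<tau>)"
  unfolding automorphism_def using bij_comp[of \<tau> \<sigma>] by (simp add: field_hom_on_def)

lemma automorphism_inv: "automorphism \<tau> \<Longrightarrow> automorphism (inv_into UNIV \<tau>)"
proof (rule automorphismI)
  assume "automorphism \<tau>"
  then have \<tau>: "field_hom_on \<tau> UNIV" "bij \<tau>" by (simp_all add: automorphism_def)
  have inv: "inv_into UNIV \<tau> (\<tau> x) = x" "\<tau> (inv_into UNIV \<tau> x) = x" for x
    using \<tau>(2) by (simp_all add: bij_is_inj bij_is_surj surj_f_inv_f)
  have "inv_into UNIV \<tau> (x + y) = inv_into UNIV \<tau> x + inv_into UNIV \<tau> y" "inv_into UNIV \<tau> (x * y) = inv_into UNIV \<tau> x * inv_into UNIV \<tau> y" for x y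
    using inv(1)[of "inv_into UNIV \<tau> x + inv_into UNIV \<tau> y"] inv(1)[of "inv_into UNIV \<tau> x * inv_into UNIV \<tau> y"] \<tau>(1)
    by (simp_all add: field_hom_on_def inv(2))
  moreover have "inv_into UNIV \<tau> 1 = 1" using inv(1)[of 1] \<tau>(1) by (simp add: field_hom_on_def)
  ultimately show "field_hom_on (inv_into UNIV \<tau>) UNIV" by (simp add: field_hom_on_def)
qed

lemma iso_class_eq_iff:
  assumes L: "subfld L" and L': "subfld L'"
  shows "iso_class L = iso_class L' \<longleftrightarrow> (\<exists>\<tau>. automorphism \<tau> \<and> \<tau> ` L = L')"
proof
  assume "iso_class L = iso_class L'"
  moreover have "automorphism id" by (rule automorphismI) (simp add: field_hom_on_def)
  then have "\<exists>\<tau>. automorphism \<tau> \<and> \<tau> ` L' = L'" by (intro exI[of _ id] conjI) simp_all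
  then have "L' \<in> iso_class L'" by (rule iffD2[OF iso_class_iff[OF L' L']])
  ultimately have "L' \<in> iso_class L" by (simp only:)
  then show "\<exists>\<tau>. automorphism \<tau> \<and> \<tau> ` L = L'" by (rule iffD1[OF iso_class_iff[OF L L']])
next
  assume "\<exists>\<tau>. automorphism \<tau> \<and> \<tau> ` L = L'"
  then obtain \<tau> where \<tau>: "automorphism \<tau>" "\<tau> ` L = L'" by blast
  have inv: "inv_into UNIV \<tau> ` L' = L"
    using \<tau> by (simp add: automorphism_def bij_is_inj image_inv_f_f flip: \<tau>(2))
  have "M \<in> iso_class L \<longleftrightarrow> M \<in> iso_class L'" for M
  proof (cases "subfld M")
    case True
    show ?thesis
      unfolding iso_class_iff[OF L True] iso_class_iff[OF L' True]
    proof
      assume "\<exists>\<sigma>. automorphism \<sigma> \<and> \<sigma> ` L = M"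
      then obtain \<sigma> where \<sigma>: "automorphism \<sigma>" "\<sigma> ` L = M" by blast
      have "(\<sigma> \<circ> inv_into UNIV \<tau>) ` L' = M" unfolding image_comp[symmetric] inv \<sigma>(2) ..
      then show "\<exists>\<sigma>. automorphism \<sigma> \<and> \<sigma> ` L' = M"
        using automorphism_comp[OF \<sigma>(1) automorphism_inv[OF \<tau>(1)]] by blast
    next
      assume "\<exists>\<sigma>. automorphism \<sigma> \<and> \<sigma> ` L' = M"
      then obtain \<sigma> where \<sigma>: "automorphism \<sigma>" "\<sigma> ` L' = M" by blast
      have "(\<sigma> \<circ> \<tau>) ` L = M" unfolding image_comp[symmetric] \<tau>(2) \<sigma>(2) ..
      then show "\<exists>\<sigma>. automorphism \<sigma> \<and> \<sigma> ` L = M"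
        using automorphism_comp[OF \<sigma>(1) \<tau>(1)] by blast
    qed
  qed (simp add: iso_class_def qbar_subfields_def)
  then show "iso_class L = iso_class L'" by blast
qed

lemma openin_iso_iff: "openin qbar_iso_topology V \<longleftrightarrow>
    V \<subseteq> iso_class ` qbar_subfields \<and> openin qbar_subfield_topology {L \<in> qbar_subfields. iso_class L \<in> V}"
  unfolding qbar_iso_topology_def openin_quotient_topology topspace_subfields ..

lemma topspace_iso: "topspace qbar_iso_topology = iso_class ` qbar_subfields"
  using quotient_imp_surjective_map[OF quotient_map_quotient_topology[of qbar_subfield_topology iso_class]]
  by (simp add: qbar_iso_topology_def topspace_subfields)

text \<open>The quotient by a group of homeomorphisms is an open map: the saturation of a basic open
  set is a union of its translates, and the translate by tau is the basic open set of the images of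
  A and B.\<close>

lemma openin_iso_basic:
  assumes "finite A" "finite B"
  shows "openin qbar_iso_topology (iso_class ` basic_open A B)"
  unfolding openin_iso_iff
proof
  show "iso_class ` basic_open A B \<subseteq> iso_class ` qbar_subfields"
    by (auto simp: basic_open_def qbar_subfields_def)
  show "openin qbar_subfield_topology {L \<in> qbar_subfields. iso_class L \<in> iso_class ` basic_open A B}"
    unfolding openin_subfields_iff
  proof (intro conjI ballI)
    fix L' assume "L' \<in> {L \<in> qbar_subfields. iso_class L \<in> iso_class ` basic_open A B}"
    then obtain L where L: "subfld L" "A \<subseteq> L" "B \<inter> L = {}" and L': "subfld L'" "iso_class L = iso_class L'"
      by (auto simp: basic_open_def qbar_subfields_def)
    then obtain \<tau> where \<tau>: "automorphism \<tau>" "\<tau> ` L = L'" using iffD1[OF iso_class_eq_iff[OF L(1) L'(1)] L'(2)] by blast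
    then have bij: "bij \<tau>" by (simp add: automorphism_def)
    have "L' \<in> basic_open (\<tau> ` A) (\<tau> ` B)"
      unfolding basic_open_def using L L'(1) \<tau>(2) bij_is_inj[OF bij] by (auto simp: inj_eq)
    moreover have "basic_open (\<tau> ` A) (\<tau> ` B) \<subseteq> {L \<in> qbar_subfields. iso_class L \<in> iso_class ` basic_open A B}"
    proof
      fix M assume M: "M \<in> basic_open (\<tau> ` A) (\<tau> ` B)"
      then have sM: "subfld M" by (simp add: basic_open_def)
      define N where "N = inv_into UNIV \<tau> ` M"
      have N: "subfld N" unfolding N_def by (rule automorphism_image[OF automorphism_inv[OF \<tau>(1)] sM])
      have \<tau>N: "\<tau> ` N = M" unfolding N_def using bij by (simp add: image_f_inv_f bij_is_surj)
      then have "N \<in> basic_open A B"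
        using M N bij_is_inj[OF bij] by (auto simp: basic_open_def inj_image_mem_iff inj_image_subset_iff)
      moreover have "iso_class M = iso_class N" using iso_class_eq_iff[OF N sM] \<tau>(1) \<tau>N by metis
      ultimately show "M \<in> {L \<in> qbar_subfields. iso_class L \<in> iso_class ` basic_open A B}"
        using sM by (simp add: qbar_subfields_def)
    qed
    ultimately show "\<exists>A' B'. finite A' \<and> finite B' \<and> L' \<in> basic_open A' B' \<and>
        basic_open A' B' \<subseteq> {L \<in> qbar_subfields. iso_class L \<in> iso_class ` basic_open A B}"
      using assms by (intro exI[of _ "\<tau> ` A"] exI[of _ "\<tau> ` B"]) simp
  qed auto
qed

section \<open>Conjugate formulas and the category argument\<close>

section \<open>Formulas\<close>

definition defined_set :: "qbar qf_formula \<Rightarrow> qbar set \<Rightarrow> qbar set" where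
  "defined_set \<phi> L = {x \<in> L. \<forall>e. e 0 = x \<longrightarrow> range e \<subseteq> L \<longrightarrow> qf_holds e \<phi>}"

definition defines_coinfinite :: "rat set \<Rightarrow> qbar qf_formula \<Rightarrow> qbar set \<Rightarrow> bool" where
  "defines_coinfinite Z \<phi> L \<longleftrightarrow> qf_params \<phi> \<subseteq> L \<and> infinite (L - defined_set \<phi> L) \<and> defined_set \<phi> L \<inter> \<rat> = of_rat ` Z"

lemma rterm_val_automorphism:
  assumes "automorphism \<tau>"
  shows "rterm_val (\<lambda>i. \<tau> (e i)) (map_rterm \<tau> s) = \<tau> (rterm_val e s)"
proof -
  have \<tau>: "field_hom_on \<tau> UNIV" using assms by (simp add: automorphism_def)
  show ?thesis
    by (induction s)
       (simp_all add: field_hom_0[OF subfld_UNIV \<tau>] field_hom_1[OF subfld_UNIV \<tau>] field_hom_add[OF subfld_UNIV \<tau>]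
          field_hom_mult[OF subfld_UNIV \<tau>] field_hom_uminus[OF subfld_UNIV \<tau>])
qed

lemma qf_holds_automorphism:
  assumes "automorphism \<tau>"
  shows "qf_holds (\<lambda>i. \<tau> (e i)) (map_qf_formula \<tau> \<phi>) \<longleftrightarrow> qf_holds e \<phi>"
proof -
  have "inj \<tau>" using assms by (simp add: automorphism_def bij_is_inj)
  then show ?thesis by (induction \<phi>) (simp_all add: rterm_val_automorphism[OF assms] inj_eq)
qed

lemma defined_set_automorphism:
  assumes \<tau>: "automorphism \<tau>"
  shows "defined_set (map_qf_formula \<tau> \<phi>) (\<tau> ` L) = \<tau> ` defined_set \<phi> L"
proof -
  have bij: "bij \<tau>" using \<tau> by (simp add: automorphism_def)
  have inv: "\<tau> (inv_into UNIV \<tau> x) = x" "inv_into UNIV \<tau> (\<tau> x) = x" for x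
    using bij by (simp_all add: bij_is_inj bij_is_surj surj_f_inv_f)
  have "\<tau> x \<in> defined_set (map_qf_formula \<tau> \<phi>) (\<tau> ` L) \<longleftrightarrow> x \<in> defined_set \<phi> L" for x
  proof
    assume x: "\<tau> x \<in> defined_set (map_qf_formula \<tau> \<phi>) (\<tau> ` L)"
    show "x \<in> defined_set \<phi> L"
      unfolding defined_set_def
    proof (intro CollectI conjI allI impI)
      show "x \<in> L" using x bij_is_inj[OF bij] by (simp add: defined_set_def inj_image_mem_iff)
      fix e :: "nat \<Rightarrow> qbar" assume "e 0 = x" "range e \<subseteq> L"
      then have "\<tau> (e 0) = \<tau> x" "range (\<lambda>i. \<tau> (e i)) \<subseteq> \<tau> ` L" by auto
      then have "qf_holds (\<lambda>i. \<tau> (e i)) (map_qf_formula \<tau> \<phi>)" using x by (simp add: defined_set_def)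
      then show "qf_holds e \<phi>" using qf_holds_automorphism[OF \<tau>] by simp
    qed
  next
    assume x: "x \<in> defined_set \<phi> L"
    show "\<tau> x \<in> defined_set (map_qf_formula \<tau> \<phi>) (\<tau> ` L)"
      unfolding defined_set_def
    proof (intro CollectI conjI allI impI)
      show "\<tau> x \<in> \<tau> ` L" using x by (simp add: defined_set_def)
      fix e :: "nat \<Rightarrow> qbar" assume e: "e 0 = \<tau> x" "range e \<subseteq> \<tau> ` L"
      have "inv_into UNIV \<tau> (e i) \<in> L" for i
      proof -
        have "e i \<in> \<tau> ` L" using e(2) by blast
        then show ?thesis by (auto simp: inv(2))
      qed
      then have "range (\<lambda>i. inv_into UNIV \<tau> (e i)) \<subseteq> L" by blast
      moreover have "inv_into UNIV \<tau> (e 0) = x" by (simp add: e(1) inv(2))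
      ultimately have "qf_holds (\<lambda>i. inv_into UNIV \<tau> (e i)) \<phi>" using x by (simp add: defined_set_def)
      then show "qf_holds e (map_qf_formula \<tau> \<phi>)"
        using qf_holds_automorphism[OF \<tau>, of "\<lambda>i. inv_into UNIV \<tau> (e i)" \<phi>] by (simp add: inv(1))
    qed
  qed
  note * = this
  have "y \<in> defined_set (map_qf_formula \<tau> \<phi>) (\<tau> ` L) \<longleftrightarrow> y \<in> \<tau> ` defined_set \<phi> L" for y
    using *[of "inv_into UNIV \<tau> y"] bij_is_inj[OF bij] inj_image_mem_iff[of \<tau> "inv_into UNIV \<tau> y" "defined_set \<phi> L"]
    by (simp add: inv(1))
  then show ?thesis by blast
qed

text \<open>Automorphisms fix the rationals pointwise, so moving L and the parameters together
  leaves the rational points of the defined set unchanged.\<close>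

lemma defines_coinfinite_automorphism:
  assumes \<tau>: "automorphism \<tau>" and D: "defines_coinfinite Z \<phi> L"
  shows "defines_coinfinite Z (map_qf_formula \<tau> \<phi>) (\<tau> ` L)"
proof -
  have hom: "field_hom_on \<tau> UNIV" and inj: "inj \<tau>" using \<tau> by (simp_all add: automorphism_def bij_is_inj)
  have fixed: "\<tau> x = x" if "x \<in> \<rat>" for x using field_hom_fixes_Rats[OF subfld_UNIV hom that] .
  have "\<tau> ` L - \<tau> ` defined_set \<phi> L = \<tau> ` (L - defined_set \<phi> L)"
    by (rule image_set_diff[OF inj, symmetric])
  moreover have "infinite (\<tau> ` (L - defined_set \<phi> L))"
    unfolding finite_image_iff[OF inj_on_subset[OF inj subset_UNIV]] using D by (simp add: defines_coinfinite_def)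
  moreover have "\<tau> ` defined_set \<phi> L \<inter> \<rat> = of_rat ` Z"
  proof -
    have "y \<in> \<tau> ` defined_set \<phi> L \<longleftrightarrow> y \<in> defined_set \<phi> L" if "y \<in> \<rat>" for y
      using inj_image_mem_iff[OF inj, of y "defined_set \<phi> L"] fixed[OF that] by simp
    note eq = this
    have "y \<in> \<tau> ` defined_set \<phi> L \<inter> \<rat> \<longleftrightarrow> y \<in> defined_set \<phi> L \<inter> \<rat>" for y
      by (cases "y \<in> \<rat>") (simp_all only: Int_iff eq simp_thms)
    then have "\<tau> ` defined_set \<phi> L \<inter> \<rat> = defined_set \<phi> L \<inter> \<rat>" by (rule Set.set_eqI)
    then show ?thesis using D by (simp only: defines_coinfinite_def)
  qed
  ultimately show ?thesis
    using D unfolding defines_coinfinite_def defined_set_automorphism[OF \<tau>]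
    by (intro conjI) (simp_all add: qf_formula.set_map image_mono)
qed

lemma finite_rterm_params: "finite (rterm_params s)"
  by (induction s) auto

lemma finite_qf_params: "finite (qf_params \<phi>)"
  by (induction \<phi>) (auto simp: finite_rterm_params)

text \<open>The conjugate formula depends only on the images of the finitely many parameters, each
  of which is a root of a fixed rational polynomial.\<close>

lemma finite_conjugate_formulas: "finite {map_qf_formula \<tau> \<phi> | \<tau>. automorphism \<tau>}"
proof -
  define R where "R p = {\<tau> p | \<tau>. automorphism \<tau>}" for p
  have "finite (R p)" for p
  proof -
    obtain P where P: "P \<noteq> 0" "poly (map_poly of_rat P) p = 0" using acl_Rats_rat_poly[OF qbar_algebraic] .
    have "R p \<subseteq> {x. poly (map_poly of_rat P) x = 0}"
      using field_hom_permutes_roots[OF _ P(2)] by (auto simp: R_def automorphism_def)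
    then show ?thesis using finite_rat_roots[OF P(1)] by (rule finite_subset)
  qed
  then have "finite (Pi\<^sub>E (qf_params \<phi>) R)" by (intro finite_PiE finite_qf_params)
  moreover have "{map_qf_formula \<tau> \<phi> | \<tau>. automorphism \<tau>} \<subseteq> (\<lambda>g. map_qf_formula g \<phi>) ` Pi\<^sub>E (qf_params \<phi>) R"
  proof
    fix \<psi> assume "\<psi> \<in> {map_qf_formula \<tau> \<phi> | \<tau>. automorphism \<tau>}"
    then obtain \<tau> where \<tau>: "\<psi> = map_qf_formula \<tau> \<phi>" "automorphism \<tau>" by blast
    have "\<psi> = map_qf_formula (restrict \<tau> (qf_params \<phi>)) \<phi>"
      unfolding \<tau>(1) by (rule qf_formula.map_cong0) simp
    moreover have "restrict \<tau> (qf_params \<phi>) \<in> Pi\<^sub>E (qf_params \<phi>) R" using \<tau>(2) by (auto simp: R_def)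
    ultimately show "\<psi> \<in> (\<lambda>g. map_qf_formula g \<phi>) ` Pi\<^sub>E (qf_params \<phi>) R" by blast
  qed
  ultimately show ?thesis by (rule finite_surj)
qed

text \<open>If some L in the basic open set realises the formula, \<open>specialise_witness\<close>
  gives another member N with a counterexample at a point of Z. Counterexamples persist in every
  field containing their entries, since the formula is quantifier-free after instantiation; so
  requiring these entries excludes the formula throughout a smaller basic open set.\<close>

lemma avoid_formula:
  assumes Z: "hilbertian_set Z" and A: "finite A" and B: "finite B" and ne: "basic_open A B \<noteq> {}"
  shows "\<exists>A'. finite A' \<and> A \<subseteq> A' \<and> basic_open A' B \<noteq> {} \<and> (\<forall>L\<in>basic_open A' B. \<not> defines_coinfinite Z \<phi> L)"
proof (cases "\<exists>L\<in>basic_open A B. defines_coinfinite Z \<phi> L")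
  case False
  then show ?thesis using A ne by blast
next
  case True
  then obtain L where L: "subfld L" "A \<subseteq> L" "B \<inter> L = {}" "qf_params \<phi> \<subseteq> L" "infinite (L - defined_set \<phi> L)"
    by (auto simp: basic_open_def defines_coinfinite_def)
  obtain x :: "nat \<Rightarrow> qbar" where x: "inj x" "range x \<subseteq> L - defined_set \<phi> L"
    using infinite_countable_subset[OF L(5)] by blast
  have "\<exists>e. e 0 = x n \<and> range e \<subseteq> L \<and> \<not> qf_holds e \<phi>" for n
  proof -
    have "x n \<in> L - defined_set \<phi> L" using x(2) by blast
    then show ?thesis unfolding defined_set_def by blast
  qed
  then obtain e where e: "\<And>n. e n 0 = x n" "\<And>n. range (e n) \<subseteq> L" "\<And>n. \<not> qf_holds (e n) \<phi>" by metis
  have inj: "inj (\<lambda>n. e n 0)" using x(1) by (simp add: e(1))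
  have fin: "finite (A \<union> qf_params \<phi>)" "A \<union> qf_params \<phi> \<subseteq> L" using A L(2,4) finite_qf_params by simp_all
  \<comment> \<open>The parameters of the formula are put into N along with A, so that N is a field
    in which it can be interpreted.\<close>
  have "\<exists>N z v. subfld N \<and> A \<union> qf_params \<phi> \<subseteq> N \<and> B \<inter> N = {} \<and> z \<in> Z \<and> v 0 = of_rat z \<and>
      range v \<subseteq> N \<and> finite (range v) \<and> \<not> qf_holds v \<phi>"
    by (rule specialise_witness[where e = e, OF Z L(1) e(2) inj e(3) fin B L(3)])
  then obtain N z v where N: "subfld N" "A \<union> qf_params \<phi> \<subseteq> N" "B \<inter> N = {}" and z: "z \<in> Z" "v 0 = of_rat z"
    and v: "range v \<subseteq> N" "finite (range v)" "\<not> qf_holds v \<phi>"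
    by blast
  define A' where "A' = A \<union> range v"
  have "N \<in> basic_open A' B" using N v(1) by (simp add: basic_open_def A'_def)
  moreover have "\<not> defines_coinfinite Z \<phi> L'" if "L' \<in> basic_open A' B" for L'
  proof
    assume D: "defines_coinfinite Z \<phi> L'"
    have "of_rat z \<in> (of_rat ` Z :: qbar set)" using z(1) by blast
    then have "of_rat z \<in> defined_set \<phi> L'" using D by (auto simp: defines_coinfinite_def)
    moreover have "range v \<subseteq> L'" using that by (simp add: basic_open_def A'_def)
    ultimately have "qf_holds v \<phi>" using z(2) by (simp add: defined_set_def)
    then show False using v(3) by blast
  qed
  moreover have "finite A'" "A \<subseteq> A'" using A v(2) by (simp_all add: A'_def)
  ultimately have "basic_open A' B \<noteq> {}" "\<forall>L\<in>basic_open A' B. \<not> defines_coinfinite Z \<phi> L" by blast+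
  with \<open>finite A'\<close> \<open>A \<subseteq> A'\<close> show ?thesis by (intro exI[of _ A'] conjI)
qed

text \<open>One formula at a time: enlarging A further shrinks the basic open set and loses nothing
  already achieved.\<close>

lemma avoid_formulas:
  assumes Z: "hilbertian_set Z" and B: "finite B" and \<Phi>: "finite \<Phi>"
  shows "finite A \<Longrightarrow> basic_open A B \<noteq> {} \<Longrightarrow>
    \<exists>A'. finite A' \<and> A \<subseteq> A' \<and> basic_open A' B \<noteq> {} \<and> (\<forall>\<phi>\<in>\<Phi>. \<forall>L\<in>basic_open A' B. \<not> defines_coinfinite Z \<phi> L)"
  using \<Phi>
proof (induction \<Phi> arbitrary: A rule: finite_induct)
  case empty
  then show ?case by blast
next
  case (insert \<phi> \<Phi>)
  obtain A1 where A1: "finite A1" "A \<subseteq> A1" "basic_open A1 B \<noteq> {}" "\<forall>L\<in>basic_open A1 B. \<not> defines_coinfinite Z \<phi> L"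
    using avoid_formula[OF Z insert.prems(1) B insert.prems(2), where \<phi> = \<phi>] by (elim exE conjE) (rule that; assumption)
  obtain A2 where A2: "finite A2" "A1 \<subseteq> A2" "basic_open A2 B \<noteq> {}"
    "\<forall>\<phi>\<in>\<Phi>. \<forall>L\<in>basic_open A2 B. \<not> defines_coinfinite Z \<phi> L" using insert.IH[OF A1(1,3)] by (elim exE conjE) (rule that; assumption)
  have "basic_open A2 B \<subseteq> basic_open A1 B" using A2(2) by (auto simp: basic_open_def)
  then have "\<forall>\<psi>\<in>insert \<phi> \<Phi>. \<forall>L\<in>basic_open A2 B. \<not> defines_coinfinite Z \<psi> L" using A1(4) A2(4) by blast
  moreover have "A \<subseteq> A2" using A1(2) A2(2) by (rule subset_trans)
  ultimately show ?case using A2(1,3) by (intro exI[of _ A2] conjI)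
qed

text \<open>An open set V inside the closure pulls back to a set containing a basic open set.
  Shrinking that set so as to avoid all conjugates of the formula leaves a nonempty set, whose image
  is open and consists of points of the closure, hence meets the set of classes. A representative
  that realises the formula is then conjugate to a member of the shrunken set, which realises a
  conjugate formula, a contradiction.\<close>

lemma nowhere_dense_formula:
  assumes Z: "hilbertian_set Z"
  shows "nowhere_dense_in qbar_iso_topology {iso_class L | L. L \<in> qbar_subfields \<and> defines_coinfinite Z \<phi> L}"
  (is "nowhere_dense_in _ ?N")
  unfolding nowhere_dense_in_def
proof
  show "?N \<subseteq> topspace qbar_iso_topology" unfolding topspace_iso by (rule subsetI) (elim CollectE exE conjE, simp only: imageI)
  define V where "V = qbar_iso_topology interior_of (qbar_iso_topology closure_of ?N)"
  have V: "openin qbar_iso_topology V" "V \<subseteq> qbar_iso_topology closure_of ?N"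
    unfolding V_def by (rule openin_interior_of, rule interior_of_subset)
  show "V = {}"
  proof (rule ccontr)
    assume "V \<noteq> {}"
    then obtain c where c: "c \<in> V" by blast
    have op: "openin qbar_subfield_topology {L \<in> qbar_subfields. iso_class L \<in> V}"
      and "V \<subseteq> iso_class ` qbar_subfields" using V(1) unfolding openin_iso_iff by (rule conjunct2, rule conjunct1)
    then obtain L0 where L0: "L0 \<in> {L \<in> qbar_subfields. iso_class L \<in> V}" using c by blast
    obtain A B where AB: "finite A" "finite B" "L0 \<in> basic_open A B"
      "basic_open A B \<subseteq> {L \<in> qbar_subfields. iso_class L \<in> V}"
      using bspec[OF conjunct2[OF iffD1[OF openin_subfields_iff op]] L0]
      by (elim exE conjE) (rule that; assumption)
    define \<Phi> where "\<Phi> = {map_qf_formula \<tau> \<phi> | \<tau>. automorphism \<tau>}"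
    have fin: "finite \<Phi>" unfolding \<Phi>_def by (rule finite_conjugate_formulas)
    have ne: "basic_open A B \<noteq> {}" using AB(3) by blast
    obtain A' where A': "finite A'" "A \<subseteq> A'" "basic_open A' B \<noteq> {}"
      "\<forall>\<phi>\<in>\<Phi>. \<forall>L\<in>basic_open A' B. \<not> defines_coinfinite Z \<phi> L"
      using avoid_formulas[OF Z AB(2) fin AB(1) ne] by (elim exE conjE) (rule that; assumption)
    obtain L1 where L1: "L1 \<in> basic_open A' B" using A'(3) by blast
    have "basic_open A' B \<subseteq> basic_open A B" using A'(2) by (auto simp: basic_open_def)
    then have "iso_class L1 \<in> V" using L1 AB(4) by blast
    then have "iso_class L1 \<in> qbar_iso_topology closure_of ?N" by (rule subsetD[OF V(2)])
    then have "\<exists>y. y \<in> ?N \<and> y \<in> S" if "iso_class L1 \<in> S" "openin qbar_iso_topology S" for S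
      using that by (simp only: in_closure_of simp_thms)
    from this[OF imageI[OF L1] openin_iso_basic[OF A'(1) AB(2)]]
    obtain L where L: "L \<in> qbar_subfields" "defines_coinfinite Z \<phi> L" and "iso_class L \<in> iso_class ` basic_open A' B"
      by blast
    then obtain L2 where L2: "L2 \<in> basic_open A' B" "iso_class L = iso_class L2" by blast
    have "subfld L" using L(1) by (simp add: qbar_subfields_def)
    have "subfld L2" using L2(1) by (simp add: basic_open_def)
    then obtain \<tau> where \<tau>: "automorphism \<tau>" "\<tau> ` L = L2" using iffD1[OF iso_class_eq_iff[OF \<open>subfld L\<close>] L2(2)] by blast
    then have "defines_coinfinite Z (map_qf_formula \<tau> \<phi>) L2" using defines_coinfinite_automorphism[OF \<tau>(1) L(2)] by simp
    moreover have "map_qf_formula \<tau> \<phi> \<in> \<Phi>" using \<tau>(1) by (auto simp: \<Phi>_def)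
    ultimately show False using A'(4) L2(1) by blast
  qed
qed

instance rterm :: (countable) countable by countable_datatype
instance qf_formula :: (countable) countable by countable_datatype

lemma countable_formulas: "countable (UNIV :: qbar qf_formula set)"
proof -
  have "inj (to_nat_on (UNIV :: qbar set))" using countable_qbar by (rule inj_on_to_nat_on)
  then have "inj (map_qf_formula (to_nat_on (UNIV :: qbar set)))" by (rule qf_formula.inj_map)
  then show ?thesis by (rule countable_image_inj_on[rotated]) (simp add: countableI_type)
qed

theorem theorem5p17:
  fixes Z :: "rat set"
  assumes "\<not> thin 1 ((\<lambda>q. [q]) ` Z)"
  shows "meager_in qbar_iso_topology
    {iso_class L | L. L \<in> qbar_subfields \<and>
       (\<exists>C. C \<subseteq> L \<and> infinite (L - C) \<and> universally_definable L C \<and> C \<inter> \<rat> = of_rat ` Z)}"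
proof -
  \<comment> \<open>Since \<open>defines_coinfinite\<close> itself demands that the parameters lie
    in L, the formulas with parameters anywhere in \<open>qbar\<close> serve as one countable index
    set for all L.\<close>
  define N where "N \<phi> = {iso_class L | L. L \<in> qbar_subfields \<and> defines_coinfinite Z \<phi> L}" for \<phi>
  have "nowhere_dense_in qbar_iso_topology (N \<phi>)" for \<phi>
    unfolding N_def using not_thin_imp_hilbertian_set[OF assms] by (rule nowhere_dense_formula)
  then have "\<forall>S\<in>range N. nowhere_dense_in qbar_iso_topology S" by blast
  moreover have "countable (range N)" using countable_formulas by simp
  moreover have "{iso_class L | L. L \<in> qbar_subfields \<and>
       (\<exists>C. C \<subseteq> L \<and> infinite (L - C) \<and> universally_definable L C \<and> C \<inter> \<rat> = of_rat ` Z)} = \<Union>(range N)"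
  proof -
    have "(\<exists>C. C \<subseteq> L \<and> infinite (L - C) \<and> universally_definable L C \<and> C \<inter> \<rat> = of_rat ` Z) \<longleftrightarrow>
      (\<exists>\<phi>. defines_coinfinite Z \<phi> L)" for L
    proof
      assume "\<exists>C. C \<subseteq> L \<and> infinite (L - C) \<and> universally_definable L C \<and> C \<inter> \<rat> = of_rat ` Z"
      then obtain C \<phi> where "infinite (L - C)" "C \<inter> \<rat> = of_rat ` Z" "qf_params \<phi> \<subseteq> L" "C = defined_set \<phi> L"
        unfolding universally_definable_def defined_set_def[symmetric] by (elim exE conjE) (rule that; assumption)
      then have "defines_coinfinite Z \<phi> L" by (simp add: defines_coinfinite_def)
      then show "\<exists>\<phi>. defines_coinfinite Z \<phi> L" ..
    next
      assume "\<exists>\<phi>. defines_coinfinite Z \<phi> L"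
      then obtain \<phi> where D: "defines_coinfinite Z \<phi> L" ..
      have "universally_definable L (defined_set \<phi> L)"
        unfolding universally_definable_def defined_set_def[symmetric]
        using D by (intro exI[of _ \<phi>]) (simp add: defines_coinfinite_def)
      moreover have "defined_set \<phi> L \<subseteq> L" by (simp add: defined_set_def)
      ultimately show "\<exists>C. C \<subseteq> L \<and> infinite (L - C) \<and> universally_definable L C \<and> C \<inter> \<rat> = of_rat ` Z"
        using D by (intro exI[of _ "defined_set \<phi> L"]) (simp add: defines_coinfinite_def)
    qed
    then show ?thesis unfolding N_def by (simp only:) blast
  qed
  ultimately show ?thesis unfolding meager_in_def by (intro exI[of _ "range N"] conjI)
qed

end
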